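(* Let $S$ be a nonempty, bounded, closed and convex subset of a generalized Banach algebra $X$. Assume that $A,C:X\to X$ and $B:S\to X$ are three operators satisfying the following conditions: (i) $A$ is regular, i.e. $A$ takes values in the set of invertible elements of $X$; (ii) $B$ and $\left(I-\frac{I-C}{A}\right)$ are an $M_1$-$\mu$-contraction and an $M_2$-$\mu$-contraction respectively; (iii) $B$ and $\frac{I-C}{A}$ are weakly sequentially continuous; (iv) $\left(\frac{I-C}{A}\right)^{-1}$ exists on $B(S)$; (v) if $y\in S$ and $x=Ax\cdot By+Cx$, then $x\in S$. If $(I-M_2)^{-1}M_1$ is a matrix converging to zero, then the operator equation $x=Ax\cdot Bx+Cx$ has at least one solution $x\in S$.
   Context: $\mathbb{R}^n$ is ordered componentwise. A generalized Banach space (in the sense of Perov) is a real vector space $X$ with a vector-valued norm $\|\cdot\|=(\|\cdot\|_1,\dots,\|\cdot\|_n):X\to\mathbb{R}^n_+$ ($\|x\|=0$ iff $x=0$, $\|\lambda x\|=|\lambda|\|x\|$, $\|x+y\|\le\|x\|+\|y\|$ componentwise), complete for the topology given by $\max_i\|x\|_i$. A generalized Banach algebra is a generalized Banach space that is an algebra with $\|x\cdot y\|_i\le\|x\|_i\|y\|_i$ for all $i$ and all $x,y$; it has a unit whenever invertible elements are mentioned. The weak topology of $X$ is the coarsest topology making all continuous linear functionals continuous; $\rightharpoonup$ is weak convergence. A map $T$ is weakly sequentially continuous if $x_k\rightharpoonup x$ (in its domain) implies $Tx_k\rightharpoonup Tx$. A square nonnegative matrix converges to zero if its spectral radius is $<1$.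 For $r\in\mathbb{R}^n_+$, $B_r=\{x\in X:\|x\|\le r\}$; for a nonempty bounded $V\subseteq X$, $$\mu(V)=\inf\{r\in\mathbb{R}^n_+:\ \text{there is a weakly compact } K\subseteq X \text{ with } V\subseteq K+B_r\}$$ (componentwise infimum). An operator $T$ is an $M$-$\mu$-contraction ($M$-set contraction with respect to $\mu$), where $M\in\mathcal{M}_{n\times n}(\mathbb{R}_+)$ is a matrix converging to zero, if $T$ maps bounded sets to bounded sets and $\mu(T(V))\le M\mu(V)$ for every bounded subset $V$ of its domain. For $A$ regular, $\frac{I-C}{A}$ is the operator sending $x$ to the unique element $z$ with $Ax\cdot z=x-Cx$; saying $\left(\frac{I-C}{A}\right)^{-1}$ exists on $B(S)$ means that for each $z\in B(S)$ there is exactly one $x\in X$ with $\left(\frac{I-C}{A}\right)x=z$. *)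

theory Defs
  imports "HOL-Analysis.Analysis"
begin

text \<open>
  The order on \<open>real ^ 'n\<close> is the componentwise one, and \<open>Inf\<close> on \<open>real ^ 'n\<close> is the
  componentwise infimum. A generalized Banach space is the type \<open>'a\<close> together with an explicit
  vector-valued norm \<open>N\<close>; it carries no topological type class, so its topologies are given as
  values of type \<open>'a topology\<close>.
\<close>

definition max_dist :: "('a::real_vector \<Rightarrow> real ^ 'n) \<Rightarrow> 'a \<Rightarrow> 'a \<Rightarrow> real" where
  "max_dist N x y = Max (range (\<lambda>i. N (x - y) $ i))"

definition strong_top :: "('a::real_vector \<Rightarrow> real ^ 'n) \<Rightarrow> 'a topology" where
  "strong_top N = Metric_space.mtopology UNIV (max_dist N)"

locale generalized_banach_space =
  fixes N :: "'a::real_vector \<Rightarrow> real ^ 'n"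
  assumes vnorm_nonneg: "0 \<le> N x"
    and vnorm_eq_0_iff: "N x = 0 \<longleftrightarrow> x = 0"
    and vnorm_scaleR: "N (c *\<^sub>R x) = \<bar>c\<bar> *\<^sub>R N x"
    and vnorm_triangle: "N (x + y) \<le> N x + N y"
    and vnorm_complete: "Metric_space.mcomplete UNIV (max_dist N)"

locale generalized_banach_algebra = generalized_banach_space N
  for N :: "'a::real_algebra \<Rightarrow> real ^ 'n" +
  assumes vnorm_mult: "N (x * y) $ i \<le> N x $ i * N y $ i"

text \<open>
  The unit is an explicit element, since \<open>real_algebra_1\<close> would exclude the zero algebra.
\<close>

definition unit_elem :: "'a::real_algebra \<Rightarrow> bool" where
  "unit_elem e \<longleftrightarrow> (\<forall>x. e * x = x \<and> x * e = x)"

definition invertible_elem :: "'a::real_algebra \<Rightarrow> 'a \<Rightarrow> bool" where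
  "invertible_elem e x \<longleftrightarrow> (\<exists>y. x * y = e \<and> y * x = e)"

definition weak_top :: "('a::real_vector \<Rightarrow> real ^ 'n) \<Rightarrow> 'a topology" where
  "weak_top N = topology_generated_by
     {f -` U | (f :: 'a \<Rightarrow> real) U. linear f \<and> continuous_map (strong_top N) euclideanreal f \<and> open U}"

definition weakly_seq_continuous_on ::
    "('a::real_vector \<Rightarrow> real ^ 'n) \<Rightarrow> 'a set \<Rightarrow> ('a \<Rightarrow> 'a) \<Rightarrow> bool" where
  "weakly_seq_continuous_on N D T \<longleftrightarrow>
     (\<forall>s x. range s \<subseteq> D \<and> x \<in> D \<and> limitin (weak_top N) s x sequentially \<longrightarrow>
        limitin (weak_top N) (\<lambda>k. T (s k)) (T x) sequentially)"

definition vbounded :: "('a::real_vector \<Rightarrow> real ^ 'n) \<Rightarrow> 'a set \<Rightarrow> bool" where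
  "vbounded N V \<longleftrightarrow> (\<exists>r. \<forall>x\<in>V. N x \<le> r)"

definition vball :: "('a::real_vector \<Rightarrow> real ^ 'n) \<Rightarrow> real ^ 'n \<Rightarrow> 'a set" where
  "vball N r = {x. N x \<le> r}"

definition mu :: "('a::real_vector \<Rightarrow> real ^ 'n) \<Rightarrow> 'a set \<Rightarrow> real ^ 'n" where
  "mu N V = Inf {r. 0 \<le> r \<and>
     (\<exists>K. compactin (weak_top N) K \<and> V \<subseteq> {k + b | k b. k \<in> K \<and> b \<in> vball N r})}"

text \<open>The eigenvalues are the complex ones.\<close>

definition mat_spectral_radius :: "real ^ 'n ^ 'n \<Rightarrow> real" where
  "mat_spectral_radius M =
     Max {cmod l | l. \<exists>v. v \<noteq> 0 \<and> map_matrix complex_of_real M *v v = l *s v}"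

definition converges_to_zero :: "real ^ 'n ^ 'n \<Rightarrow> bool" where
  "converges_to_zero M \<longleftrightarrow> mat_spectral_radius M < 1"

definition mu_contraction_on ::
    "('a::real_vector \<Rightarrow> real ^ 'n) \<Rightarrow> 'a set \<Rightarrow> real ^ 'n ^ 'n \<Rightarrow> ('a \<Rightarrow> 'a) \<Rightarrow> bool" where
  "mu_contraction_on N D M T \<longleftrightarrow>
     (\<forall>i j. 0 \<le> M $ i $ j) \<and> converges_to_zero M \<and>
     (\<forall>V. V \<subseteq> D \<and> vbounded N V \<longrightarrow> vbounded N (T ` V)) \<and>
     (\<forall>V. V \<subseteq> D \<and> V \<noteq> {} \<and> vbounded N V \<longrightarrow> mu N (T ` V) \<le> M *v mu N V)"

text \<open>The operator \<open>(I - C) / A\<close>; it is meaningful when all \<open>A x\<close> are invertible.\<close>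

definition quot_op :: "('a::real_algebra \<Rightarrow> 'a) \<Rightarrow> ('a \<Rightarrow> 'a) \<Rightarrow> 'a \<Rightarrow> 'a" where
  "quot_op A C x = (THE z. A x * z = x - C x)"

end

theory Submission
  imports Defs
begin

text \<open>
  With \<open>F = (I - C)/A\<close>, a solution is a fixed point of \<open>T = F\<inverse> \<circ> B\<close>, which maps \<open>S\<close> into itself.
  Since \<open>T y = B y + (I - F) (T y)\<close>, one has \<open>mu (T V) \<le> M1 (mu V) + M2 (mu (T V))\<close>. In particular
  \<open>mu V = 0\<close> forces \<open>mu (T V) = 0\<close>, so the images of a weakly convergent sequence have weakly
  convergent subsequences, and \<open>T\<close> is weakly sequentially continuous.

  Let \<open>Q\<close> be the smallest set that contains a point \<open>x0\<close> of \<open>S\<close> and is closed under \<open>T\<close> and under rational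
  convex combinations. It is countable and contained in the convex hull of \<open>T Q \<union> {x0}\<close>, so
  Krein's theorem gives \<open>mu Q \<le> mu (T Q)\<close>, whence \<open>mu Q = 0\<close>. The closure of \<open>Q\<close> is therefore
  convex, weakly compact, separable and invariant under \<open>T\<close>, and Schauder's argument yields a
  fixed point. Working with a countable \<open>Q\<close> makes all weak compactness arguments sequential.

  Each component of \<open>mu\<close> is an infimum of its own, so \<open>mu V = 0\<close> only provides approximating weakly compact sets
  that depend on the component. Hahn-Banach in the product space \<open>'a ^ 'n\<close> produces
  convex combinations that are close to all of them at once.
\<close>

section \<open>Linear functionals below sublinear functionals\<close>

text \<open>The hypotheses on \<open>B\<close> and \<open>F\<close> are sequential, while the weak
  topology is in general not described by sequences. Separability is the bridge. In the norm closure
  of a countable set, countably many functionals separate points; a diagonal choice then turns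
  limits along an ultrafilter into limits of subsequences, and weak sequential compactness into weak
  compactness. Ultrafilters supply the candidates, since every bounded real sequence converges along
  them.

  All functionals come from one Hahn-Banach statement, \<open>mazur_orlicz\<close>, whose conclusion
  includes a lower bound on a convex set.

  The term with \<open>M2\<close> in the estimate for \<open>T\<close> carries
  \<open>mu (T V)\<close> instead of \<open>mu V\<close>, because \<open>I - F\<close> is evaluated
  at points of the image. It can be absorbed because the inverse of \<open>mat 1 - M2\<close> is
  nonnegative, which leaves an inequality governed by the matrix that is assumed to converge to
  zero.

  The uniqueness in (iv) is what identifies weak limits: once \<open>F z = B x\<close> is known for
  a limit \<open>z\<close>, it must be \<open>T x\<close>.\<close>

definition sublinear :: "('v::real_vector \<Rightarrow> real) \<Rightarrow> bool" where
  "sublinear q \<longleftrightarrow> (\<forall>x y. q (x + y) \<le> q x + q y) \<and> (\<forall>c x. 0 \<le> c \<longrightarrow> q (c *\<^sub>R x) = c * q x)"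

lemma sublinear_add: "sublinear q \<Longrightarrow> q (x + y) \<le> q x + q y"
  and sublinear_scale: "sublinear q \<Longrightarrow> 0 \<le> c \<Longrightarrow> q (c *\<^sub>R x) = c * q x"
  by (auto simp: sublinear_def)

lemma sublinear_zero: "sublinear q \<Longrightarrow> q 0 = 0"
  using sublinear_scale[of q 0 0] by simp

lemma sublinear_ge: "sublinear q \<Longrightarrow> - q (- x) \<le> q x"
  using sublinear_add[of q x "- x"] sublinear_zero[of q] by simp

text \<open>Used at \<open>1 / c\<close> and \<open>c *\<^sub>R x\<close>, the upper bound in the
  second assumption becomes the lower bound. Functionals defined as infima then need checking in one
  direction only.\<close>

lemma sublinearI_inequality:
  assumes "\<And>x y. q (x + y) \<le> q x + q y" "\<And>c x. 0 < c \<Longrightarrow> q (c *\<^sub>R x) \<le> c * q x" "q 0 = 0"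
  shows "sublinear q"
  unfolding sublinear_def
proof (intro conjI allI impI)
  fix c :: real and x assume "0 \<le> c"
  show "q (c *\<^sub>R x) = c * q x"
  proof (cases "c = 0")
    case False
    with \<open>0 \<le> c\<close> have c: "0 < c" by simp
    then have "q ((1 / c) *\<^sub>R c *\<^sub>R x) \<le> (1 / c) * q (c *\<^sub>R x)"
      by (intro assms) simp
    then have "c * q x \<le> q (c *\<^sub>R x)" using c by (simp add: field_simps)
    then show ?thesis using assms(2)[OF c, of x] by simp
  qed (simp add: assms)
qed (fact assms)

text \<open>The infimum of \<open>q (x + t *\<^sub>R d) - t * \<delta>\<close> over
  \<open>t \<ge> 0\<close> and \<open>d \<in> D\<close> is the largest sublinear functional below
  \<open>q\<close> with the required bound at \<open>- d\<close>. A linear functional below it is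
  automatically at least \<delta> on \<open>D\<close>.\<close>

lemma sublinear_lower:
  assumes q: "sublinear q" and D: "convex D" "D \<noteq> {}" and \<delta>: "\<And>d. d \<in> D \<Longrightarrow> \<delta> \<le> q d"
  obtains q' where "sublinear q'" "\<And>x. q' x \<le> q x" "\<And>d. d \<in> D \<Longrightarrow> q' (- d) \<le> - \<delta>"
proof -
  define Y where "Y x = (\<lambda>(t, d). q (x + t *\<^sub>R d) - t * \<delta>) ` ({0..} \<times> D)" for x
  define q' where "q' x = Inf (Y x)" for x
  \<comment> \<open>The infimum is finite because
    \<open>t * \<delta> \<le> q (t *\<^sub>R d)\<close>; this is where the bound on \<open>D\<close>
    enters.\<close>
  have ge: "- q (- x) \<le> y" if yY: "y \<in> Y x" for x y
  proof -
    obtain t d where y: "y = q (x + t *\<^sub>R d) - t * \<delta>" "0 \<le> t" "d \<in> D"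
      using yY by (auto simp: Y_def)
    have "t * \<delta> \<le> q (t *\<^sub>R d)"
      using y \<delta> q by (simp add: sublinear_scale mult_left_mono)
    also have "\<dots> \<le> q (x + t *\<^sub>R d) + q (- x)"
      using sublinear_add[OF q, of "x + t *\<^sub>R d" "- x"] by simp
    finally show ?thesis using y by simp
  qed
  then have bdd: "bdd_below (Y x)" for x by (meson bdd_belowI)
  have ne: "Y x \<noteq> {}" for x using D by (auto simp: Y_def)
  have le: "q' x \<le> q (x + t *\<^sub>R d) - t * \<delta>" if "0 \<le> t" "d \<in> D" for x t d
    unfolding q'_def using that by (intro cInf_lower bdd) (force simp: Y_def)
  obtain d0 where "d0 \<in> D" using D by auto
  have leq: "q' x \<le> q x" for x using le[of 0 d0 x] \<open>d0 \<in> D\<close> by simp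
  have "q' (- d) \<le> - \<delta>" if "d \<in> D" for d
    using le[of 1 d "- d"] that sublinear_zero[OF q] by simp
  moreover have "sublinear q'"
  proof (rule sublinearI_inequality)
    fix x y
    have "q' (x + y) \<le> a + b" if "a \<in> Y x" "b \<in> Y y" for a b
    proof -
      obtain t d where a: "a = q (x + t *\<^sub>R d) - t * \<delta>" "0 \<le> t" "d \<in> D"
        using \<open>a \<in> Y x\<close> by (auto simp: Y_def)
      obtain s e where b: "b = q (y + s *\<^sub>R e) - s * \<delta>" "0 \<le> s" "e \<in> D"
        using \<open>b \<in> Y y\<close> by (auto simp: Y_def)
      \<comment> \<open>Convexity merges the two directions: a nonnegative combination of points of
        \<open>D\<close> is a multiple of one point of \<open>D\<close>.\<close>
      obtain w where w: "w \<in> D" "(t + s) *\<^sub>R w = t *\<^sub>R d + s *\<^sub>R e"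
      proof (cases "t + s = 0")
        case True
        then have "t = 0" "s = 0" using a b by auto
        then show ?thesis using that a by auto
      next
        case False
        then have "(t / (t + s)) *\<^sub>R d + (s / (t + s)) *\<^sub>R e \<in> D"
          using a b by (intro convexD[OF D(1)]) (auto simp: add_divide_distrib[symmetric])
        with False that show ?thesis by (force simp: scaleR_right_distrib)
      qed
      have "q' (x + y) \<le> q ((x + y) + (t + s) *\<^sub>R w) - (t + s) * \<delta>"
        using w a b by (intro le) auto
      also have "(x + y) + (t + s) *\<^sub>R w = (x + t *\<^sub>R d) + (y + s *\<^sub>R e)"
        using w by (simp add: algebra_simps)
      also have "q \<dots> \<le> q (x + t *\<^sub>R d) + q (y + s *\<^sub>R e)" by (rule sublinear_add[OF q])
      finally show ?thesis using a b by (simp add: algebra_simps)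
    qed
    then have "q' (x + y) - b \<le> q' x" if "b \<in> Y y" for b
      unfolding q'_def[of x] using that by (intro cInf_greatest ne) (simp add: algebra_simps)
    then have "q' (x + y) - q' x \<le> q' y"
      unfolding q'_def[of y] by (intro cInf_greatest ne) (simp add: algebra_simps)
    then show "q' (x + y) \<le> q' x + q' y" by simp
  next
    fix c :: real and x assume c: "0 < c"
    have "q' (c *\<^sub>R x) / c \<le> a" if "a \<in> Y x" for a
    proof -
      obtain t d where a: "a = q (x + t *\<^sub>R d) - t * \<delta>" "0 \<le> t" "d \<in> D"
        using \<open>a \<in> Y x\<close> by (auto simp: Y_def)
      have "q' (c *\<^sub>R x) \<le> q (c *\<^sub>R x + (c * t) *\<^sub>R d) - (c * t) * \<delta>"
        using a c by (intro le) auto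
      also have "c *\<^sub>R x + (c * t) *\<^sub>R d = c *\<^sub>R (x + t *\<^sub>R d)" by (simp add: algebra_simps)
      also have "q \<dots> = c * q (x + t *\<^sub>R d)" using q c by (simp add: sublinear_scale)
      finally have "q' (c *\<^sub>R x) \<le> c * a" unfolding a(1) by (simp add: right_diff_distrib)
      then show ?thesis using c by (simp add: field_simps)
    qed
    then have "q' (c *\<^sub>R x) / c \<le> q' x"
      unfolding q'_def[of x] by (intro cInf_greatest ne)
    then show "q' (c *\<^sub>R x) \<le> c * q' x" using c by (simp add: field_simps)
  next
    have "- q (- 0) \<le> q' 0" unfolding q'_def by (intro cInf_greatest ne ge)
    then show "q' 0 = 0" using leq[of 0] sublinear_zero[OF q] by simp
  qed
  ultimately show ?thesis using leq that by blast
qed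

text \<open>A minimal sublinear functional \<open>f\<close> below \<open>q\<close> is linear:
  lowering it at \<open>- y\<close> to \<open>- f y\<close> by \<open>sublinear_lower\<close> leaves
  it unchanged, which forces additivity. Zorn's lemma supplies the minimal one.\<close>

lemma sublinear_dominates_linear:
  assumes q: "sublinear q"
  obtains f where "linear f" "\<And>x. f x \<le> q x"
proof -
  define A where "A = {g. sublinear g \<and> g \<le> q}"
  have "\<exists>m\<in>A. \<forall>a\<in>A. a \<le> m \<longrightarrow> a = m"
  proof (rule predicate_Zorn)
    show "partial_order_on A (relation_of (\<lambda>x y. y \<le> x) A)"
      by (rule partial_order_on_relation_ofI) auto
  next
    fix C assume C: "C \<in> Chains (relation_of (\<lambda>x y. y \<le> x) A)"
    show "\<exists>u\<in>A. \<forall>a\<in>C. u \<le> a"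
    proof (cases "C = {}")
      case True
      then show ?thesis using q by (auto simp: A_def)
    next
      case False
      have CA: "g \<in> A" if "g \<in> C" for g
        using C that by (auto simp: Chains_def relation_of_def)
      have chain: "g \<le> h \<or> h \<le> g" if "g \<in> C" "h \<in> C" for g h
        using C that by (auto simp: Chains_def relation_of_def)
      have sub: "sublinear g" if "g \<in> C" for g using CA[OF that] by (simp add: A_def)
      have gq: "g x \<le> q x" if "g \<in> C" for g x using CA[OF that] by (simp add: A_def le_fun_def)
      \<comment> \<open>The pointwise infimum of a chain is finite, with lower bound
        \<open>- q (- x)\<close>. It is subadditive since any two members of the chain lie above a
        common member.\<close>
      define u where "u x = (INF g\<in>C. g x)" for x
      have ge: "- q (- x) \<le> g x" if "g \<in> C" for g x
        using sublinear_ge[OF sub[OF that], of x] gq[OF that, of "- x"] by simp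
      have bdd: "bdd_below ((\<lambda>g. g x) ` C)" for x using ge by (meson bdd_belowI2)
      have ul: "u x \<le> g x" if "g \<in> C" for g x unfolding u_def by (intro cINF_lower bdd that)
      have "sublinear u"
      proof (rule sublinearI_inequality)
        fix x y
        have "u (x + y) \<le> g x + h y" if gh: "g \<in> C" "h \<in> C" for g h
        proof -
          obtain l where l: "l \<in> C" "l \<le> g" "l \<le> h" using chain[OF gh] gh by auto
          have "u (x + y) \<le> l x + l y" using ul[OF l(1), of "x + y"] sublinear_add[OF sub[OF l(1)], of x y] by simp
          also have "\<dots> \<le> g x + h y" using l by (intro add_mono) (auto simp: le_fun_def)
          finally show ?thesis .
        qed
        then have "u (x + y) - h y \<le> u x" if "h \<in> C" for h
          unfolding u_def[of x] using that False by (intro cINF_greatest) (auto simp: algebra_simps)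
        then have "u (x + y) - u x \<le> u y"
          unfolding u_def[of y] using False by (intro cINF_greatest) (auto simp: algebra_simps)
        then show "u (x + y) \<le> u x + u y" by simp
      next
        fix c :: real and x assume c: "0 < c"
        have "u (c *\<^sub>R x) / c \<le> g x" if "g \<in> C" for g
          using ul[OF that, of "c *\<^sub>R x"] sublinear_scale[OF sub[OF that], of c x] c by (simp add: field_simps)
        then have "u (c *\<^sub>R x) / c \<le> u x"
          unfolding u_def[of x] using False by (intro cINF_greatest) auto
        then show "u (c *\<^sub>R x) \<le> c * u x" using c by (simp add: field_simps)
      next
        have "(\<lambda>g. g 0) ` C = {0}" using False sublinear_zero[OF sub] by force
        then show "u 0 = 0" by (simp add: u_def)
      qed
      moreover obtain g0 where "g0 \<in> C" using False by auto
      moreover have "u x \<le> q x" for x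
        using ul[OF \<open>g0 \<in> C\<close>, of x] gq[OF \<open>g0 \<in> C\<close>, of x] by simp
      ultimately show ?thesis
        using ul by (intro bexI[of _ u]) (auto simp: A_def le_fun_def)
    qed
  qed
  then obtain f where f: "f \<in> A" "\<And>a. a \<in> A \<Longrightarrow> a \<le> f \<Longrightarrow> a = f" by auto
  have sf: "sublinear f" and fq: "f \<le> q" using f by (auto simp: A_def)
  have add: "f (x + y) = f x + f y" for x y
  proof -
    obtain g where g: "sublinear g" "\<And>x. g x \<le> f x" "g (- y) \<le> - f y"
      using sublinear_lower[OF sf, of "{y}" "f y"] by auto
    then have "g = f" using fq by (intro f(2)) (auto simp: A_def le_fun_def intro: order_trans)
    then have "f x \<le> f (x + y) - f y"
      using g(3) sublinear_add[OF sf, of "x + y" "- y"] by simp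
    then show ?thesis using sublinear_add[OF sf, of x y] by simp
  qed
  have minus: "f (- x) = - f x" for x using add[of x "- x"] sublinear_zero[OF sf] by simp
  have "linear f"
  proof (rule linearI)
    fix c x show "f (c *\<^sub>R x) = c *\<^sub>R f x"
      using sublinear_scale[OF sf, of c x] sublinear_scale[OF sf, of "- c" x] minus[of "c *\<^sub>R x"]
      by (cases "0 \<le> c") auto
  qed (fact add)
  then show ?thesis using fq that by (auto simp: le_fun_def)
qed

text \<open>With a single point for \<open>D\<close> this gives norming functionals, with a
  translated convex set strict separation, and with a convex set in a product space bounds for
  several functionals at once.\<close>

theorem mazur_orlicz:
  assumes "sublinear q" "convex D" "D \<noteq> {}" "\<And>d. d \<in> D \<Longrightarrow> \<delta> \<le> q d"
  obtains f where "linear f" "\<And>x. f x \<le> q x" "\<And>d. d \<in> D \<Longrightarrow> \<delta> \<le> f d"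
proof -
  obtain q' where q': "sublinear q'" "\<And>x. q' x \<le> q x" "\<And>d. d \<in> D \<Longrightarrow> q' (- d) \<le> - \<delta>"
    using sublinear_lower[OF assms] by blast
  obtain f where f: "linear f" "\<And>x. f x \<le> q' x" using sublinear_dominates_linear[OF q'(1)] by blast
  show ?thesis
  proof
    show "f x \<le> q x" for x using f(2) q'(2) order_trans by blast
    show "\<delta> \<le> f d" if "d \<in> D" for d
      using f(2)[of "- d"] q'(3)[OF that] linear_neg[OF f(1), of d] by simp
  qed (fact f)
qed

section \<open>Ultrafilters\<close>

definition ultrafilter :: "'b filter \<Rightarrow> bool" where
  "ultrafilter U \<longleftrightarrow> U \<noteq> bot \<and> (\<forall>P. eventually P U \<or> eventually (\<lambda>x. \<not> P x) U)"

text \<open>A minimal proper filter decides every predicate: its meet with a principal filter is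
  either trivial or the filter itself.\<close>

lemma ultrafilter_exists:
  assumes "F \<noteq> (bot :: 'b filter)"
  obtains U where "ultrafilter U" "U \<le> F"
proof -
  define A where "A = {G. G \<noteq> bot \<and> G \<le> F}"
  have "\<exists>m\<in>A. \<forall>a\<in>A. a \<le> m \<longrightarrow> a = m"
  proof (rule predicate_Zorn)
    show "partial_order_on A (relation_of (\<lambda>x y. y \<le> x) A)"
      by (rule partial_order_on_relation_ofI) auto
  next
    fix C assume C: "C \<in> Chains (relation_of (\<lambda>x y. y \<le> x) A)"
    show "\<exists>u\<in>A. \<forall>a\<in>C. u \<le> a"
    proof (cases "C = {}")
      case True
      then show ?thesis using assms by (auto simp: A_def)
    next
      case False
      have CA: "g \<in> A" if "g \<in> C" for g
        using C that by (auto simp: Chains_def relation_of_def)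
      have chain: "g \<le> h \<or> h \<le> g" if "g \<in> C" "h \<in> C" for g h
        using C that by (auto simp: Chains_def relation_of_def)
      have "\<exists>x\<in>C. x \<le> inf a b" if "a \<in> C" "b \<in> C" for a b
        using chain[OF that] that by auto
      then have "eventually P (Inf C) \<longleftrightarrow> (\<exists>b\<in>C. eventually P b)" for P
        using False by (intro eventually_Inf_base) auto
      then have "Inf C \<noteq> bot" using CA by (auto simp: A_def trivial_limit_def)
      moreover have "Inf C \<le> F"
        using False CA by (auto simp: A_def intro: Inf_lower2)
      ultimately show ?thesis by (intro bexI[of _ "Inf C"]) (auto simp: A_def intro: Inf_lower)
    qed
  qed
  then obtain U where U: "U \<in> A" "\<And>a. a \<in> A \<Longrightarrow> a \<le> U \<Longrightarrow> a = U" by auto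
  have "eventually P U \<or> eventually (\<lambda>x. \<not> P x) U" for P
  proof (cases "inf U (principal {x. P x}) = bot")
    case True
    then show ?thesis by (auto simp: trivial_limit_def eventually_inf_principal)
  next
    case False
    then have "inf U (principal {x. P x}) = U"
      using U(1) by (intro U(2)) (auto simp: A_def intro: le_infI1)
    then have "eventually P U" using eventually_inf_principal[of P U "{x. P x}"] by simp
    then show ?thesis ..
  qed
  then show ?thesis using U that by (auto simp: ultrafilter_def A_def)
qed

lemma ultrafilter_not_eventually:
  "ultrafilter U \<Longrightarrow> \<not> eventually P U \<longleftrightarrow> eventually (\<lambda>x. \<not> P x) U"
  using eventually_conj[of P U "\<lambda>x. \<not> P x"] by (auto simp: ultrafilter_def)

lemma ultrafilter_neq_bot: "ultrafilter U \<Longrightarrow> U \<noteq> bot"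
  by (simp add: ultrafilter_def)

text \<open>If no point of \<open>K\<close> were a limit, each would have a neighbourhood that
  \<open>s\<close> eventually avoids along \<open>U\<close>, and a finite subcover would leave no
  place for \<open>s\<close>.\<close>

lemma compactin_ultrafilter_limit:
  assumes K: "compactin X K" and U: "ultrafilter U" and ev: "eventually (\<lambda>n. s n \<in> K) U"
  obtains x where "x \<in> K" "limitin X s x U"
proof -
  have "\<exists>x\<in>K. limitin X s x U"
  proof (rule ccontr)
    assume "\<not> ?thesis"
    then have "\<forall>x\<in>K. \<exists>V. openin X V \<and> x \<in> V \<and> \<not> eventually (\<lambda>n. s n \<in> V) U"
      using compactin_subset_topspace[OF K] by (auto simp: limitin_def)
    then obtain V where V: "\<And>x. x \<in> K \<Longrightarrow> openin X (V x) \<and> x \<in> V x \<and> \<not> eventually (\<lambda>n. s n \<in> V x) U"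
      by metis
    obtain \<F> where \<F>: "finite \<F>" "\<F> \<subseteq> V ` K" "K \<subseteq> \<Union>\<F>"
      using compactinD[OF K, of "V ` K"] V by blast
    have "eventually (\<lambda>n. \<forall>W\<in>\<F>. s n \<notin> W) U"
      using \<F> V ultrafilter_not_eventually[OF U] by (intro eventually_ball_finite) auto
    with ev have "eventually (\<lambda>n. False) U" by eventually_elim (use \<F> in auto)
    then show False using U by (simp add: ultrafilter_def)
  qed
  then show ?thesis using that by auto
qed

text \<open>Turns \<open>Lim U s\<close> into a genuine limit for every bounded sequence.
  Functionals can therefore be defined pointwise by \<open>Lim\<close>, before any subsequence is
  chosen.\<close>

lemma ultrafilter_bounded_limit:
  fixes s :: "'b \<Rightarrow> real"
  assumes U: "ultrafilter U" and ev: "eventually (\<lambda>n. \<bar>s n\<bar> \<le> b) U"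
  shows "(s \<longlongrightarrow> Lim U s) U"
proof -
  have "compactin euclideanreal {-b..b}" by simp
  then obtain x where "limitin euclideanreal s x U"
    by (rule compactin_ultrafilter_limit[OF _ U, where s = s])
       (use ev in \<open>auto elim!: eventually_mono simp: abs_le_iff\<close>)
  then have "(s \<longlongrightarrow> x) U" by simp
  then show ?thesis using tendsto_Lim[OF ultrafilter_neq_bot[OF U]] by blast
qed

lemma frequently_imp_strict_mono:
  assumes "\<And>k::nat. \<exists>\<^sub>F n in sequentially. P k n"
  obtains r :: "nat \<Rightarrow> nat" where "strict_mono r" "\<And>k. P k (r k)"
proof -
  have ex: "\<exists>n>m. P k n" for k m
    using assms[of k] unfolding frequently_sequentially by (meson Suc_le_lessD)
  have "\<exists>r. \<forall>k. P k (r k) \<and> r k < r (Suc k)"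
    by (rule dependent_nat_choice) (use ex in auto)
  then show ?thesis using that strict_mono_Suc_iff by metis
qed

lemma frequently_if_eventually_le:
  assumes "U \<le> F" "U \<noteq> bot" "eventually P U" shows "frequently P F"
  using assms eventually_conj[of P U "\<lambda>x. \<not> P x"] by (auto simp: frequently_def dest: filter_leD)

text \<open>A fixed free ultrafilter. It inherits every limit along \<open>sequentially\<close>, and
  what holds eventually along it holds for infinitely many indices; the second fact is how
  subsequences are recovered.\<close>

definition nat_ultrafilter :: "nat filter" where
  "nat_ultrafilter = (SOME U. ultrafilter U \<and> U \<le> sequentially)"

lemma nat_ultrafilter: "ultrafilter nat_ultrafilter" "nat_ultrafilter \<le> sequentially"
proof -
  have "\<exists>U. ultrafilter U \<and> U \<le> (sequentially :: nat filter)"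
    using ultrafilter_exists[of "sequentially :: nat filter"] by auto
  from someI_ex[OF this] show "ultrafilter nat_ultrafilter" "nat_ultrafilter \<le> sequentially"
    by (auto simp: nat_ultrafilter_def)
qed

lemma nat_ultrafilter_neq_bot [simp]: "nat_ultrafilter \<noteq> bot"
  by (rule ultrafilter_neq_bot[OF nat_ultrafilter(1)])

section \<open>Rationally convex sets\<close>

text \<open>Rational weights keep generated sets countable, while the norm closure of such a set is
  convex in the usual sense.\<close>

definition rat_convex :: "'v::real_vector set \<Rightarrow> bool" where
  "rat_convex P \<longleftrightarrow> (\<forall>x\<in>P. \<forall>y\<in>P. \<forall>t\<in>\<rat>. 0 \<le> t \<and> t \<le> 1 \<longrightarrow> (1 - t) *\<^sub>R x + t *\<^sub>R y \<in> P)"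

lemma convex_imp_rat_convex: "convex P \<Longrightarrow> rat_convex P"
  by (auto simp: rat_convex_def convex_alt)

text \<open>The last clause asks for \<open>T x \<in> P\<close> only at points \<open>x\<close> of
  \<open>Q\<close>. In this form it applies to the convex hull of the starting point and the image
  of \<open>Q\<close>, which need not be invariant under \<open>T\<close>.\<close>

lemma countable_rat_convex_closure:
  fixes Z :: "'v::real_vector set" and T :: "'v \<Rightarrow> 'v"
  assumes "countable Z"
  obtains Q where "countable Q" "Z \<subseteq> Q" "T ` Q \<subseteq> Q" "rat_convex Q"
    "\<forall>P. Z \<subseteq> P \<longrightarrow> (\<forall>x\<in>P \<inter> Q. T x \<in> P) \<longrightarrow> rat_convex P \<longrightarrow> Q \<subseteq> P"
proof -
  define step where "step R = R \<union> T ` R \<union>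
    (\<lambda>(t, x, y). (1 - t) *\<^sub>R x + t *\<^sub>R y) ` ((\<rat> \<inter> {0..1}) \<times> R \<times> R)" for R
  define R where "R n = (step ^^ n) Z" for n
  have R_Suc: "R (Suc n) = step (R n)" and R_0: "R 0 = Z" for n by (auto simp: R_def)
  define Q where "Q = (\<Union>n. R n)"
  have "countable (R n)" for n
    by (induction n) (auto simp: R_Suc R_0 assms step_def countable_rat intro!: countable_SIGMA countable_Int1)
  then have "countable Q" by (auto simp: Q_def)
  moreover have "Z \<subseteq> Q" using R_0 unfolding Q_def by blast
  moreover have "T ` Q \<subseteq> Q"
  proof (intro image_subsetI)
    fix x assume "x \<in> Q"
    then obtain n where "x \<in> R n" by (auto simp: Q_def)
    then have "T x \<in> R (Suc n)" by (auto simp: R_Suc step_def)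
    then show "T x \<in> Q" unfolding Q_def by blast
  qed
  moreover have "rat_convex Q" unfolding rat_convex_def
  proof (intro ballI impI)
    fix x y :: 'v and t :: real
    assume "x \<in> Q" "y \<in> Q" and t: "t \<in> \<rat>" "0 \<le> t \<and> t \<le> 1"
    then obtain m n where mn: "x \<in> R m" "y \<in> R n" by (auto simp: Q_def)
    have mono: "R i \<subseteq> R j" if "i \<le> j" for i j
      using that by (rule lift_Suc_mono_le[rotated]) (auto simp: R_Suc step_def)
    have "x \<in> R (max m n)" "y \<in> R (max m n)" using mn mono[of m "max m n"] mono[of n "max m n"] by auto
    then have "(1 - t) *\<^sub>R x + t *\<^sub>R y \<in> R (Suc (max m n))"
      unfolding R_Suc step_def using t by (intro UnI2 image_eqI[of _ _ "(t, x, y)"]) auto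
    then show "(1 - t) *\<^sub>R x + t *\<^sub>R y \<in> Q" unfolding Q_def by blast
  qed
  moreover have "\<forall>P. Z \<subseteq> P \<longrightarrow> (\<forall>x\<in>P \<inter> Q. T x \<in> P) \<longrightarrow> rat_convex P \<longrightarrow> Q \<subseteq> P"
  proof (intro allI impI)
    fix P assume P: "Z \<subseteq> P" "\<forall>x\<in>P \<inter> Q. T x \<in> P" "rat_convex P"
    have "R n \<subseteq> P" for n
    proof (induction n)
      case (Suc n)
      have "R n \<subseteq> Q" by (auto simp: Q_def)
      with Suc P(2,3) show ?case by (auto simp: R_Suc step_def rat_convex_def subset_iff)
    qed (use P R_0 in simp)
    then show "Q \<subseteq> P" by (auto simp: Q_def)
  qed
  ultimately show ?thesis by (rule that)
qed

section \<open>Luxemburg's dominated convergence argument\<close>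

text \<open>
  Minima of almost optimal partial suprema of the \<open>g m\<close> keep most of the mass of \<open>L\<close> but decrease to
  \<open>0\<close> pointwise, hence uniformly by Dini's argument; no measure representing \<open>L\<close> is needed.
\<close>

lemma positive_functional_dominated_convergence:
  fixes L :: "('v \<Rightarrow> real) \<Rightarrow> real" and g :: "nat \<Rightarrow> 'v \<Rightarrow> real" and conv :: "(nat \<Rightarrow> 'v) \<Rightarrow> 'v \<Rightarrow> bool"
  assumes compact: "\<And>s. (\<And>n::nat. s n \<in> K) \<Longrightarrow> \<exists>r x. strict_mono r \<and> x \<in> K \<and> conv (s \<circ> r) x"
    and L_mono: "\<And>h h'. bounded (h ` K) \<Longrightarrow> bounded (h' ` K) \<Longrightarrow> (\<And>x. x \<in> K \<Longrightarrow> h x \<le> h' x) \<Longrightarrow> L h \<le> L h'"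
    and L_add: "\<And>h h'. bounded (h ` K) \<Longrightarrow> bounded (h' ` K) \<Longrightarrow> L (\<lambda>x. h x + h' x) = L h + L h'"
    and L_const: "\<And>c. L (\<lambda>x. c) = c"
    and g_bound: "\<And>m x. x \<in> K \<Longrightarrow> 0 \<le> g m x \<and> g m x \<le> C"
    and g_cont: "\<And>m s x. (\<And>n. s n \<in> K) \<Longrightarrow> x \<in> K \<Longrightarrow> conv s x \<Longrightarrow> (\<lambda>n. g m (s n)) \<longlonglongrightarrow> g m x"
    and g_lim: "\<And>x. x \<in> K \<Longrightarrow> (\<lambda>m. g m x) \<longlonglongrightarrow> 0"
  shows "(\<lambda>m. L (g m)) \<longlonglongrightarrow> 0"
proof -
  have bdd: "bounded (h ` K)" if "\<And>x. x \<in> K \<Longrightarrow> 0 \<le> h x \<and> h x \<le> C" for h :: "'v \<Rightarrow> real"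
    using that by (intro boundedI[of _ C]) auto
  \<comment> \<open>Partial suprema over the finite windows \<open>{n..n + j}\<close>, which inherit
    sequential continuity from the \<open>g i\<close>.\<close>
  define u where "u n j x = Max ((\<lambda>i. g i x) ` {n..n + j})" for n j x
  have u_ge: "g i x \<le> u n j x" if "i \<in> {n..n + j}" for i n j x using that by (auto simp: u_def)
  have u_bound: "0 \<le> u n j x \<and> u n j x \<le> C" if "x \<in> K" for n j x
  proof
    show "0 \<le> u n j x" using g_bound[OF that, of n] u_ge[of n n j x] by simp
    show "u n j x \<le> C" unfolding u_def using g_bound[OF that] by simp
  qed
  have u_Suc: "u n (Suc j) x = max (u n j x) (g (n + Suc j) x)" for n j x
  proof -
    have "{n..n + Suc j} = insert (n + Suc j) {n..n + j}" by auto
    then show ?thesis by (simp add: u_def max.commute)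
  qed
  have u_cont: "(\<lambda>k. u n j (s k)) \<longlonglongrightarrow> u n j x" if "\<And>n. s n \<in> K" "x \<in> K" "conv s x" for n j s x
    by (induction j) (auto simp: u_Suc u_def[of _ 0] intro!: tendsto_max g_cont that)
  have L_u: "L (u n j) \<le> C" for n j
    using L_mono[of "u n j" "\<lambda>x. C"] bdd[of "u n j"] u_bound L_const[of C] by (auto simp: image_constant_conv)
  define a where "a n = (SUP j. L (u n j))" for n
  have bdd_a: "bdd_above (range (\<lambda>j. L (u n j)))" for n by (rule bdd_aboveI2[OF L_u])
  have L_u_le_a: "L (u n j) \<le> a n" for n j unfolding a_def by (intro cSUP_upper bdd_a) auto
  show ?thesis
  proof (rule LIMSEQ_I)
    fix \<epsilon> :: real assume \<epsilon>: "0 < \<epsilon>"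
    \<comment> \<open>Any finitely many of the tolerances \<open>\<epsilon> / 2 / 2 ^ Suc n\<close>
      sum to less than \<open>\<epsilon> / 2\<close>, so the minimum \<open>H n\<close> below loses
      less than that, whatever \<open>n\<close> is.\<close>
    have "\<exists>j. a n - \<epsilon> / 2 / 2 ^ Suc n < L (u n j)" for n
    proof -
      have "a n - \<epsilon> / 2 / 2 ^ Suc n < (SUP j. L (u n j))" using \<epsilon> by (simp add: a_def)
      then show ?thesis unfolding less_cSUP_iff[OF UNIV_not_empty bdd_a] by blast
    qed
    then obtain J where J: "\<And>n. a n - \<epsilon> / 2 / 2 ^ Suc n < L (u n (J n))" by metis
    define h where "h n = u n (J n)" for n
    define H where "H n x = Min ((\<lambda>i. h i x) ` {..n})" for n x
    have H_Suc: "H (Suc n) x = min (H n x) (h (Suc n) x)" for n x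
      by (simp add: H_def atMost_Suc min.commute)
    have H_bound: "0 \<le> H n x \<and> H n x \<le> C" if "x \<in> K" for n x
      using u_bound[OF that] by (induction n) (auto simp: H_Suc H_def[of 0] h_def min_le_iff_disj)
    have H_le: "H n x \<le> h n x" for n x by (auto simp: H_def)
    have H_cont: "(\<lambda>k. H n (s k)) \<longlonglongrightarrow> H n x" if "\<And>n. s n \<in> K" "x \<in> K" "conv s x" for n s x
      by (induction n) (auto simp: H_Suc H_def[of 0] h_def intro!: tendsto_min u_cont that)
    have H_mono: "H n x \<le> H m x" if "m \<le> n" for m n x
      unfolding H_def using that by (intro Min_antimono) auto
    have L_H: "a n - \<epsilon> / 2 * (1 - 1 / 2 ^ Suc n) \<le> L (H n)" for n
    proof (induction n)
      case 0
      have "H 0 = h 0" by (auto simp: H_def)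
      then show ?case using J[of 0] by (simp add: h_def)
    next
      case (Suc n)
      \<comment> \<open>Minimum plus maximum is the sum, so a lower bound for the minimum follows
        from an upper bound for the maximum \<open>M\<close>. The window of length \<open>l\<close>
        contains those of both \<open>h n\<close> and \<open>h (Suc n)\<close>, whence
        \<open>L M \<le> a n\<close>.\<close>
      define M where "M x = max (H n x) (h (Suc n) x)" for x
      have M_bound: "0 \<le> M x \<and> M x \<le> C" if "x \<in> K" for x
        using H_bound[OF that, of n] u_bound[OF that, of "Suc n" "J (Suc n)"] by (auto simp: M_def h_def)
      define l where "l = J n + Suc (J (Suc n))"
      have "M x \<le> u n l x" for x
      proof -
        have "h n x \<le> u n l x" "h (Suc n) x \<le> u n l x"
          unfolding h_def u_def l_def by (intro Max_mono; auto)+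
        then show ?thesis using H_le[of n x] by (simp add: M_def)
      qed
      then have "L M \<le> L (u n l)" by (intro L_mono bdd M_bound u_bound)
      also have "\<dots> \<le> a n" by (rule L_u_le_a)
      finally have LM: "L M \<le> a n" .
      have "L (H (Suc n)) + L M = L (\<lambda>x. H (Suc n) x + M x)"
        by (intro L_add[symmetric] bdd M_bound H_bound)
      also have "(\<lambda>x. H (Suc n) x + M x) = (\<lambda>x. H n x + h (Suc n) x)"
        by (auto simp: H_Suc M_def)
      also have "L \<dots> = L (H n) + L (h (Suc n))"
        unfolding h_def by (intro L_add bdd H_bound u_bound)
      finally have "L (H (Suc n)) = L (H n) + L (h (Suc n)) - L M" by simp
      also have "\<dots> \<ge> (a n - \<epsilon> / 2 * (1 - 1 / 2 ^ Suc n)) + (a (Suc n) - \<epsilon> / 2 / 2 ^ Suc (Suc n)) - a n"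
        using Suc LM J[of "Suc n"] by (simp add: h_def)
      also have "(a n - \<epsilon> / 2 * (1 - 1 / 2 ^ Suc n)) + (a (Suc n) - \<epsilon> / 2 / 2 ^ Suc (Suc n)) - a n =
          a (Suc n) - \<epsilon> / 2 * (1 - 1 / 2 ^ Suc (Suc n))"
        by (simp add: algebra_simps)
      finally show ?case .
    qed
    have "\<exists>n. \<forall>x\<in>K. H n x < \<epsilon> / 2"
    proof (rule ccontr)
      assume "\<not> ?thesis"
      then have "\<forall>n. \<exists>x. x \<in> K \<and> \<epsilon> / 2 \<le> H n x" by (meson not_less)
      then obtain s where s: "\<And>n. s n \<in> K" "\<And>n. \<epsilon> / 2 \<le> H n (s n)" by metis
      obtain r x where r: "strict_mono r" "x \<in> K" "conv (s \<circ> r) x" using compact[of s] s(1) by blast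
      have Hx: "\<epsilon> / 2 \<le> H m x" for m
      proof (rule LIMSEQ_le_const[OF H_cont[OF _ r(2,3)]])
        have "\<epsilon> / 2 \<le> H m ((s \<circ> r) n)" if "m \<le> n" for n
          using s(2)[of "r n"] H_mono[of m "r n" "s (r n)"] seq_suble[OF r(1), of n] that by simp
        then show "\<exists>n0. \<forall>n\<ge>n0. \<epsilon> / 2 \<le> H m ((s \<circ> r) n)" by blast
      qed (use s in simp)
      obtain n where n: "\<And>m. n \<le> m \<Longrightarrow> g m x < \<epsilon> / 2"
        using order_tendstoD(2)[OF g_lim[OF r(2)], of "\<epsilon> / 2"] \<epsilon> by (auto simp: eventually_sequentially)
      have "h n x < \<epsilon> / 2" unfolding h_def u_def using n by (subst Max_less_iff) auto
      then show False using Hx[of n] H_le[of n x] by simp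
    qed
    then obtain n where n: "\<And>x. x \<in> K \<Longrightarrow> H n x < \<epsilon> / 2" by auto
    have "norm (L (g m) - 0) < \<epsilon>" if "n \<le> m" for m
    proof -
      have "L (H m) \<le> L (\<lambda>x. \<epsilon> / 2)"
      proof (rule L_mono)
        show "bounded (H m ` K)" by (intro bdd H_bound)
        show "bounded ((\<lambda>x. \<epsilon> / 2) ` K)" by (simp add: image_constant_conv)
        show "H m x \<le> \<epsilon> / 2" if "x \<in> K" for x
          using n[OF that] H_mono[OF \<open>n \<le> m\<close>, of x] by simp
      qed
      then have "L (H m) \<le> \<epsilon> / 2" by (simp add: L_const)
      moreover have "L (g m) \<le> a m"
      proof -
        have "g m = u m 0" by (auto simp: u_def)
        then show ?thesis using L_u_le_a[of m 0] by simp
      qed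
      moreover have "\<epsilon> / 2 * (1 - 1 / 2 ^ Suc m) < \<epsilon> / 2" using \<epsilon> by simp
      moreover have "0 \<le> L (g m)"
        using L_mono[of "\<lambda>x. 0" "g m"] g_bound L_const[of 0] bdd by (auto simp: image_constant_conv)
      ultimately have "0 \<le> L (g m)" "L (g m) < \<epsilon>" using L_H[of m] by linarith+
      then show ?thesis by simp
    qed
    then show "\<exists>n0. \<forall>m\<ge>n0. norm (L (g m) - 0) < \<epsilon>" by blast
  qed
qed

section \<open>Nonnegative matrices\<close>

text \<open>\<open>Max\<close> in the definition of the spectral radius bounds its members only for
  a finite set. Eigenvalues are the roots of the characteristic polynomial, which is shown to be
  nonzero.\<close>

lemma finite_eigenvalues:
  fixes A :: "complex ^ 'n ^ 'n"
  shows "finite {l. \<exists>v. v \<noteq> 0 \<and> A *v v = l *s v}"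
proof -
  define B where "B l = (\<chi> i j. A $ i $ j - (if i = j then l else 0))" for l
  have B_mult: "B l *v v = A *v v - l *s v" for l v
    by (simp add: B_def vec_eq_iff matrix_vector_mult_def left_diff_distrib sum_subtractf if_distrib[of "\<lambda>x. x * _"] cong: if_cong)
  have det_B: "det (B l) = 0 \<longleftrightarrow> (\<exists>v. v \<noteq> 0 \<and> A *v v = l *s v)" for l
  proof -
    have "det (B l) = 0 \<longleftrightarrow> \<not> (\<exists>B'. B' ** B l = mat 1)"
      by (metis invertible_det_nz invertible_left_inverse)
    also have "\<dots> \<longleftrightarrow> (\<exists>v. v \<noteq> 0 \<and> B l *v v = 0)"
      unfolding matrix_left_invertible_ker by blast
    finally show ?thesis by (simp add: B_mult)
  qed
  define P where "P = det (\<chi> i j. [:A $ i $ j:] - (if i = j then [:0, 1:] else 0))"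
  have poly_P: "poly P l = det (B l)" for l
    unfolding P_def B_def det_def
    by (auto simp: poly_sum poly_prod intro!: sum.cong prod.cong)
  have "P \<noteq> 0"
  proof
    assume "P = 0"
    \<comment> \<open>A number exceeding the sum of the moduli of all entries is not an eigenvalue:
      compare the row at a component of \<open>v\<close> of largest modulus. The added 1 makes the
      excess strict.\<close>
    define l where "l = complex_of_real ((\<Sum>i\<in>UNIV. \<Sum>j\<in>UNIV. cmod (A $ i $ j)) + 1)"
    have "det (B l) = 0" using poly_P[of l] \<open>P = 0\<close> by simp
    then obtain v where v: "v \<noteq> 0" "A *v v = l *s v" using det_B by blast
    obtain i where i: "\<And>j. cmod (v $ j) \<le> cmod (v $ i)"
    proof -
      have "Max (range (\<lambda>j. cmod (v $ j))) \<in> range (\<lambda>j. cmod (v $ j))" by (rule Max_in) auto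
      then obtain i where "Max (range (\<lambda>j. cmod (v $ j))) = cmod (v $ i)" by (elim rangeE)
      then show ?thesis using that[of i] Max_ge[of "range (\<lambda>j. cmod (v $ j))"] by auto
    qed
    have "v $ i \<noteq> 0"
    proof
      assume "v $ i = 0"
      then have "v $ j = 0" for j using i[of j] by simp
      then show False using v(1) by (simp add: vec_eq_iff)
    qed
    have "cmod l * cmod (v $ i) = cmod ((A *v v) $ i)" by (simp add: v(2) norm_mult)
    also have "\<dots> \<le> (\<Sum>j\<in>UNIV. cmod (A $ i $ j) * cmod (v $ j))"
      unfolding matrix_vector_mult_def by (simp add: norm_mult[symmetric] norm_sum)
    also have "\<dots> \<le> (\<Sum>j\<in>UNIV. cmod (A $ i $ j) * cmod (v $ i))"
      by (intro sum_mono mult_left_mono i) auto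
    also have "\<dots> = (\<Sum>j\<in>UNIV. cmod (A $ i $ j)) * cmod (v $ i)" by (simp add: sum_distrib_right)
    finally have "cmod l \<le> (\<Sum>j\<in>UNIV. cmod (A $ i $ j))" using \<open>v $ i \<noteq> 0\<close> by simp
    also have "\<dots> \<le> (\<Sum>i\<in>UNIV. \<Sum>j\<in>UNIV. cmod (A $ i $ j))"
      by (rule member_le_sum) (auto intro: sum_nonneg)
    also have "\<dots> < cmod l"
    proof -
      have "0 \<le> (\<Sum>i\<in>UNIV. \<Sum>j\<in>UNIV. cmod (A $ i $ j))" by (intro sum_nonneg) auto
      then show ?thesis unfolding l_def norm_of_real by simp
    qed
    finally show False by simp
  qed
  then have "finite {l. poly P l = 0}" by (rule poly_roots_finite)
  then show ?thesis by (simp add: poly_P det_B)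
qed

lemma matrix_vector_mult_mono:
  fixes M :: "real ^ 'n ^ 'm"
  assumes "\<And>i j. 0 \<le> M $ i $ j" "v \<le> w"
  shows "M *v v \<le> M *v w"
  using assms by (auto simp: less_eq_vec_def matrix_vector_mult_def intro!: sum_mono mult_left_mono)

text \<open>
  Otherwise Brouwer's theorem, applied to the normalised map \<open>x \<mapsto> M x\<close> on the unit simplex cut down by \<open>x \<le> M x\<close>,
  yields an eigenvalue at least \<open>1\<close>.
\<close>

lemma converges_to_zero_subinvariant:
  fixes M :: "real ^ 'n ^ 'n"
  assumes M: "\<And>i j. 0 \<le> M $ i $ j" "converges_to_zero M" and v: "0 \<le> v" "v \<le> M *v v"
  shows "v = 0"
proof (rule ccontr)
  assume "v \<noteq> 0"
  define \<sigma> where "\<sigma> x = (\<Sum>i\<in>UNIV. x $ i)" for x :: "real ^ 'n"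
  have \<sigma>_scale: "\<sigma> (c *\<^sub>R x) = c * \<sigma> x" and \<sigma>_add: "\<sigma> (x + y) = \<sigma> x + \<sigma> y" for c x y
    by (simp_all add: \<sigma>_def sum_distrib_left sum.distrib)
  have \<sigma>_mono: "\<sigma> x \<le> \<sigma> y" if "x \<le> y" for x y
    using that by (auto simp: \<sigma>_def less_eq_vec_def intro: sum_mono)
  have \<sigma>_cont: "continuous_on X \<sigma>" for X unfolding \<sigma>_def by (intro continuous_intros)
  have M_cont: "continuous_on X (\<lambda>x. M *v x)" for X
    by (intro linear_continuous_on linear_conv_bounded_linear[THEN iffD1] matrix_vector_mul_linear)
  define C where "C = {x. 0 \<le> x \<and> \<sigma> x = 1 \<and> x \<le> M *v x}"
  have comp_le: "x $ i \<le> \<sigma> x" if "0 \<le> x" for x i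
    unfolding \<sigma>_def using that by (intro member_le_sum) (auto simp: less_eq_vec_def)
  have "compact C"
  proof -
    have "closed {x :: real ^ 'n. 0 \<le> x}"
      unfolding less_eq_vec_def by (intro closed_Collect_all closed_Collect_le continuous_intros)
    moreover have "closed {x. \<sigma> x = 1}"
      by (intro closed_Collect_eq \<sigma>_cont continuous_intros)
    moreover have "closed {x. x \<le> M *v x}"
      unfolding less_eq_vec_def by (intro closed_Collect_all closed_Collect_le continuous_intros M_cont)
    ultimately have "closed ({x. 0 \<le> x} \<inter> {x. \<sigma> x = 1} \<inter> {x. x \<le> M *v x})" by (intro closed_Int)
    also have "{x. 0 \<le> x} \<inter> {x. \<sigma> x = 1} \<inter> {x. x \<le> M *v x} = C" by (auto simp: C_def)
    finally have "closed C" .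
    moreover have "bounded C"
    proof (rule boundedI)
      fix x assume x: "x \<in> C"
      have "norm x \<le> (\<Sum>i\<in>UNIV. \<bar>x $ i\<bar>)" by (rule norm_le_l1_cart)
      also have "\<dots> = \<sigma> x" unfolding \<sigma>_def using x by (intro sum.cong) (auto simp: C_def less_eq_vec_def)
      finally show "norm x \<le> 1" using x by (simp add: C_def)
    qed
    ultimately show ?thesis by (simp add: compact_eq_bounded_closed)
  qed
  moreover have "convex C" unfolding convex_def
  proof (intro ballI allI impI)
    fix x y and s t :: real assume xy: "x \<in> C" "y \<in> C" and st: "0 \<le> s" "0 \<le> t" "s + t = 1"
    have "s *\<^sub>R x + t *\<^sub>R y \<le> s *\<^sub>R (M *v x) + t *\<^sub>R (M *v y)"
      using xy st by (intro add_mono scaleR_left_mono) (auto simp: C_def)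
    then show "s *\<^sub>R x + t *\<^sub>R y \<in> C"
      using xy st by (auto simp: C_def \<sigma>_add \<sigma>_scale matrix_vector_right_distrib matrix_vector_mult_scaleR
          intro!: add_nonneg_nonneg scaleR_nonneg_nonneg)
  qed
  moreover have "C \<noteq> {}"
  proof -
    obtain i where "v $ i \<noteq> 0" using \<open>v \<noteq> 0\<close> by (auto simp: vec_eq_iff)
    moreover have "0 \<le> v $ i" using v(1) by (simp add: less_eq_vec_def)
    ultimately have "0 < \<sigma> v" using comp_le[OF v(1), of i] by simp
    then have "(1 / \<sigma> v) *\<^sub>R v \<in> C"
      using v by (auto simp: C_def \<sigma>_scale matrix_vector_mult_scaleR intro!: scaleR_left_mono scaleR_nonneg_nonneg)
    then show ?thesis by auto
  qed
  ultimately have C: "compact C" "convex C" "C \<noteq> {}" by auto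
  \<comment> \<open>On \<open>C\<close> the coordinate sum of \<open>M *v x\<close> is at least 1,
    since \<open>x \<le> M *v x\<close>. The denominator thus never vanishes, and at a fixed point
    it is the eigenvalue.\<close>
  define F where "F x = (1 / \<sigma> (M *v x)) *\<^sub>R (M *v x)" for x
  have \<sigma>_ge: "1 \<le> \<sigma> (M *v x)" if "x \<in> C" for x
    using \<sigma>_mono[of x "M *v x"] that by (simp add: C_def)
  have "continuous_on C (\<lambda>x. \<sigma> (M *v x))"
    using continuous_on_compose2[OF \<sigma>_cont[of UNIV] M_cont[of C]] by simp
  moreover have "\<sigma> (M *v x) \<noteq> 0" if "x \<in> C" for x using \<sigma>_ge[OF that] by simp
  ultimately have "continuous_on C F" unfolding F_def
    by (intro continuous_intros M_cont) auto
  moreover have "F \<in> C \<rightarrow> C"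
  proof
    fix x assume x: "x \<in> C"
    have xM: "0 \<le> x" "x \<le> M *v x" using x by (auto simp: C_def)
    have "M *v x \<le> M *v (M *v x)" using xM by (intro matrix_vector_mult_mono M)
    then show "F x \<in> C"
      using \<sigma>_ge[OF x] xM by (auto simp: C_def F_def \<sigma>_scale matrix_vector_mult_scaleR intro!: scaleR_left_mono scaleR_nonneg_nonneg)
  qed
  ultimately obtain x where x: "x \<in> C" "F x = x" by (rule brouwer[OF C])
  define l where "l = \<sigma> (M *v x)"
  have l: "1 \<le> l" using \<sigma>_ge[OF x(1)] by (simp add: l_def)
  have "l *\<^sub>R F x = M *v x" using l by (simp add: F_def l_def)
  then have Mx: "M *v x = l *\<^sub>R x" using x(2) by simp
  define z where "z = (\<chi> i. complex_of_real (x $ i))"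
  have "x \<noteq> 0" using x(1) by (auto simp: C_def \<sigma>_def)
  then have "z \<noteq> 0" by (simp add: z_def vec_eq_iff)
  moreover have "map_matrix complex_of_real M *v z = complex_of_real l *s z"
  proof -
    have "(map_matrix complex_of_real M *v z) $ i = complex_of_real ((M *v x) $ i)" for i
      by (simp add: z_def matrix_vector_mult_def map_matrix_def)
    then show ?thesis by (simp add: vec_eq_iff Mx z_def)
  qed
  ultimately have "cmod (complex_of_real l) \<in> {cmod l | l. \<exists>v. v \<noteq> 0 \<and> map_matrix complex_of_real M *v v = l *s v}"
    by blast
  moreover have "finite {cmod l | l. \<exists>v. v \<noteq> 0 \<and> map_matrix complex_of_real M *v v = l *s v}"
    using finite_imageI[OF finite_eigenvalues[of "map_matrix complex_of_real M"], of cmod]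
    by (simp add: image_Collect)
  ultimately have "cmod (complex_of_real l) \<le> mat_spectral_radius M"
    unfolding mat_spectral_radius_def by (rule Max_ge[rotated])
  then show False using M(2) l by (simp add: converges_to_zero_def)
qed

lemma matrix_inv_left_right:
  fixes A :: "'a::semiring_1 ^ 'n ^ 'n"
  assumes "invertible A"
  shows matrix_inv_left: "matrix_inv A ** A = mat 1" and matrix_inv_right: "A ** matrix_inv A = mat 1"
proof -
  have "\<exists>B. A ** B = mat 1 \<and> B ** A = mat 1" using assms by (simp add: invertible_def)
  from someI_ex[OF this] show "matrix_inv A ** A = mat 1" "A ** matrix_inv A = mat 1"
    by (auto simp: matrix_inv_def)
qed

text \<open>If \<open>M *v x \<le> x\<close>, the negative part \<open>y\<close> of \<open>x\<close>
  satisfies \<open>y \<le> M *v y\<close> and therefore vanishes. This positivity yields both the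
  injectivity of \<open>mat 1 - M\<close> and the nonnegativity of its inverse.\<close>

lemma one_minus_converges_to_zero_inverse:
  fixes M :: "real ^ 'n ^ 'n"
  assumes M: "\<And>i j. 0 \<le> M $ i $ j" "converges_to_zero M"
  shows "invertible (mat 1 - M)" "0 \<le> w \<Longrightarrow> 0 \<le> matrix_inv (mat 1 - M) *v w"
proof -
  have diff: "(mat 1 - M) *v x = x - M *v x" for x
    by (simp add: matrix_vector_mult_diff_rdistrib)
  have positive: "0 \<le> x" if "M *v x \<le> x" for x
  proof -
    define y where "y = (\<chi> i. max 0 (- (x $ i)))"
    have "y \<le> M *v y" unfolding less_eq_vec_def
    proof
      fix i
      have xy: "- x \<le> y" "0 \<le> y" by (auto simp: y_def less_eq_vec_def)
      have "- (x $ i) \<le> - (M *v x) $ i" using that by (simp add: less_eq_vec_def)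
      also have "\<dots> = (M *v (- x)) $ i" by (simp add: matrix_vector_mult_def sum_negf)
      also have "\<dots> \<le> (M *v y) $ i" using matrix_vector_mult_mono[OF M(1) xy(1)] by (simp add: less_eq_vec_def)
      finally have "- (x $ i) \<le> (M *v y) $ i" .
      moreover have "0 \<le> (M *v y) $ i"
        using xy(2) M(1) by (auto simp: matrix_vector_mult_def less_eq_vec_def intro!: sum_nonneg mult_nonneg_nonneg)
      ultimately show "y $ i \<le> (M *v y) $ i" by (simp add: y_def)
    qed
    then have "y = 0" by (intro converges_to_zero_subinvariant[OF M]) (auto simp: y_def less_eq_vec_def)
    then have "max 0 (- (x $ i)) = 0" for i by (simp add: y_def vec_eq_iff)
    then have "- (x $ i) \<le> 0" for i using max.cobounded2[of "- (x $ i)" 0] by simp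
    then show ?thesis by (simp add: less_eq_vec_def)
  qed
  have "x = 0" if "(mat 1 - M) *v x = 0" for x
  proof -
    have x: "M *v x = x" using that by (simp add: diff)
    have "M *v (- x) = - x" using x by (simp add: matrix_vector_mult_def vec_eq_iff sum_negf)
    then have "0 \<le> x" "0 \<le> - x" using positive[of x] positive[of "- x"] x by simp_all
    then show ?thesis by (simp add: order_antisym)
  qed
  then show inv: "invertible (mat 1 - M)"
    by (simp add: invertible_left_inverse matrix_left_invertible_ker)
  assume "0 \<le> w"
  moreover have "(mat 1 - M) *v (matrix_inv (mat 1 - M) *v w) = w"
    by (simp add: matrix_vector_mul_assoc matrix_inv_right[OF inv])
  ultimately have "0 \<le> matrix_inv (mat 1 - M) *v w - M *v (matrix_inv (mat 1 - M) *v w)"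
    unfolding diff by simp
  then show "0 \<le> matrix_inv (mat 1 - M) *v w" by (intro positive) simp
qed

text \<open>The inverse of \<open>mat 1 - M2\<close> preserves order, so it can be applied to
  \<open>v - M2 *v v \<le> M1 *v v\<close>. That the product matrix is nonnegative is read off its
  columns, the images of basis vectors.\<close>

lemma two_matrix_subinvariant:
  fixes M1 M2 :: "real ^ 'n ^ 'n"
  assumes M1: "\<And>i j. 0 \<le> M1 $ i $ j" and M2: "\<And>i j. 0 \<le> M2 $ i $ j" "converges_to_zero M2"
    and M: "converges_to_zero (matrix_inv (mat 1 - M2) ** M1)"
    and v: "0 \<le> v" "v \<le> M1 *v v + M2 *v v"
  shows "v = 0"
proof -
  let ?R = "matrix_inv (mat 1 - M2)"
  note inv = one_minus_converges_to_zero_inverse[OF M2]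
  have "0 \<le> ?R *v (M1 *v v - (v - M2 *v v))" using v(2) by (intro inv(2)) (simp add: algebra_simps)
  also have "\<dots> = ?R *v (M1 *v v) - ?R *v ((mat 1 - M2) *v v)"
    by (simp add: matrix_vector_mult_diff_distrib matrix_vector_mult_diff_rdistrib)
  also have "\<dots> = (?R ** M1) *v v - v"
    by (simp add: matrix_vector_mul_assoc matrix_inv_left[OF inv(1)])
  finally have "v \<le> (?R ** M1) *v v" by simp
  moreover have "0 \<le> (?R ** M1) $ i $ j" for i j
  proof -
    have "0 \<le> ?R *v (M1 *v axis j 1)"
      using matrix_vector_mult_mono[OF M1, of 0 "axis j 1"] by (intro inv(2)) (auto simp: less_eq_vec_def axis_def)
    then have "0 \<le> (?R ** M1) *v axis j 1" by (simp only: matrix_vector_mul_assoc)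
    then have "0 \<le> column j (?R ** M1)" by (simp only: matrix_vector_mult_basis)
    then show ?thesis by (simp add: less_eq_vec_def column_def)
  qed
  ultimately show ?thesis using converges_to_zero_subinvariant[OF _ M v(1)] by blast
qed

section \<open>Brouwer's theorem on cubes of arbitrary dimension\<close>

text \<open>The dimension \<open>m\<close> will be the size of a finite cover found inside a proof,
  so points are functions on \<open>nat\<close> of which only the first \<open>m\<close> values
  count. Continuity is sequential because the map will involve a weakly sequentially continuous
  operator. Kuhn's combinatorial lemma on finer and finer grids supplies approximate fixed
  points.\<close>

lemma brouwer_unit_cube_sequential:
  fixes G :: "(nat \<Rightarrow> real) \<Rightarrow> nat \<Rightarrow> real" and m :: nat
  defines "Q \<equiv> {u. \<forall>i<m. 0 \<le> u i \<and> u i \<le> 1}"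
  assumes G: "\<And>u i. u \<in> Q \<Longrightarrow> i < m \<Longrightarrow> 0 \<le> G u i \<and> G u i \<le> 1"
    and cont: "\<And>s u i. (\<And>k::nat. s k \<in> Q) \<Longrightarrow> u \<in> Q \<Longrightarrow> (\<And>i. i < m \<Longrightarrow> (\<lambda>k. s k i) \<longlonglongrightarrow> u i) \<Longrightarrow>
      i < m \<Longrightarrow> (\<lambda>k. G (s k) i) \<longlonglongrightarrow> G u i"
  obtains u where "u \<in> Q" "\<And>i. i < m \<Longrightarrow> G u i = u i"
proof -
  define pt where "pt p x i = real (x i) / real (Suc p)" for p :: nat and x :: "nat \<Rightarrow> nat" and i :: nat
  have pt_Q: "pt p x \<in> Q" if "\<And>i. i < m \<Longrightarrow> x i \<le> Suc p" for p x
    using that by (force simp: Q_def pt_def)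
  have "\<exists>a. a \<in> Q \<and> (\<forall>i<m. \<exists>c d. c \<in> Q \<and> d \<in> Q \<and> c i \<le> G c i \<and> G d i \<le> d i \<and>
      (\<forall>j<m. \<bar>c j - a j\<bar> \<le> inverse (real (Suc p)) \<and> \<bar>d j - a j\<bar> \<le> inverse (real (Suc p))))" for p
  proof -
    \<comment> \<open>Label 1 means that \<open>G\<close> moves the coordinate down, or that the
      point is on the upper face, where \<open>G\<close> cannot move it up. Points of the lower face
      get label 0 because \<open>G\<close> is nonnegative.\<close>
    define label where "label x i = (if x i = Suc p \<or> G (pt p x) i < pt p x i then 1 else 0 :: nat)" for x i
    obtain q where q: "\<forall>i<m. q i < Suc p"
      and q': "\<forall>i<m. \<exists>r s. (\<forall>j<m. q j \<le> r j \<and> r j \<le> q j + 1) \<and>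
        (\<forall>j<m. q j \<le> s j \<and> s j \<le> q j + 1) \<and> label r i \<noteq> label s i"
    proof (rule kuhn_lemma[of "Suc p" m label])
      show "\<forall>x. (\<forall>i<m. x i \<le> Suc p) \<longrightarrow> (\<forall>i<m. x i = 0 \<longrightarrow> label x i = 0)"
        using G pt_Q by (fastforce simp: label_def pt_def not_less)
    qed (auto simp: label_def)
    have near: "pt p r \<in> Q" "\<And>j. j < m \<Longrightarrow> \<bar>pt p r j - pt p q j\<bar> \<le> inverse (real (Suc p))"
      if r: "\<forall>j<m. q j \<le> r j \<and> r j \<le> q j + 1" for r
    proof -
      show "pt p r \<in> Q" using r q by (intro pt_Q) (metis Suc_eq_plus1 Suc_leI order_trans)
      show "\<bar>pt p r j - pt p q j\<bar> \<le> inverse (real (Suc p))" if "j < m" for j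
      proof -
        have "\<bar>pt p r j - pt p q j\<bar> = \<bar>real (r j) - real (q j)\<bar> / real (Suc p)"
          by (simp add: pt_def diff_divide_distrib[symmetric])
        also have "\<dots> \<le> 1 / real (Suc p)" using r that by (intro divide_right_mono) (force simp: abs_le_iff)+
        finally show ?thesis by (simp add: inverse_eq_divide)
      qed
    qed
    have labels: "label x i = 0 \<Longrightarrow> pt p x i \<le> G (pt p x) i"
      "label x i \<noteq> 0 \<Longrightarrow> pt p x \<in> Q \<Longrightarrow> i < m \<Longrightarrow> G (pt p x) i \<le> pt p x i" for x i
      using G[of "pt p x" i] by (auto simp: label_def pt_def split: if_splits)
    have "\<exists>c d. c \<in> Q \<and> d \<in> Q \<and> c i \<le> G c i \<and> G d i \<le> d i \<and>
        (\<forall>j<m. \<bar>c j - pt p q j\<bar> \<le> inverse (real (Suc p)) \<and> \<bar>d j - pt p q j\<bar> \<le> inverse (real (Suc p)))" if i: "i < m" for i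
    proof -
      obtain r s where rs: "\<forall>j<m. q j \<le> r j \<and> r j \<le> q j + 1" "\<forall>j<m. q j \<le> s j \<and> s j \<le> q j + 1" "label r i \<noteq> label s i"
        using q' i by blast
      \<comment> \<open>Kuhn's lemma only says that the two labels differ; the vertices are swapped
        if necessary.\<close>
      have "\<exists>r s. (\<forall>j<m. q j \<le> r j \<and> r j \<le> q j + 1) \<and> (\<forall>j<m. q j \<le> s j \<and> s j \<le> q j + 1) \<and> label r i = 0 \<and> label s i \<noteq> 0"
      proof (cases "label r i = 0")
        case True
        then show ?thesis using rs by (intro exI[of _ r] exI[of _ s]) auto
      next
        case False
        then have "label s i = 0" using rs(3) by (auto simp: label_def split: if_splits)
        then show ?thesis using rs False by (intro exI[of _ s] exI[of _ r]) auto
      qed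
      then obtain r s where rs: "\<forall>j<m. q j \<le> r j \<and> r j \<le> q j + 1" "\<forall>j<m. q j \<le> s j \<and> s j \<le> q j + 1"
        and l: "label r i = 0" "label s i \<noteq> 0" by blast
      show ?thesis
        using near[OF rs(1)] near[OF rs(2)] labels(1)[OF l(1)] labels(2)[OF l(2) _ i]
        by (intro exI[of _ "pt p r"] exI[of _ "pt p s"]) auto
    qed
    moreover have "pt p q \<in> Q" using q by (intro pt_Q) (auto intro: less_imp_le)
    ultimately show ?thesis by blast
  qed
  then obtain a where a: "\<And>p. a p \<in> Q"
    and near: "\<And>p i. i < m \<Longrightarrow> \<exists>c d. c \<in> Q \<and> d \<in> Q \<and> c i \<le> G c i \<and> G d i \<le> d i \<and>
      (\<forall>j<m. \<bar>c j - a p j\<bar> \<le> inverse (real (Suc p)) \<and> \<bar>d j - a p j\<bar> \<le> inverse (real (Suc p)))"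
    by metis
  \<comment> \<open>The ultralimit treats all coordinates at once. A subsequence converging to it is
    extracted afterwards, because \<open>cont\<close> speaks of sequences.\<close>
  define u where "u i = Lim nat_ultrafilter (\<lambda>p. a p i)" for i
  have u_lim: "((\<lambda>p. a p i) \<longlongrightarrow> u i) nat_ultrafilter" if "i < m" for i
    unfolding u_def
    by (rule ultrafilter_bounded_limit[OF nat_ultrafilter(1), of _ 1]) (use a that in \<open>auto simp: Q_def intro!: always_eventually\<close>)
  have u: "u \<in> Q" unfolding Q_def
  proof (intro CollectI allI impI conjI)
    fix i assume i: "i < m"
    show "0 \<le> u i" by (rule tendsto_lowerbound[OF u_lim[OF i] always_eventually nat_ultrafilter_neq_bot]) (use a i in \<open>auto simp: Q_def\<close>)
    show "u i \<le> 1" by (rule tendsto_upperbound[OF u_lim[OF i] always_eventually nat_ultrafilter_neq_bot]) (use a i in \<open>auto simp: Q_def\<close>)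
  qed
  have "\<exists>\<^sub>F p in sequentially. \<forall>i\<in>{..<m}. \<bar>a p i - u i\<bar> < inverse (real (Suc k))" for k
  proof (rule frequently_if_eventually_le[OF nat_ultrafilter(2) nat_ultrafilter_neq_bot])
    show "\<forall>\<^sub>F p in nat_ultrafilter. \<forall>i\<in>{..<m}. \<bar>a p i - u i\<bar> < inverse (real (Suc k))"
      using tendstoD[OF u_lim] by (intro eventually_ball_finite ballI) (auto simp: dist_real_def)
  qed
  then obtain r where r: "strict_mono r" and r_close: "\<And>k. \<forall>i\<in>{..<m}. \<bar>a (r k) i - u i\<bar> < inverse (real (Suc k))"
    using frequently_imp_strict_mono[of "\<lambda>k p. \<forall>i\<in>{..<m}. \<bar>a p i - u i\<bar> < inverse (real (Suc k))"] by blast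
  have lim: "(\<lambda>k. c k j) \<longlonglongrightarrow> u j"
    if "\<And>k. \<bar>c k j - a (r k) j\<bar> \<le> inverse (real (Suc (r k)))" "j < m" for c :: "nat \<Rightarrow> nat \<Rightarrow> real" and j
  proof (rule LIM_zero_cancel, rule Lim_null_comparison[OF always_eventually[OF allI]])
    show "norm (c k j - u j) \<le> inverse (real (Suc k)) + inverse (real (Suc k))" for k
    proof -
      have "inverse (real (Suc (r k))) \<le> inverse (real (Suc k))"
        using seq_suble[OF r, of k] by (intro le_imp_inverse_le) auto
      moreover have "\<bar>a (r k) j - u j\<bar> < inverse (real (Suc k))" using r_close that(2) by blast
      ultimately show ?thesis using that(1)[of k] unfolding real_norm_def by linarith
    qed
    show "(\<lambda>k. inverse (real (Suc k)) + inverse (real (Suc k))) \<longlonglongrightarrow> 0"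
      using tendsto_add[OF LIMSEQ_inverse_real_of_nat LIMSEQ_inverse_real_of_nat] by simp
  qed
  have "G u i = u i" if i: "i < m" for i
  proof -
    obtain c d where cd: "\<And>k. c k \<in> Q" "\<And>k. d k \<in> Q" "\<And>k. c k i \<le> G (c k) i" "\<And>k. G (d k) i \<le> d k i"
      "\<And>k j. j < m \<Longrightarrow> \<bar>c k j - a (r k) j\<bar> \<le> inverse (real (Suc (r k)))"
      "\<And>k j. j < m \<Longrightarrow> \<bar>d k j - a (r k) j\<bar> \<le> inverse (real (Suc (r k)))"
      using near[OF i, of "r k" for k] by metis
    have c: "(\<lambda>k. c k j) \<longlonglongrightarrow> u j" and d: "(\<lambda>k. d k j) \<longlonglongrightarrow> u j" if "j < m" for j
      using lim[of c j] lim[of d j] cd that by auto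
    have "u i \<le> G u i"
      by (rule LIMSEQ_le[OF c[OF i] cont[OF cd(1) u c i]]) (use cd in auto)
    moreover have "G u i \<le> u i"
      by (rule LIMSEQ_le[OF cont[OF cd(2) u d i] d[OF i]]) (use cd in auto)
    ultimately show ?thesis by simp
  qed
  then show ?thesis using that u by blast
qed

section \<open>Norm and weak topology\<close>

context generalized_banach_space
begin

section \<open>The maximum norm and norm closures\<close>

definition mnorm :: "'a \<Rightarrow> real" where
  "mnorm x = Max (range (\<lambda>i. N x $ i))"

lemma vnorm_component_nonneg: "0 \<le> N x $ i"
  using vnorm_nonneg[of x] by (simp add: less_eq_vec_def)

lemma vnorm_component_triangle: "N (x + y) $ i \<le> N x $ i + N y $ i"
  using vnorm_triangle[of x y] by (simp add: less_eq_vec_def)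

lemma vnorm_component_scaleR: "N (c *\<^sub>R x) $ i = \<bar>c\<bar> * N x $ i"
  by (simp add: vnorm_scaleR)

lemma vnorm_minus: "N (- x) = N x"
  using vnorm_scaleR[of "-1" x] by simp

lemma vnorm_zero: "N 0 = 0"
  using vnorm_eq_0_iff by blast

lemma component_le_mnorm: "N x $ i \<le> mnorm x"
  by (auto simp: mnorm_def)

lemma mnorm_le_iff: "mnorm x \<le> c \<longleftrightarrow> (\<forall>i. N x $ i \<le> c)"
  by (auto simp: mnorm_def)

lemma mnorm_nonneg: "0 \<le> mnorm x"
  using vnorm_component_nonneg component_le_mnorm order_trans by blast

lemma mnorm_eq_0_iff: "mnorm x = 0 \<longleftrightarrow> x = 0"
proof
  assume "mnorm x = 0"
  then have "N x $ i = 0" for i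
    using component_le_mnorm[of x i] vnorm_component_nonneg[of x i] by simp
  then have "N x = 0" by (simp add: vec_eq_iff)
  then show "x = 0" using vnorm_eq_0_iff by blast
next
  assume "x = 0"
  then show "mnorm x = 0" by (simp add: mnorm_def vnorm_zero)
qed

lemma mnorm_zero [simp]: "mnorm 0 = 0"
  by (simp add: mnorm_eq_0_iff)

lemma mnorm_triangle: "mnorm (x + y) \<le> mnorm x + mnorm y"
  unfolding mnorm_le_iff
  using vnorm_component_triangle add_mono[OF component_le_mnorm component_le_mnorm] order_trans by blast

lemma mnorm_scaleR: "mnorm (c *\<^sub>R x) = \<bar>c\<bar> * mnorm x"
proof (rule antisym)
  have le: "mnorm (c *\<^sub>R x) \<le> \<bar>c\<bar> * mnorm x" for c x
    unfolding mnorm_le_iff by (simp add: vnorm_component_scaleR component_le_mnorm mult_left_mono)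
  show "mnorm (c *\<^sub>R x) \<le> \<bar>c\<bar> * mnorm x" by (rule le)
  show "\<bar>c\<bar> * mnorm x \<le> mnorm (c *\<^sub>R x)"
  proof (cases "c = 0")
    case False
    then show ?thesis using le[of "1 / c" "c *\<^sub>R x"] by (simp add: field_simps)
  qed (simp add: mnorm_nonneg)
qed

lemma mnorm_minus: "mnorm (- x) = mnorm x"
  using mnorm_scaleR[of "-1" x] by simp

lemma mnorm_minus_commute: "mnorm (x - y) = mnorm (y - x)"
  using mnorm_minus[of "x - y"] by simp

lemma mnorm_diff_triangle: "mnorm (x - z) \<le> mnorm (x - y) + mnorm (y - z)"
  using mnorm_triangle[of "x - y" "y - z"] by simp

lemma max_dist_eq: "max_dist N x y = mnorm (x - y)"
  by (simp add: max_dist_def mnorm_def)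

sublocale strong: Metric_space UNIV "max_dist N"
  by unfold_locales
     (auto simp: max_dist_eq mnorm_nonneg mnorm_eq_0_iff mnorm_minus_commute intro: mnorm_diff_triangle)

lemma sublinear_mnorm: "sublinear mnorm"
  by (auto simp: sublinear_def mnorm_triangle mnorm_scaleR)

definition scl :: "'a set \<Rightarrow> 'a set" where
  "scl D = {x. \<forall>\<epsilon>>0. \<exists>d\<in>D. mnorm (x - d) < \<epsilon>}"

lemma sclD: "x \<in> scl D \<Longrightarrow> 0 < \<epsilon> \<Longrightarrow> \<exists>d\<in>D. mnorm (x - d) < \<epsilon>"
  by (simp add: scl_def)

lemma scl_subset: "D \<subseteq> scl D"
  by (auto simp: scl_def intro!: bexI)

lemma scl_mono: "D \<subseteq> E \<Longrightarrow> scl D \<subseteq> scl E"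
  unfolding scl_def by blast

lemma scl_scl: "scl (scl D) \<subseteq> scl D"
proof
  fix x assume x: "x \<in> scl (scl D)"
  show "x \<in> scl D" unfolding scl_def
  proof (intro CollectI allI impI)
    fix \<epsilon> :: real assume "0 < \<epsilon>"
    then obtain d where d: "d \<in> scl D" "mnorm (x - d) < \<epsilon> / 2"
      using sclD[OF x, of "\<epsilon> / 2"] by auto
    then obtain e where e: "e \<in> D" "mnorm (d - e) < \<epsilon> / 2"
      using sclD[of d D "\<epsilon> / 2"] \<open>0 < \<epsilon>\<close> by auto
    show "\<exists>d\<in>D. mnorm (x - d) < \<epsilon>"
      using e d mnorm_diff_triangle[of x e d] by (intro bexI[of _ e]) auto
  qed
qed

lemma closedin_strong_iff: "closedin (strong_top N) D \<longleftrightarrow> scl D \<subseteq> D"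
proof -
  have "closedin (strong_top N) D \<longleftrightarrow> (\<forall>x. x \<notin> D \<longrightarrow> (\<exists>r>0. disjnt D (strong.mball x r)))"
    by (auto simp: strong_top_def strong.closedin_metric)
  also have "\<dots> \<longleftrightarrow> scl D \<subseteq> D"
    unfolding scl_def subset_iff disjnt_iff by (simp add: max_dist_eq not_less) (meson not_le)
  finally show ?thesis .
qed

text \<open>Replacing a real weight \<open>t\<close> by a rational \<open>s\<close> costs
  \<open>(t - s) *\<^sub>R (y' - x')\<close>, which density makes small. The closure of a countable
  set can thus be convex.\<close>

lemma convex_scl:
  assumes "\<And>x y t. x \<in> D \<Longrightarrow> y \<in> D \<Longrightarrow> t \<in> \<rat> \<Longrightarrow> 0 \<le> t \<Longrightarrow> t \<le> 1 \<Longrightarrow> (1 - t) *\<^sub>R x + t *\<^sub>R y \<in> D"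
  shows "convex (scl D)"
  unfolding convex_alt
proof (intro ballI allI impI)
  fix x y t assume x: "x \<in> scl D" and y: "y \<in> scl D" and t: "0 \<le> t \<and> t \<le> (1::real)"
  show "(1 - t) *\<^sub>R x + t *\<^sub>R y \<in> scl D" unfolding scl_def
  proof (intro CollectI allI impI)
    fix \<epsilon> :: real assume \<epsilon>: "0 < \<epsilon>"
    obtain x' where x': "x' \<in> D" "mnorm (x - x') < \<epsilon> / 3" using sclD[OF x, of "\<epsilon> / 3"] \<epsilon> by auto
    obtain y' where y': "y' \<in> D" "mnorm (y - y') < \<epsilon> / 3" using sclD[OF y, of "\<epsilon> / 3"] \<epsilon> by auto
    \<comment> \<open>The added 1 keeps the tolerance \<open>\<epsilon> / (3 * m)\<close> meaningful
      when \<open>x' = y'\<close>.\<close>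
    define m where "m = mnorm (y' - x') + 1"
    have m: "0 < m" using mnorm_nonneg[of "y' - x'"] by (simp add: m_def)
    \<comment> \<open>Rationals are sought above \<open>t\<close> and must not exceed 1, hence the
      separate case \<open>t = 1\<close>.\<close>
    obtain s where s: "s \<in> \<rat>" "0 \<le> s" "s \<le> 1" "\<bar>t - s\<bar> \<le> \<epsilon> / (3 * m)"
    proof (cases "t = 1")
      case True
      then show ?thesis using that[of 1] \<epsilon> m by simp
    next
      case False
      then have "t < min 1 (t + \<epsilon> / (3 * m))" using t \<epsilon> m by simp
      then obtain s where "s \<in> \<rat>" "t < s" "s < min 1 (t + \<epsilon> / (3 * m))"
        using Rats_dense_in_real by blast
      then show ?thesis using that[of s] t by auto
    qed
    have "mnorm ((t - s) *\<^sub>R (y' - x')) \<le> \<epsilon> / (3 * m) * mnorm (y' - x')"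
      unfolding mnorm_scaleR using s by (intro mult_right_mono mnorm_nonneg)
    also have "\<dots> < \<epsilon> / (3 * m) * m" using \<epsilon> m by (intro mult_strict_left_mono) (auto simp: m_def)
    finally have 1: "mnorm ((t - s) *\<^sub>R (y' - x')) < \<epsilon> / 3" using m by simp
    have "(1 - t) *\<^sub>R x + t *\<^sub>R y - ((1 - s) *\<^sub>R x' + s *\<^sub>R y') =
        ((1 - t) *\<^sub>R (x - x') + t *\<^sub>R (y - y')) + (t - s) *\<^sub>R (y' - x')"
      by (simp add: algebra_simps)
    also have "mnorm \<dots> \<le> (mnorm ((1 - t) *\<^sub>R (x - x')) + mnorm (t *\<^sub>R (y - y'))) + mnorm ((t - s) *\<^sub>R (y' - x'))"
      by (intro order_trans[OF mnorm_triangle] add_mono mnorm_triangle order_refl)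
    also have "\<dots> = ((1 - t) * mnorm (x - x') + t * mnorm (y - y')) + mnorm ((t - s) *\<^sub>R (y' - x'))"
      using t by (simp add: mnorm_scaleR)
    also have "\<dots> < (mnorm (x - x') + mnorm (y - y')) + \<epsilon> / 3"
      using t by (intro add_le_less_mono add_mono 1 mult_left_le_one_le mnorm_nonneg) auto
    also have "\<dots> < \<epsilon>" using x' y' by simp
    finally show "\<exists>d\<in>D. mnorm ((1 - t) *\<^sub>R x + t *\<^sub>R y - d) < \<epsilon>"
      using assms[OF x'(1) y'(1) s(1-3)] by blast
  qed
qed

section \<open>Continuous functionals and separation\<close>

definition dual :: "('a \<Rightarrow> real) \<Rightarrow> bool" where
  "dual f \<longleftrightarrow> linear f \<and> continuous_map (strong_top N) euclideanreal f"

text \<open>The bound from above becomes a bound from below at \<open>- x\<close>, so this is the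
  unit ball of the dual; the one-sided form is the one that \<open>mazur_orlicz\<close>
  delivers.\<close>

definition dual_ball :: "('a \<Rightarrow> real) set" where
  "dual_ball = {f. linear f \<and> (\<forall>x. f x \<le> mnorm x)}"

lemma dual_linear: "dual f \<Longrightarrow> linear f"
  by (simp add: dual_def)

lemma dual_ball_linear: "f \<in> dual_ball \<Longrightarrow> linear f"
  by (simp add: dual_ball_def)

lemma dual_ball_le: "f \<in> dual_ball \<Longrightarrow> f x \<le> mnorm x"
  by (simp add: dual_ball_def)

lemma dual_ball_abs_le: "f \<in> dual_ball \<Longrightarrow> \<bar>f x\<bar> \<le> mnorm x"
  using dual_ball_le[of f x] dual_ball_le[of f "- x"] linear_neg[OF dual_ball_linear, of f x]
  by (simp add: mnorm_minus abs_le_iff)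

lemma dual_ball_diff: "f \<in> dual_ball \<Longrightarrow> f (x - y) = f x - f y"
  using linear_diff[OF dual_ball_linear] .

lemma dual_diff: "dual f \<Longrightarrow> f (x - y) = f x - f y"
  using linear_diff[OF dual_linear] .

lemma dualI:
  assumes "linear f" "\<And>x. \<bar>f x\<bar> \<le> C * mnorm x" "0 < C"
  shows "dual f"
  unfolding dual_def
proof (intro conjI assms(1))
  have "openin strong.mtopology {x. f x \<in> V}" if V: "open V" for V
    unfolding strong.openin_mtopology
  proof (intro conjI allI impI subset_UNIV)
    fix x assume "x \<in> {x. f x \<in> V}"
    then obtain e where e: "0 < e" "\<And>z. \<bar>z - f x\<bar> < e \<Longrightarrow> z \<in> V"
      using V by (auto simp: open_dist dist_real_def)
    have "f y \<in> V" if "mnorm (x - y) < e / C" for y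
    proof (rule e(2))
      have "\<bar>f y - f x\<bar> \<le> C * mnorm (x - y)"
        using assms(2)[of "y - x"] linear_diff[OF assms(1), of y x] by (simp add: mnorm_minus_commute)
      also have "\<dots> < e" using that assms(3) by (simp add: field_simps)
      finally show "\<bar>f y - f x\<bar> < e" .
    qed
    then show "\<exists>r>0. strong.mball x r \<subseteq> {x. f x \<in> V}"
      using e(1) assms(3) by (intro exI[of _ "e / C"]) (auto simp: max_dist_eq)
  qed
  then show "continuous_map (strong_top N) euclideanreal f"
    by (simp add: continuous_map_def strong_top_def)
qed

lemma dual_ball_imp_dual: "f \<in> dual_ball \<Longrightarrow> dual f"
  using dual_ball_abs_le by (intro dualI[of f 1]) (auto simp: dual_ball_linear)

text \<open>Continuity at 0 keeps \<open>f\<close> below 1 on a ball of radius \<open>r\<close>;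
  scaling gives \<open>c = r / 2\<close>. Weak convergence can therefore be tested on
  \<open>dual_ball\<close>.\<close>

lemma dual_scaled_in_dual_ball:
  assumes "dual f"
  obtains c where "0 < c" "(\<lambda>x. c * f x) \<in> dual_ball"
proof -
  have lin: "linear f" and cont: "continuous_map strong.mtopology euclideanreal f"
    using assms by (auto simp: dual_def strong_top_def)
  have "openin strong.mtopology {x \<in> topspace strong.mtopology. f x \<in> {..<1}}"
    by (rule openin_continuous_map_preimage[OF cont]) simp
  moreover have "0 \<in> {x \<in> topspace strong.mtopology. f x \<in> {..<1}}" by (simp add: linear_0[OF lin])
  ultimately obtain r where r: "0 < r" "strong.mball 0 r \<subseteq> {x \<in> topspace strong.mtopology. f x \<in> {..<1}}"
    unfolding strong.openin_mtopology by blast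
  have "(r / 2) * f x \<le> mnorm x" for x
  proof (cases "x = 0")
    case True
    then show ?thesis by (simp add: linear_0[OF lin])
  next
    case False
    then have pos: "0 < mnorm x" using mnorm_nonneg[of x] mnorm_eq_0_iff[of x] by linarith
    have "mnorm ((r / (2 * mnorm x)) *\<^sub>R x) < r"
      using pos r(1) by (simp add: mnorm_scaleR)
    then have "(r / (2 * mnorm x)) *\<^sub>R x \<in> strong.mball 0 r"
      by (simp add: max_dist_eq mnorm_minus)
    then have "f ((r / (2 * mnorm x)) *\<^sub>R x) < 1" using r(2) by blast
    then show ?thesis using pos by (simp add: linear_scale[OF lin] field_simps)
  qed
  then have "(\<lambda>x. r / 2 * f x) \<in> dual_ball"
    using linear_add[OF lin] linear_scale[OF lin]
    by (auto simp: dual_ball_def linear_iff algebra_simps)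
  then show ?thesis using r(1) that[of "r / 2"] by simp
qed

lemma norming_functional:
  obtains f where "f \<in> dual_ball" "f x = mnorm x"
proof -
  obtain f where f: "linear f" "\<And>x. f x \<le> mnorm x" "mnorm x \<le> f x"
    using mazur_orlicz[OF sublinear_mnorm, of "{x}" "mnorm x"] by auto
  then show ?thesis using that[of f] by (auto simp: dual_ball_def intro: antisym)
qed

text \<open>Since \<open>x\<close> has positive distance from \<open>D\<close>, the norm is at least
  some \<delta> on the translate of \<open>D\<close> by \<open>- x\<close>, and a linear functional
  dominated by the norm can keep that bound.\<close>

lemma separation:
  assumes "convex D" "D \<noteq> {}" "x \<notin> scl D"
  obtains f \<delta> where "f \<in> dual_ball" "0 < \<delta>" "\<And>d. d \<in> D \<Longrightarrow> f x + \<delta> \<le> f d"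
proof -
  obtain \<delta> where \<delta>: "0 < \<delta>" "\<And>d. d \<in> D \<Longrightarrow> \<delta> \<le> mnorm (x - d)"
    using assms(3) by (auto simp: scl_def not_less)
  have "convex ((\<lambda>d. d - x) ` D)" using convex_translation_subtract[OF assms(1), of x] .
  then obtain f where f: "linear f" "\<And>x. f x \<le> mnorm x" "\<And>e. e \<in> (\<lambda>d. d - x) ` D \<Longrightarrow> \<delta> \<le> f e"
    using mazur_orlicz[OF sublinear_mnorm, of "(\<lambda>d. d - x) ` D" \<delta>] assms \<delta>
    by (auto simp: mnorm_minus_commute)
  show ?thesis
  proof
    show "f \<in> dual_ball" using f by (simp add: dual_ball_def)
    show "f x + \<delta> \<le> f d" if "d \<in> D" for d
      using f(3)[of "d - x"] that linear_diff[OF f(1), of d x] by auto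
  qed (fact \<delta>)
qed

section \<open>Weak limits along filters\<close>

abbreviation wlim :: "('b \<Rightarrow> 'a) \<Rightarrow> 'a \<Rightarrow> 'b filter \<Rightarrow> bool" where
  "wlim s x F \<equiv> limitin (weak_top N) s x F"

lemma weak_top_subbase:
  "{f -` V | f V. linear f \<and> continuous_map (strong_top N) euclideanreal f \<and> open V} = {f -` V | f V. dual f \<and> open V}"
  by (auto simp: dual_def)

lemma openin_weak_top: "openin (weak_top N) W \<longleftrightarrow> generate_topology_on {f -` V | f V. dual f \<and> open V} W"
  unfolding weak_top_def weak_top_subbase openin_topology_generated_by_iff ..

lemma openin_weak_vimage: "dual f \<Longrightarrow> open V \<Longrightarrow> openin (weak_top N) (f -` V)"
  unfolding openin_weak_top by (rule generate_topology_on.Basis) auto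

lemma dual_zero: "dual (\<lambda>x. 0)"
  by (rule dualI[of _ 1]) (auto simp: mnorm_nonneg linear_iff)

lemma topspace_weak_top [simp]: "topspace (weak_top N) = UNIV"
  using openin_weak_vimage[OF dual_zero open_UNIV] by (metis openin_subset top.extremum_unique vimage_UNIV)

lemma wlim_iff: "wlim s x F \<longleftrightarrow> (\<forall>f. dual f \<longrightarrow> ((\<lambda>n. f (s n)) \<longlongrightarrow> f x) F)"
proof (intro iffI allI impI)
  fix f assume lim: "wlim s x F" and f: "dual f"
  show "((\<lambda>n. f (s n)) \<longlongrightarrow> f x) F"
  proof (rule topological_tendstoI)
    fix V assume "open V" "f x \<in> V"
    then show "eventually (\<lambda>n. f (s n) \<in> V) F"
      using lim openin_weak_vimage[OF f \<open>open V\<close>] by (auto simp: limitin_def)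
  qed
next
  assume lim: "\<forall>f. dual f \<longrightarrow> ((\<lambda>n. f (s n)) \<longlongrightarrow> f x) F"
  have "eventually (\<lambda>n. s n \<in> W) F" if "generate_topology_on {f -` V | f V. dual f \<and> open V} W" "x \<in> W" for W
    using that
  proof (induction rule: generate_topology_on.induct)
    case (Int a b)
    then show ?case by (auto intro: eventually_conj)
  next
    case (UN K)
    then obtain k where "k \<in> K" "x \<in> k" by auto
    with UN have "eventually (\<lambda>n. s n \<in> k) F" by auto
    then show ?case by (rule eventually_mono) (use \<open>k \<in> K\<close> in auto)
  next
    case (Basis W)
    then obtain f V where W: "W = f -` V" "dual f" "open V" by auto
    then have "eventually (\<lambda>n. f (s n) \<in> V) F"
      using lim Basis(2) by (intro topological_tendstoD[of _ "f x"]) auto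
    then show ?case by (simp add: W)
  qed auto
  then show "wlim s x F" by (auto simp: limitin_def openin_weak_top)
qed

lemma wlim_dualD: "wlim s x F \<Longrightarrow> dual f \<Longrightarrow> ((\<lambda>n. f (s n)) \<longlongrightarrow> f x) F"
  by (simp add: wlim_iff)

lemma wlim_iff_dual_ball: "wlim s x F \<longleftrightarrow> (\<forall>f\<in>dual_ball. ((\<lambda>n. f (s n)) \<longlongrightarrow> f x) F)"
proof
  assume R: "\<forall>f\<in>dual_ball. ((\<lambda>n. f (s n)) \<longlongrightarrow> f x) F"
  show "wlim s x F" unfolding wlim_iff
  proof (intro allI impI)
    fix f assume "dual f"
    then obtain c where c: "0 < c" "(\<lambda>x. c * f x) \<in> dual_ball" by (rule dual_scaled_in_dual_ball)
    then have "((\<lambda>n. (c * f (s n)) / c) \<longlongrightarrow> (c * f x) / c) F"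
      using R by (intro tendsto_divide tendsto_const) auto
    then show "((\<lambda>n. f (s n)) \<longlongrightarrow> f x) F" using c(1) by simp
  qed
qed (simp add: wlim_iff dual_ball_imp_dual)

lemma wlim_unique:
  assumes "wlim s x F" "wlim s y F" "F \<noteq> bot"
  shows "x = y"
proof -
  obtain f where f: "f \<in> dual_ball" "f (x - y) = mnorm (x - y)" by (rule norming_functional)
  have "f x = f y"
    using assms wlim_dualD[OF _ dual_ball_imp_dual[OF f(1)]] tendsto_unique by blast
  then show ?thesis using f dual_ball_diff[OF f(1), of x y] by (simp add: mnorm_eq_0_iff)
qed

lemma wlim_mono: "wlim s x F \<Longrightarrow> F' \<le> F \<Longrightarrow> wlim s x F'"
  by (auto simp: wlim_iff intro: tendsto_mono)

text \<open>Mazur's theorem for filters: a functional separating \<open>x\<close> from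
  \<open>D\<close> by \<delta> would keep that gap in the limit.\<close>

lemma wlim_in_scl:
  assumes "convex D" "wlim s x F" "F \<noteq> bot" "eventually (\<lambda>n. s n \<in> D) F"
  shows "x \<in> scl D"
proof (rule ccontr)
  assume "x \<notin> scl D"
  moreover have "D \<noteq> {}" using assms(3,4) eventually_happens' by fastforce
  ultimately obtain f \<delta> where f: "f \<in> dual_ball" "0 < \<delta>" "\<And>d. d \<in> D \<Longrightarrow> f x + \<delta> \<le> f d"
    using separation[OF assms(1)] by blast
  have "f x + \<delta> \<le> f x"
    by (rule tendsto_lowerbound[OF wlim_dualD[OF assms(2) dual_ball_imp_dual[OF f(1)]] _ assms(3)])
       (use assms(4) f(3) in \<open>auto elim: eventually_mono\<close>)
  then show False using f(2) by simp
qed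

lemma wlim_strong_perturbation:
  assumes "wlim s x F" "((\<lambda>n. mnorm (t n - s n)) \<longlongrightarrow> 0) F"
  shows "wlim t x F"
  unfolding wlim_iff_dual_ball
proof
  fix f assume f: "f \<in> dual_ball"
  have "((\<lambda>n. f (t n) - f (s n)) \<longlongrightarrow> 0) F"
    by (rule Lim_null_comparison[OF _ assms(2)])
       (use dual_ball_abs_le[OF f] in \<open>auto simp: dual_ball_diff[OF f, symmetric]\<close>)
  then have "((\<lambda>n. (f (t n) - f (s n)) + f (s n)) \<longlongrightarrow> 0 + f x) F"
    using wlim_dualD[OF assms(1) dual_ball_imp_dual[OF f]] by (intro tendsto_add)
  then show "((\<lambda>n. f (t n)) \<longlongrightarrow> f x) F" by simp
qed

lemma wlim_const: "wlim (\<lambda>n. x) x F"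
  by (simp add: wlim_iff)

lemma wlim_diff: "wlim s x F \<Longrightarrow> wlim t y F \<Longrightarrow> wlim (\<lambda>n. s n - t n) (x - y) F"
  by (auto simp: wlim_iff dual_diff intro: tendsto_diff)

lemma closedin_weak_convex:
  assumes "convex D" "scl D \<subseteq> D"
  shows "closedin (weak_top N) D"
proof -
  have "\<exists>W. openin (weak_top N) W \<and> x \<in> W \<and> W \<subseteq> - D" if "x \<in> - D" for x
  proof (cases "D = {}")
    case True
    then show ?thesis using openin_topspace[of "weak_top N"] by auto
  next
    case False
    then obtain f \<delta> where f: "f \<in> dual_ball" "0 < \<delta>" "\<And>d. d \<in> D \<Longrightarrow> f x + \<delta> \<le> f d"
      using separation[OF assms(1)] assms(2) \<open>x \<in> - D\<close> by blast
    then show ?thesis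
      by (intro exI[of _ "f -` {..< f x + \<delta>}"])
         (auto intro!: openin_weak_vimage dual_ball_imp_dual simp: not_le[symmetric])
  qed
  then have "openin (weak_top N) (- D)" by (subst openin_subopen) auto
  then show ?thesis by (simp add: closedin_def Compl_eq_Diff_UNIV)
qed

lemma openin_weak_imp_strong:
  assumes W: "openin (weak_top N) W" and x: "x \<in> W"
  obtains r where "0 < r" "\<And>y. mnorm (y - x) < r \<Longrightarrow> y \<in> W"
proof -
  have "generate_topology_on {f -` V | f V. dual f \<and> open V} W" using W by (simp add: openin_weak_top)
  then have "openin (strong_top N) W"
  proof (induction rule: generate_topology_on.induct)
    case (Basis W)
    then obtain f V where "W = f -` V" "dual f" "open V" by auto
    then show ?case
      using openin_continuous_map_preimage[of "strong_top N" euclideanreal f V]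
      by (simp add: dual_def strong_top_def vimage_def)
  qed (auto simp: openin_Int)
  then obtain r where "0 < r" "strong.mball x r \<subseteq> W"
    using x unfolding strong_top_def strong.openin_mtopology by blast
  then show ?thesis using that[of r] by (force simp: max_dist_eq mnorm_minus_commute)
qed

subsection \<open>Weak compactness and sequences\<close>

lemma convex_scl_rat: "rat_convex D \<Longrightarrow> convex (scl D)"
  by (rule convex_scl) (auto simp: rat_convex_def)

lemma convex_scl_convex: "convex D \<Longrightarrow> convex (scl D)"
  by (intro convex_scl_rat convex_imp_rat_convex)

lemma convex_hull_separable:
  assumes "countable Z"
  obtains E where "countable E" "scl (convex hull Z) \<subseteq> scl E"
proof -
  obtain Q where Q: "countable Q" "Z \<subseteq> Q" "rat_convex Q"
    using countable_rat_convex_closure[OF assms, of id] by metis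
  have "convex hull Z \<subseteq> scl Q"
    using Q scl_subset[of Q] by (intro hull_minimal convex_scl_rat) auto
  then have "scl (convex hull Z) \<subseteq> scl Q" using scl_mono scl_scl by blast
  then show ?thesis using that Q by blast
qed

text \<open>Norming functionals for all differences of points of \<open>E\<close> are enough: if
  they agree at \<open>x\<close> and \<open>y\<close>, then approximating both points from
  \<open>E\<close> bounds \<open>mnorm (x - y)\<close> by twice the sum of the approximation
  errors.\<close>

lemma separating_functionals:
  assumes "countable E"
  obtains g :: "nat \<Rightarrow> 'a \<Rightarrow> real" where "\<And>j. g j \<in> dual_ball"
    "\<And>x y. x \<in> scl E \<Longrightarrow> y \<in> scl E \<Longrightarrow> (\<And>j. g j x = g j y) \<Longrightarrow> x = y"
proof -
  have "\<forall>z. \<exists>f. f \<in> dual_ball \<and> f z = mnorm z" using norming_functional by metis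
  then obtain \<phi> where \<phi>: "\<And>z. \<phi> z \<in> dual_ball" "\<And>z. \<phi> z z = mnorm z" by metis
  \<comment> \<open>The member \<open>\<phi> 0\<close> makes the family nonempty, so that it can be
    enumerated even for empty \<open>E\<close>.\<close>
  define G where "G = insert (\<phi> 0) ((\<lambda>(d, e). \<phi> (d - e)) ` (E \<times> E))"
  have G: "countable G" "G \<noteq> {}" using assms by (auto simp: G_def)
  define g where "g = from_nat_into G"
  have "g j \<in> dual_ball" for j
    using from_nat_into[OF G(2), of j] \<phi>(1) by (auto simp: g_def G_def)
  moreover have "x = y" if x: "x \<in> scl E" and y: "y \<in> scl E" and eq: "\<And>j. g j x = g j y" for x y
  proof (rule ccontr)
    assume "x \<noteq> y"
    then have pos: "0 < mnorm (x - y)" using mnorm_nonneg[of "x - y"] mnorm_eq_0_iff[of "x - y"] by simp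
    define \<epsilon> where "\<epsilon> = mnorm (x - y) / 4"
    obtain d where d: "d \<in> E" "mnorm (x - d) < \<epsilon>" using sclD[OF x, of \<epsilon>] pos by (auto simp: \<epsilon>_def)
    obtain e where e: "e \<in> E" "mnorm (y - e) < \<epsilon>" using sclD[OF y, of \<epsilon>] pos by (auto simp: \<epsilon>_def)
    define f where "f = \<phi> (d - e)"
    have "f \<in> G" using d e by (force simp: f_def G_def)
    then have "f x = f y" using eq from_nat_into_surj[OF G(1)] unfolding g_def by metis
    have fb: "f \<in> dual_ball" by (simp add: f_def \<phi>)
    have "mnorm (x - y) \<le> mnorm (x - d) + (mnorm (d - e) + mnorm (e - y))"
      using mnorm_diff_triangle[of x y d] mnorm_diff_triangle[of d y e] by simp
    also have "mnorm (d - e) = f d - f e" using \<phi>(2)[of "d - e"] dual_ball_diff[OF fb] by (simp add: f_def)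
    also have "\<dots> = f (d - x) + f (y - e)" using \<open>f x = f y\<close> dual_ball_diff[OF fb] by simp
    also have "\<dots> \<le> mnorm (x - d) + mnorm (y - e)"
      using dual_ball_le[OF fb, of "d - x"] dual_ball_le[OF fb, of "y - e"] by (simp add: mnorm_minus_commute)
    finally show False using d e pos by (simp add: mnorm_minus_commute \<epsilon>_def)
  qed
  ultimately show ?thesis using that by blast
qed

lemma wlim_subseq: "wlim s x sequentially \<Longrightarrow> strict_mono r \<Longrightarrow> wlim (s \<circ> r) x sequentially"
  by (rule limitin_subsequence)

lemma wlim_nat_ultrafilter: "wlim s x sequentially \<Longrightarrow> wlim s x nat_ultrafilter"
  using wlim_mono nat_ultrafilter(2) by blast

text \<open>A subsequence \<open>r\<close> is chosen along which countably many separating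
  functionals converge to their values at one ultralimit \<open>z\<close>. Every ultralimit of a
  further subsequence has the same values there and so equals \<open>z\<close>; hence no functional
  can stay away from \<open>f z\<close> infinitely often.\<close>

lemma weak_subsequence_if_ultralimits:
  fixes y :: "nat \<Rightarrow> 'a"
  assumes E: "countable E"
    and lim: "\<And>r. strict_mono r \<Longrightarrow> \<exists>z\<in>scl E. wlim (y \<circ> r) z nat_ultrafilter"
  obtains r z where "strict_mono r" "wlim (y \<circ> r) z nat_ultrafilter" "wlim (y \<circ> r) z sequentially"
proof -
  obtain g :: "nat \<Rightarrow> 'a \<Rightarrow> real" where g: "\<And>j. g j \<in> dual_ball"
    and sep: "\<And>x y. x \<in> scl E \<Longrightarrow> y \<in> scl E \<Longrightarrow> (\<And>j. g j x = g j y) \<Longrightarrow> x = y"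
    using separating_functionals[OF E] by blast
  obtain z where z: "z \<in> scl E" "wlim y z nat_ultrafilter"
    using lim[of id] by (auto simp: strict_mono_id)
  have "\<exists>\<^sub>F n in sequentially. \<forall>j\<in>{..k}. \<bar>g j (y n) - g j z\<bar> < inverse (real (Suc k))" for k
  proof (rule frequently_if_eventually_le[OF nat_ultrafilter(2) nat_ultrafilter_neq_bot])
    show "\<forall>\<^sub>F n in nat_ultrafilter. \<forall>j\<in>{..k}. \<bar>g j (y n) - g j z\<bar> < inverse (real (Suc k))"
    proof (intro eventually_ball_finite ballI)
      fix j
      show "\<forall>\<^sub>F n in nat_ultrafilter. \<bar>g j (y n) - g j z\<bar> < inverse (real (Suc k))"
        using tendstoD[OF wlim_dualD[OF z(2) dual_ball_imp_dual[OF g]]]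
        by (simp add: dist_real_def)
    qed simp
  qed
  then obtain r where r: "strict_mono r"
    and rg: "\<And>k. \<forall>j\<in>{..k}. \<bar>g j (y (r k)) - g j z\<bar> < inverse (real (Suc k))"
    using frequently_imp_strict_mono[of "\<lambda>k n. \<forall>j\<in>{..k}. \<bar>g j (y n) - g j z\<bar> < inverse (real (Suc k))"]
    by blast
  have g_lim: "(\<lambda>k. g j (y (r k))) \<longlonglongrightarrow> g j z" for j
  proof (rule LIM_zero_cancel)
    show "(\<lambda>k. g j (y (r k)) - g j z) \<longlonglongrightarrow> 0"
    proof (rule Lim_null_comparison[OF _ LIMSEQ_inverse_real_of_nat])
      show "\<forall>\<^sub>F k in sequentially. norm (g j (y (r k)) - g j z) \<le> inverse (real (Suc k))"
        using rg by (intro eventually_sequentiallyI[of j]) (force intro: less_imp_le)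
    qed
  qed
  have unique: "z' = z" if sz: "strict_mono s" "wlim (y \<circ> r \<circ> s) z' nat_ultrafilter" for s z'
  proof -
    obtain z'' where z'': "z'' \<in> scl E" "wlim (y \<circ> r \<circ> s) z'' nat_ultrafilter"
      using lim[of "r \<circ> s"] strict_mono_o[OF r sz(1)] by (auto simp: o_assoc)
    then have "z'' = z'" using sz wlim_unique nat_ultrafilter_neq_bot by blast
    have "g j z' = g j z" for j
    proof (rule tendsto_unique[OF nat_ultrafilter_neq_bot])
      show "((\<lambda>n. g j ((y \<circ> r \<circ> s) n)) \<longlongrightarrow> g j z') nat_ultrafilter"
        by (rule wlim_dualD[OF sz(2) dual_ball_imp_dual[OF g]])
      have "(\<lambda>n. g j ((y \<circ> r \<circ> s) n)) \<longlonglongrightarrow> g j z"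
        using LIMSEQ_subseq_LIMSEQ[OF g_lim sz(1)] by (simp add: o_def)
      then show "((\<lambda>n. g j ((y \<circ> r \<circ> s) n)) \<longlongrightarrow> g j z) nat_ultrafilter"
        using tendsto_mono nat_ultrafilter(2) by blast
    qed
    then show ?thesis using sep z'' z \<open>z'' = z'\<close> by blast
  qed
  have "wlim (y \<circ> r) z sequentially" unfolding wlim_iff
  proof (intro allI impI)
    fix f assume f: "dual f"
    show "(\<lambda>n. f ((y \<circ> r) n)) \<longlonglongrightarrow> f z"
    proof (rule ccontr)
      assume "\<not> ?thesis"
      then obtain \<epsilon> where \<epsilon>: "0 < \<epsilon>" "\<exists>\<^sub>F n in sequentially. \<epsilon> \<le> \<bar>f ((y \<circ> r) n) - f z\<bar>"
        by (auto simp: tendsto_iff frequently_def dist_real_def not_le)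
      then obtain s where s: "strict_mono s" "\<And>k::nat. \<epsilon> \<le> \<bar>f ((y \<circ> r) (s k)) - f z\<bar>"
        using frequently_imp_strict_mono[of "\<lambda>k n. \<epsilon> \<le> \<bar>f ((y \<circ> r) n) - f z\<bar>"] by blast
      obtain z' where z': "wlim (y \<circ> r \<circ> s) z' nat_ultrafilter"
        using lim[of "r \<circ> s"] strict_mono_o[OF r s(1)] by (auto simp: o_assoc)
      have "((\<lambda>n. f ((y \<circ> r \<circ> s) n)) \<longlongrightarrow> f z) nat_ultrafilter"
        using wlim_dualD[OF z' f] unique[OF s(1) z'] by simp
      then have "\<forall>\<^sub>F n in nat_ultrafilter. \<bar>f ((y \<circ> r) (s n)) - f z\<bar> < \<epsilon>"
        using \<epsilon>(1) by (auto simp: tendsto_iff dist_real_def)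
      then have "\<forall>\<^sub>F n in nat_ultrafilter. False" by (rule eventually_mono) (use s(2) in \<open>auto simp: not_less[symmetric]\<close>)
      then show False by simp
    qed
  qed
  then show ?thesis using that[OF r] wlim_nat_ultrafilter by blast
qed

text \<open>Compactness of \<open>K\<close> provides ultralimits of all subsequences. By Mazur's
  theorem they lie in the closed convex hull of the range of \<open>y\<close>, which is
  separable.\<close>

theorem eberlein_smulian:
  assumes K: "compactin (weak_top N) K" and y: "\<And>n::nat. y n \<in> K"
  obtains r z where "strict_mono r" "z \<in> K" "wlim (y \<circ> r) z sequentially"
proof -
  obtain E where E: "countable E" "scl (convex hull (range y)) \<subseteq> scl E"
    using convex_hull_separable[of "range y"] by auto
  have lim: "\<exists>z\<in>K. wlim (y \<circ> r) z nat_ultrafilter" for r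
    using compactin_ultrafilter_limit[OF K nat_ultrafilter(1), of "y \<circ> r"] y by auto
  have "z \<in> scl E" if "wlim (y \<circ> r) z nat_ultrafilter" for r z
    using wlim_in_scl[OF convex_convex_hull that nat_ultrafilter_neq_bot, of "range y"] E
    by (auto simp: hull_inc)
  then have "\<exists>z\<in>scl E. wlim (y \<circ> r) z nat_ultrafilter" for r using lim by blast
  then obtain r z where r: "strict_mono r" "wlim (y \<circ> r) z nat_ultrafilter" "wlim (y \<circ> r) z sequentially"
    using weak_subsequence_if_ultralimits[OF E(1), of y] by blast
  obtain z' where "z' \<in> K" "wlim (y \<circ> r) z' nat_ultrafilter" using lim by blast
  then have "z \<in> K" using wlim_unique[OF r(2)] nat_ultrafilter_neq_bot by blast
  then show ?thesis using that r by blast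
qed

text \<open>Weakly open sets are strongly open, so a weakly open cover of a separable set has a countable subcover.\<close>

lemma weakly_compact_if_separable_seq_compact:
  assumes E: "countable E" "D \<subseteq> scl E"
    and seq: "\<And>y. (\<And>n::nat. y n \<in> D) \<Longrightarrow> \<exists>r z. strict_mono r \<and> z \<in> D \<and> wlim (y \<circ> r) z sequentially"
  shows "compactin (weak_top N) D"
  unfolding compactin_def
proof (intro conjI allI impI)
  fix \<C> assume \<C>: "Ball \<C> (openin (weak_top N)) \<and> D \<subseteq> \<Union>\<C>"
  define B where "B e r = {x. mnorm (x - e) < r}" for e r
  \<comment> \<open>Balls of rational radius around points of \<open>E\<close> that fit into a
    member of the cover: a countable refinement.\<close>
  define I where "I = {(e, r). e \<in> E \<and> r \<in> (\<rat> :: real set) \<and> (\<exists>W\<in>\<C>. B e r \<subseteq> W)}"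
  define W where "W = (\<lambda>(e, r). SOME W. W \<in> \<C> \<and> B e r \<subseteq> W)"
  have W: "W (e, r) \<in> \<C>" "B e r \<subseteq> W (e, r)" if "(e, r) \<in> I" for e r
  proof -
    have "\<exists>W. W \<in> \<C> \<and> B e r \<subseteq> W" using that by (auto simp: I_def)
    from someI_ex[OF this] show "W (e, r) \<in> \<C>" "B e r \<subseteq> W (e, r)" by (auto simp: W_def)
  qed
  have "I \<subseteq> E \<times> \<rat>" by (auto simp: I_def)
  then have "countable I" by (rule countable_subset) (auto simp: E countable_rat)
  have cover: "\<exists>i\<in>I. x \<in> W i" if xD: "x \<in> D" for x
  proof -
    obtain V where V: "V \<in> \<C>" "x \<in> V" using \<C> xD by auto
    then obtain \<epsilon> where \<epsilon>: "0 < \<epsilon>" "\<And>y. mnorm (y - x) < \<epsilon> \<Longrightarrow> y \<in> V"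
      using openin_weak_imp_strong \<C> by metis
    obtain e where e: "e \<in> E" "mnorm (x - e) < \<epsilon> / 2"
      using sclD[of x E "\<epsilon> / 2"] E xD \<epsilon> by auto
    obtain r where r: "r \<in> \<rat>" "mnorm (x - e) < r" "r < \<epsilon> / 2" using Rats_dense_in_real[OF e(2)] by auto
    have "B e r \<subseteq> V"
    proof
      fix y assume "y \<in> B e r"
      then have "mnorm (y - x) < \<epsilon>"
        using mnorm_diff_triangle[of y x e] r by (simp add: B_def mnorm_minus_commute)
      then show "y \<in> V" by (rule \<epsilon>(2))
    qed
    then have "(e, r) \<in> I" using e r V by (auto simp: I_def)
    then show ?thesis using W(2) r(2) by (force simp: B_def)
  qed
  show "\<exists>\<F>. finite \<F> \<and> \<F> \<subseteq> \<C> \<and> D \<subseteq> \<Union>\<F>"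
  proof (cases "D = {}")
    case False
    then have "I \<noteq> {}" using cover by auto
    define O' where "O' n = W (from_nat_into I n)" for n :: nat
    have O'C: "O' n \<in> \<C>" for n
      using from_nat_into[OF \<open>I \<noteq> {}\<close>, of n] W(1) by (cases "from_nat_into I n") (auto simp: O'_def)
    have O'cover: "\<exists>n. x \<in> O' n" if "x \<in> D" for x
      using cover[OF that] from_nat_into_surj[OF \<open>countable I\<close>] unfolding O'_def by metis
    \<comment> \<open>Otherwise there are \<open>y n\<close> outside the first \<open>n + 1\<close>
      sets, but a subsequential limit lies in some \<open>O' i\<close>, which the subsequence then
      enters at arbitrarily late indices.\<close>
    have "\<exists>n. D \<subseteq> (\<Union>i\<le>n. O' i)"
    proof (rule ccontr)
      assume "\<not> ?thesis"
      then have "\<forall>n. \<exists>x. x \<in> D \<and> (\<forall>i\<le>n. x \<notin> O' i)" by blast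
      then obtain y where y: "\<And>n. y n \<in> D" "\<And>n i. i \<le> n \<Longrightarrow> y n \<notin> O' i" by metis
      obtain r z where r: "strict_mono r" "z \<in> D" "wlim (y \<circ> r) z sequentially" using seq[of y] y(1) by blast
      obtain i where i: "z \<in> O' i" using O'cover[OF r(2)] by auto
      then have "eventually (\<lambda>n. (y \<circ> r) n \<in> O' i) sequentially"
        using r(3) \<C> O'C by (auto simp: limitin_def)
      then obtain n where n: "n \<ge> i" "y (r n) \<in> O' i"
        unfolding eventually_sequentially by (metis linear o_apply order_refl)
      then show False using y(2)[of i "r n"] seq_suble[OF r(1), of n] by simp
    qed
    then obtain n where "D \<subseteq> (\<Union>i\<le>n. O' i)" by auto
    then show ?thesis using O'C by (intro exI[of _ "O' ` {..n}"]) auto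
  qed auto
qed simp

subsection \<open>The measure of weak noncompactness\<close>

text \<open>The rate is the one met in the applications, where \<open>s m\<close> approximates a
  common object up to a multiple of \<open>inverse (real (Suc m))\<close>.\<close>

lemma strong_complete:
  assumes "\<And>m n::nat. mnorm (s m - s n) \<le> C * (inverse (real (Suc m)) + inverse (real (Suc n)))"
  obtains x where "(\<lambda>n. mnorm (s n - x)) \<longlonglongrightarrow> 0"
proof -
  have "(\<lambda>n. C * inverse (real (Suc n))) \<longlonglongrightarrow> C * 0"
    by (intro tendsto_mult tendsto_const LIMSEQ_inverse_real_of_nat)
  then have lim: "(\<lambda>n. C * inverse (real (Suc n))) \<longlonglongrightarrow> 0" by simp
  have "strong.MCauchy s" unfolding strong.MCauchy_def
  proof (intro conjI allI impI subset_UNIV)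
    fix \<epsilon> :: real assume "0 < \<epsilon>"
    then have "\<forall>\<^sub>F n in sequentially. C * inverse (real (Suc n)) < \<epsilon> / 2"
      using order_tendstoD(2)[OF lim, of "\<epsilon> / 2"] by simp
    then obtain M where M: "\<And>n. M \<le> n \<Longrightarrow> C * inverse (real (Suc n)) < \<epsilon> / 2"
      by (auto simp: eventually_sequentially)
    have "max_dist N (s n) (s n') < \<epsilon>" if "M \<le> n" "M \<le> n'" for n n'
      using assms[of n n'] M[OF that(1)] M[OF that(2)] by (simp add: max_dist_eq distrib_left)
    then show "\<exists>M. \<forall>n n'. M \<le> n \<longrightarrow> M \<le> n' \<longrightarrow> max_dist N (s n) (s n') < \<epsilon>" by blast
  qed
  then obtain x where "limitin strong.mtopology s x sequentially"
    using vnorm_complete unfolding strong.mcomplete_def by auto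
  then have "(\<lambda>n. mnorm (s n - x)) \<longlonglongrightarrow> 0"
    by (auto simp: strong.limitin_metric tendsto_iff max_dist_eq dist_real_def mnorm_nonneg)
  then show ?thesis by (rule that)
qed

lemma mnorm_tendsto_imp_wlim: "((\<lambda>n. mnorm (s n - x)) \<longlongrightarrow> 0) F \<Longrightarrow> wlim s x F"
  using wlim_strong_perturbation[OF wlim_const[of x F]] by blast

lemma continuous_map_weak_dual: "dual f \<Longrightarrow> continuous_map (weak_top N) euclideanreal f"
  using openin_weak_vimage by (auto simp: continuous_map_def vimage_def)

text \<open>Addition is jointly continuous for the weak topology. On the subbase this holds because
  a functional of a sum is a sum of functionals.\<close>

lemma compactin_weak_sum:
  assumes "compactin (weak_top N) K" "compactin (weak_top N) L"
  shows "compactin (weak_top N) {k + l | k l. k \<in> K \<and> l \<in> L}"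
proof -
  let ?P = "prod_topology (weak_top N) (weak_top N)"
  have "continuous_map ?P (weak_top N) (\<lambda>p. fst p + snd p)"
    unfolding weak_top_def weak_top_subbase continuous_on_generated_topo_iff
  proof (intro conjI ballI allI impI)
    let ?Q = "prod_topology (topology_generated_by {f -` V |f V. dual f \<and> open V})
                (topology_generated_by {f -` V |f V. dual f \<and> open V})"
    have Q: "?Q = ?P" by (simp add: weak_top_def weak_top_subbase)
    fix U assume "U \<in> {f -` V | f V. dual f \<and> open V}"
    then obtain f V where U: "U = f -` V" "dual f" "open V" by auto
    note f = continuous_map_weak_dual[OF U(2)]
    have "continuous_map ?P euclideanreal (\<lambda>p. f (fst p) + f (snd p))"
      using continuous_map_compose[OF continuous_map_fst f] continuous_map_compose[OF continuous_map_snd f]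
      by (intro continuous_map_add) (auto simp: o_def)
    then have "openin ?P {p \<in> topspace ?P. f (fst p) + f (snd p) \<in> V}"
      using U(3) by (intro openin_continuous_map_preimage) auto
    also have "{p \<in> topspace ?P. f (fst p) + f (snd p) \<in> V} = (\<lambda>p. fst p + snd p) -` U \<inter> topspace ?P"
      using U(1) by (auto simp: linear_add[OF dual_linear[OF U(2)]])
    finally show "openin ?Q ((\<lambda>p. fst p + snd p) -` U \<inter> topspace ?Q)" unfolding Q .
  next
    have "UNIV \<in> {f -` V |f V. dual f \<and> open V}" using dual_zero by blast
    then show "(\<lambda>p. fst p + snd p) ` topspace (prod_topology (topology_generated_by {f -` V |f V. dual f \<and> open V})
                (topology_generated_by {f -` V |f V. dual f \<and> open V})) \<subseteq> \<Union> {f -` V |f V. dual f \<and> open V}"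
      by blast
  qed
  then have "compactin (weak_top N) ((\<lambda>p. fst p + snd p) ` (K \<times> L))"
    using assms by (intro image_compactin) (auto simp: compactin_Times)
  also have "(\<lambda>p. fst p + snd p) ` (K \<times> L) = {k + l | k l. k \<in> K \<and> l \<in> L}" by force
  finally show ?thesis .
qed

definition mu_radii :: "'a set \<Rightarrow> (real ^ 'n) set" where
  "mu_radii V = {r. 0 \<le> r \<and>
     (\<exists>K. compactin (weak_top N) K \<and> V \<subseteq> {k + b | k b. k \<in> K \<and> b \<in> vball N r})}"

lemma mu_radiiI:
  assumes "0 \<le> r" "compactin (weak_top N) K" "\<And>x. x \<in> V \<Longrightarrow> \<exists>k\<in>K. N (x - k) \<le> r"
  shows "r \<in> mu_radii V"
  unfolding mu_radii_def
proof (intro CollectI conjI exI[of _ K] subsetI)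
  fix x assume "x \<in> V"
  then obtain k where "k \<in> K" "N (x - k) \<le> r" using assms(3) by auto
  then show "\<exists>k b. x = k + b \<and> k \<in> K \<and> b \<in> vball N r"
    by (intro exI[of _ k] exI[of _ "x - k"]) (auto simp: vball_def)
qed (use assms in auto)

lemma mu_radiiD:
  assumes "r \<in> mu_radii V"
  obtains K where "0 \<le> r" "compactin (weak_top N) K" "\<And>x. x \<in> V \<Longrightarrow> \<exists>k\<in>K. N (x - k) \<le> r"
proof -
  obtain K where K: "0 \<le> r" "compactin (weak_top N) K" "V \<subseteq> {k + b | k b. k \<in> K \<and> b \<in> vball N r}"
    using assms by (auto simp: mu_radii_def)
  have "\<exists>k\<in>K. N (x - k) \<le> r" if "x \<in> V" for x
    using K(3) that by (force simp: vball_def)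
  then show ?thesis using that K by blast
qed

lemma mu_component: "mu N V $ i = (INF r\<in>mu_radii V. r $ i)"
  by (simp add: mu_def mu_radii_def Inf_vec_def)

lemma mu_radii_nonempty:
  assumes "vbounded N V" shows "mu_radii V \<noteq> {}"
proof -
  obtain r where r: "\<And>x. x \<in> V \<Longrightarrow> N x \<le> r" using assms by (auto simp: vbounded_def)
  have "(\<chi> i. \<bar>r $ i\<bar>) \<in> mu_radii V"
  proof (rule mu_radiiI[where K = "{0}"])
    show "\<exists>k\<in>{0}. N (x - k) \<le> (\<chi> i. \<bar>r $ i\<bar>)" if "x \<in> V" for x
      using r[OF that] by (auto simp: less_eq_vec_def intro: order_trans)
  qed (auto simp: less_eq_vec_def)
  then show ?thesis by auto
qed

lemma mu_le: "r \<in> mu_radii V \<Longrightarrow> mu N V \<le> r"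
  unfolding less_eq_vec_def mu_component
  by (intro allI cINF_lower) (auto simp: mu_radii_def less_eq_vec_def intro!: bdd_belowI2[of _ 0])

lemma mu_approx:
  assumes "vbounded N V" "0 < \<epsilon>"
  obtains r where "r \<in> mu_radii V" "r $ i < mu N V $ i + \<epsilon>"
proof -
  have "\<exists>y\<in>(\<lambda>r. r $ i) ` mu_radii V. y < mu N V $ i + \<epsilon>"
    unfolding mu_component using assms mu_radii_nonempty by (intro cInf_lessD) auto
  then show ?thesis using that by auto
qed

lemma mu_leI:
  assumes "vbounded N W" "\<And>r. r \<in> mu_radii W \<Longrightarrow> r \<in> mu_radii V"
  shows "mu N V \<le> mu N W"
  unfolding less_eq_vec_def
proof
  fix i show "mu N V $ i \<le> mu N W $ i"
  proof (rule field_le_epsilon)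
    fix \<epsilon> :: real assume "0 < \<epsilon>"
    then obtain r where r: "r \<in> mu_radii W" "r $ i < mu N W $ i + \<epsilon>" using mu_approx[OF assms(1)] by blast
    then have "mu N V $ i \<le> r $ i" "r $ i < mu N W $ i + \<epsilon>"
      using mu_le[OF assms(2)[of r]] by (simp_all add: less_eq_vec_def)
    then show "mu N V $ i \<le> mu N W $ i + \<epsilon>" by simp
  qed
qed

lemma mu_nonneg: "vbounded N V \<Longrightarrow> 0 \<le> mu N V"
  unfolding less_eq_vec_def mu_component
  by (intro allI cINF_greatest order_refl mu_radii_nonempty) (auto simp: mu_radii_def less_eq_vec_def
       intro!: cINF_greatest mu_radii_nonempty)

lemma mu_mono:
  assumes "vbounded N W" "V \<subseteq> W" shows "mu N V \<le> mu N W"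
proof (rule mu_leI[OF assms(1)])
  show "r \<in> mu_radii V" if "r \<in> mu_radii W" for r
    using that assms(2) by (auto elim!: mu_radiiD intro!: mu_radiiI)
qed

lemma mu_weakly_compact_le_0:
  assumes "compactin (weak_top N) K" "V \<subseteq> K" shows "mu N V \<le> 0"
  using assms by (intro mu_le mu_radiiI[of 0 K]) (auto intro!: bexI simp: vnorm_zero)

lemma mu_insert_le:
  assumes "vbounded N V" shows "mu N (insert x V) \<le> mu N V"
proof (rule mu_leI[OF assms])
  fix r assume "r \<in> mu_radii V"
  then obtain K where K: "0 \<le> r" "compactin (weak_top N) K" "\<And>x. x \<in> V \<Longrightarrow> \<exists>k\<in>K. N (x - k) \<le> r"
    using mu_radiiD by metis
  have "compactin (weak_top N) ({x} \<union> K)" using K(2) by (intro compactin_Un) auto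
  then show "r \<in> mu_radii (insert x V)"
    using K by (intro mu_radiiI[of r "{x} \<union> K"]) (auto simp: vnorm_zero)
qed

lemma mu_sum_le:
  assumes "vbounded N V" "vbounded N W"
  shows "mu N {v + w | v w. v \<in> V \<and> w \<in> W} \<le> mu N V + mu N W"
  unfolding less_eq_vec_def
proof
  fix i
  let ?S = "{v + w | v w. v \<in> V \<and> w \<in> W}"
  show "mu N ?S $ i \<le> (mu N V + mu N W) $ i"
  proof (rule field_le_epsilon)
    fix \<epsilon> :: real assume "0 < \<epsilon>"
    then obtain r where r: "r \<in> mu_radii V" "r $ i < mu N V $ i + \<epsilon> / 2"
      using mu_approx[OF assms(1), of "\<epsilon> / 2"] by auto
    obtain s where s: "s \<in> mu_radii W" "s $ i < mu N W $ i + \<epsilon> / 2"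
      using mu_approx[OF assms(2), of "\<epsilon> / 2"] \<open>0 < \<epsilon>\<close> by auto
    obtain K where K: "0 \<le> r" "compactin (weak_top N) K" "\<And>x. x \<in> V \<Longrightarrow> \<exists>k\<in>K. N (x - k) \<le> r"
      using mu_radiiD[OF r(1)] by metis
    obtain L where L: "0 \<le> s" "compactin (weak_top N) L" "\<And>x. x \<in> W \<Longrightarrow> \<exists>k\<in>L. N (x - k) \<le> s"
      using mu_radiiD[OF s(1)] by metis
    have "r + s \<in> mu_radii ?S"
    proof (rule mu_radiiI)
      show "compactin (weak_top N) {k + l | k l. k \<in> K \<and> l \<in> L}" using K L by (intro compactin_weak_sum)
      fix x assume "x \<in> ?S"
      then obtain v w where x: "x = v + w" "v \<in> V" "w \<in> W" by auto
      obtain k l where kl: "k \<in> K" "N (v - k) \<le> r" "l \<in> L" "N (w - l) \<le> s" using K(3) L(3) x by metis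
      have "N (x - (k + l)) \<le> N (v - k) + N (w - l)"
        using vnorm_triangle[of "v - k" "w - l"] by (simp add: x(1) algebra_simps)
      also have "\<dots> \<le> r + s" using kl by (intro add_mono)
      finally show "\<exists>k\<in>{k + l | k l. k \<in> K \<and> l \<in> L}. N (x - k) \<le> r + s" using kl by blast
    qed (use K L in \<open>simp add: add_nonneg_nonneg\<close>)
    from mu_le[OF this] r(2) s(2) show "mu N ?S $ i \<le> (mu N V + mu N W) $ i + \<epsilon>"
      by (auto simp: less_eq_vec_def dest!: spec[of _ i])
  qed
qed

section \<open>Weak ultralimits in sets of measure zero\<close>

lemma dual_ball_uminus: "f \<in> dual_ball \<Longrightarrow> (\<lambda>x. - f x) \<in> dual_ball"
  using dual_ball_abs_le[of f] by (auto simp: dual_ball_def linear_compose_neg abs_le_iff)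

lemma dual_ball_ultrafilter_bounded:
  assumes "vbounded N V" "eventually (\<lambda>n. x n \<in> V) U" "ultrafilter U" "f \<in> dual_ball"
  shows "((\<lambda>n. f (x n)) \<longlongrightarrow> Lim U (\<lambda>n. f (x n))) U"
proof -
  obtain r where r: "\<And>x. x \<in> V \<Longrightarrow> N x \<le> r" using assms by (auto simp: vbounded_def)
  have b: "mnorm v \<le> Max (range (\<lambda>i. r $ i))" if "v \<in> V" for v
    unfolding mnorm_le_iff
  proof
    fix i
    have "N v $ i \<le> r $ i" using r[OF that] by (simp add: less_eq_vec_def)
    also have "\<dots> \<le> Max (range (\<lambda>i. r $ i))" by simp
    finally show "N v $ i \<le> Max (range (\<lambda>i. r $ i))" .
  qed
  have "\<bar>f v\<bar> \<le> Max (range (\<lambda>i. r $ i))" if "v \<in> V" for v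
    using dual_ball_abs_le[OF assms(4), of v] b[OF that] by simp
  then have "\<forall>\<^sub>F n in U. \<bar>f (x n)\<bar> \<le> Max (range (\<lambda>i. r $ i))"
    using assms(2) by (auto elim: eventually_mono)
  then show ?thesis by (rule ultrafilter_bounded_limit[OF assms(3)])
qed

text \<open>A component of the norm is only a seminorm, but it is sublinear and so has its own
  norming functionals; these are continuous because the maximum norm dominates every
  component.\<close>

lemma vnorm_norming_functional:
  obtains f where "f \<in> dual_ball" "\<And>x. f x \<le> N x $ i" "f z = N z $ i"
proof -
  have "sublinear (\<lambda>x. N x $ i)"
    by (auto simp: sublinear_def vnorm_component_triangle vnorm_component_scaleR)
  then obtain f where f: "linear f" "\<And>x. f x \<le> N x $ i" "N z $ i \<le> f z"
    using mazur_orlicz[of "\<lambda>x. N x $ i" "{z}" "N z $ i"] by auto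
  then show ?thesis
    using that[of f] by (auto simp: dual_ball_def intro: antisym order_trans[OF _ component_le_mnorm])
qed

text \<open>If all hull points were far from the \<open>k i\<close> in the sum of the seminorms on
  the product space, some functional would be at least \<open>2 * c * \<epsilon>\<close> at every
  vector of differences \<open>x n - k i\<close>. It splits into functionals dominated by single
  components, and this bounds it by a quantity tending to \<open>c * \<epsilon>\<close>, one
  \<epsilon> per component. The predicate \<open>P\<close> restricts the combinations to a chosen
  large set of indices.\<close>

lemma ultrafilter_convex_approximation:
  fixes x :: "'b \<Rightarrow> 'a" and \<kappa> :: "'n \<Rightarrow> 'b \<Rightarrow> 'a" and k :: "'n \<Rightarrow> 'a"
  assumes U: "U \<noteq> bot" and \<kappa>: "\<And>i n. N (x n - \<kappa> i n) $ i \<le> \<epsilon>" "\<And>i. wlim (\<kappa> i) (k i) U"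
    and P: "eventually P U" and \<epsilon>: "0 < \<epsilon>"
  obtains z where "z \<in> convex hull (x ` {n. P n})" "\<And>i. N (z - k i) $ i \<le> 2 * real CARD('n) * \<epsilon>"
proof -
  define c where "c = real CARD('n)"
  have c: "0 < c" by (simp add: c_def)
  define q where "q w = (\<Sum>i\<in>UNIV. N (w $ i) $ i)" for w :: "'a ^ 'n"
  have q: "sublinear q" unfolding sublinear_def q_def
    by (auto simp: sum_distrib_left vnorm_component_scaleR vnorm_component_triangle sum.distrib[symmetric] intro!: sum_mono)
  define D where "D = (\<lambda>z. \<chi> i. z - k i) ` (convex hull (x ` {n. P n}))"
  have "\<exists>z\<in>convex hull (x ` {n. P n}). q (\<chi> i. z - k i) < 2 * c * \<epsilon>"
  proof (rule ccontr)
    assume contra: "\<not> ?thesis"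
    have "convex D" unfolding convex_alt
    proof (intro ballI allI impI)
      fix v w t assume "v \<in> D" "w \<in> D" and t: "0 \<le> t \<and> t \<le> (1::real)"
      then obtain y z where yz: "y \<in> convex hull (x ` {n. P n})" "z \<in> convex hull (x ` {n. P n})"
        and vw: "v = (\<chi> i. y - k i)" "w = (\<chi> i. z - k i)" by (auto simp: D_def)
      have "(1 - t) *\<^sub>R y + t *\<^sub>R z \<in> convex hull (x ` {n. P n})"
        using convex_convex_hull yz t by (auto simp: convex_alt)
      moreover have "(1 - t) *\<^sub>R v + t *\<^sub>R w = (\<chi> i. ((1 - t) *\<^sub>R y + t *\<^sub>R z) - k i)"
        unfolding vw by (simp add: vec_eq_iff algebra_simps)
      ultimately show "(1 - t) *\<^sub>R v + t *\<^sub>R w \<in> D" by (auto simp: D_def)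
    qed
    moreover have "D \<noteq> {}" using eventually_happens'[OF U P] by (auto simp: D_def)
    ultimately obtain f where f: "linear f" "\<And>w. f w \<le> q w" "\<And>d. d \<in> D \<Longrightarrow> 2 * c * \<epsilon> \<le> f d"
      using mazur_orlicz[OF q, of D "2 * c * \<epsilon>"] contra by (auto simp: D_def not_less)
    \<comment> \<open>Restrictions to the coordinate axes; on the axis \<open>i\<close>,
      \<open>q\<close> is just component \<open>i\<close> of the norm.\<close>
    define \<phi> where "\<phi> i v = f (axis i v)" for i v
    have \<phi>_lin: "linear (\<phi> i)" for i
    proof (rule linearI)
      show "\<phi> i (u + v) = \<phi> i u + \<phi> i v" for u v
        by (simp add: \<phi>_def linear_add[OF f(1), symmetric]) (rule arg_cong[of _ _ f], simp add: vec_eq_iff axis_def)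
      show "\<phi> i (a *\<^sub>R v) = a *\<^sub>R \<phi> i v" for a v
        by (simp add: \<phi>_def linear_scale[OF f(1), symmetric, simplified]) (rule arg_cong[of _ _ f], simp add: vec_eq_iff axis_def)
    qed
    have \<phi>_le: "\<phi> i v \<le> N v $ i" for i v
    proof -
      have "q (axis i v) = (\<Sum>j\<in>UNIV. if j = i then N v $ i else 0)"
        unfolding q_def by (intro sum.cong) (auto simp: axis_def vnorm_zero)
      then show ?thesis using f(2)[of "axis i v"] by (simp add: \<phi>_def)
    qed
    have \<phi>_ball: "\<phi> i \<in> dual_ball" for i
      using \<phi>_lin \<phi>_le component_le_mnorm order_trans by (fastforce simp: dual_ball_def)
    have f_eq: "f w = (\<Sum>i\<in>UNIV. \<phi> i (w $ i))" for w
    proof -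
      have "w = (\<Sum>i\<in>UNIV. axis i (w $ i))"
        by (simp add: vec_eq_iff sum_component axis_def if_distrib[of "\<lambda>h. h _"] cong: if_cong)
      then have "f w = f (\<Sum>i\<in>UNIV. axis i (w $ i))" by simp
      then show ?thesis by (simp add: linear_sum[OF f(1)] \<phi>_def)
    qed
    have "((\<lambda>n. (\<Sum>i\<in>UNIV. \<phi> i (\<kappa> i n) - \<phi> i (k i)) + c * \<epsilon>) \<longlongrightarrow> (\<Sum>i\<in>UNIV. \<phi> i (k i) - \<phi> i (k i)) + c * \<epsilon>) U"
      using wlim_dualD[OF \<kappa>(2) dual_ball_imp_dual[OF \<phi>_ball]] by (intro tendsto_intros)
    then have "((\<lambda>n. (\<Sum>i\<in>UNIV. \<phi> i (\<kappa> i n) - \<phi> i (k i)) + c * \<epsilon>) \<longlongrightarrow> c * \<epsilon>) U" by simp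
    moreover have "\<forall>\<^sub>F n in U. 2 * c * \<epsilon> \<le> (\<Sum>i\<in>UNIV. \<phi> i (\<kappa> i n) - \<phi> i (k i)) + c * \<epsilon>"
    proof (rule eventually_mono[OF P])
      fix n assume "P n"
      have "2 * c * \<epsilon> \<le> f (\<chi> i. x n - k i)" using \<open>P n\<close> by (intro f(3)) (auto simp: D_def hull_inc)
      also have "\<dots> = (\<Sum>i\<in>UNIV. (\<phi> i (\<kappa> i n) - \<phi> i (k i)) + \<phi> i (x n - \<kappa> i n))"
        unfolding f_eq by (simp add: dual_ball_diff[OF \<phi>_ball])
      also have "\<dots> \<le> (\<Sum>i\<in>UNIV. (\<phi> i (\<kappa> i n) - \<phi> i (k i)) + \<epsilon>)"
        using order_trans[OF \<phi>_le \<kappa>(1)] by (intro sum_mono add_left_mono)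
      also have "\<dots> = (\<Sum>i\<in>UNIV. \<phi> i (\<kappa> i n) - \<phi> i (k i)) + c * \<epsilon>"
        by (simp add: sum.distrib c_def)
      finally show "2 * c * \<epsilon> \<le> (\<Sum>i\<in>UNIV. \<phi> i (\<kappa> i n) - \<phi> i (k i)) + c * \<epsilon>" .
    qed
    ultimately have "2 * c * \<epsilon> \<le> c * \<epsilon>" using tendsto_lowerbound U by blast
    then show False using c \<epsilon> by simp
  qed
  then obtain z where z: "z \<in> convex hull (x ` {n. P n})" "q (\<chi> i. z - k i) < 2 * c * \<epsilon>" by auto
  have "N (z - k i) $ i \<le> 2 * c * \<epsilon>" for i
  proof -
    have "N (z - k i) $ i \<le> q (\<chi> i. z - k i)"
      unfolding q_def using member_le_sum[of i UNIV "\<lambda>i. N (z - k i) $ i"] vnorm_component_nonneg by simp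
    then show ?thesis using z(2) by simp
  qed
  then show ?thesis using that z(1) by (auto simp: c_def)
qed

text \<open>At each precision \<open>m\<close> the weakly compact sets give limits
  \<open>k m i\<close>, one per component. Convex combinations of the \<open>x n\<close> that are
  near all of them form a Cauchy sequence, whose norm limit \<open>z\<close> is the candidate.
  Combinations using only indices where \<open>f (x n)\<close> barely exceeds its ultralimit can be
  kept near the same points, so they also converge to \<open>z\<close>. This bounds
  \<open>f z\<close> from above, and \<open>- f\<close> gives the other bound.\<close>

theorem mu_le_0_imp_ultralimit:
  assumes V: "vbounded N V" "mu N V \<le> 0" and x: "\<And>n. x n \<in> V" and U: "ultrafilter U"
  obtains z where "wlim x z U"
proof -
  have U': "U \<noteq> bot" by (rule ultrafilter_neq_bot[OF U])
  define \<epsilon> where "\<epsilon> m = inverse (real (Suc m))" for m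
  have \<epsilon>: "0 < \<epsilon> m" for m by (simp add: \<epsilon>_def)
  have "\<forall>m i. \<exists>\<kappa> k. (\<forall>n. N (x n - \<kappa> n) $ i \<le> \<epsilon> m) \<and> wlim \<kappa> k U"
  proof (intro allI)
    fix m i
    obtain r where r: "r \<in> mu_radii V" "r $ i < mu N V $ i + \<epsilon> m" using mu_approx[OF V(1) \<epsilon>] by blast
    obtain K where K: "compactin (weak_top N) K" "\<And>x. x \<in> V \<Longrightarrow> \<exists>k\<in>K. N (x - k) \<le> r"
      using mu_radiiD[OF r(1)] by metis
    have "\<forall>n. \<exists>k\<in>K. N (x n - k) \<le> r" using K(2) x by blast
    then obtain \<kappa> where \<kappa>: "\<And>n. \<kappa> n \<in> K" "\<And>n. N (x n - \<kappa> n) \<le> r" by metis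
    obtain k where "wlim \<kappa> k U" using compactin_ultrafilter_limit[OF K(1) U, of \<kappa>] \<kappa>(1) by auto
    moreover have "N (x n - \<kappa> n) $ i \<le> \<epsilon> m" for n
    proof -
      have "N (x n - \<kappa> n) $ i \<le> r $ i" using \<kappa>(2)[of n] by (simp add: less_eq_vec_def)
      moreover have "mu N V $ i \<le> 0" using V(2) by (simp add: less_eq_vec_def)
      ultimately show ?thesis using r(2) by linarith
    qed
    ultimately show "\<exists>\<kappa> k. (\<forall>n. N (x n - \<kappa> n) $ i \<le> \<epsilon> m) \<and> wlim \<kappa> k U" by blast
  qed
  then obtain \<kappa> k where \<kappa>: "\<And>m i n. N (x n - \<kappa> m i n) $ i \<le> \<epsilon> m" "\<And>m i. wlim (\<kappa> m i) (k m i) U"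
    unfolding choice_iff by blast
  \<comment> \<open>Both \<open>\<kappa> m i n\<close> and \<open>\<kappa> l i n\<close> are close
    to \<open>x n\<close> in component \<open>i\<close>, and a functional norming that component
    carries the estimate to the weak limits.\<close>
  have k_dist: "N (k m i - k l i) $ i \<le> \<epsilon> m + \<epsilon> l" for m l i
  proof -
    obtain f where f: "f \<in> dual_ball" "\<And>x. f x \<le> N x $ i" "f (k m i - k l i) = N (k m i - k l i) $ i"
      using vnorm_norming_functional by blast
    have "f (k m i - k l i) \<le> \<epsilon> m + \<epsilon> l"
    proof (rule tendsto_upperbound[OF wlim_dualD[OF wlim_diff dual_ball_imp_dual[OF f(1)]] _ U'])
      show "\<forall>\<^sub>F n in U. f (\<kappa> m i n - \<kappa> l i n) \<le> \<epsilon> m + \<epsilon> l"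
      proof (intro always_eventually allI)
        fix n
        have "f (\<kappa> m i n - \<kappa> l i n) \<le> N ((\<kappa> m i n - x n) + (x n - \<kappa> l i n)) $ i" using f(2) by simp
        also have "\<dots> \<le> N (\<kappa> m i n - x n) $ i + N (x n - \<kappa> l i n) $ i" by (rule vnorm_component_triangle)
        also have "N (\<kappa> m i n - x n) $ i = N (x n - \<kappa> m i n) $ i" using vnorm_minus[of "x n - \<kappa> m i n"] by simp
        also have "\<dots> + N (x n - \<kappa> l i n) $ i \<le> \<epsilon> m + \<epsilon> l" by (intro add_mono \<kappa>)
        finally show "f (\<kappa> m i n - \<kappa> l i n) \<le> \<epsilon> m + \<epsilon> l" .
      qed
    qed (rule \<kappa>)+
    then show ?thesis using f(3) by simp
  qed
  define c where "c = 2 * real CARD('n)"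
  define near where "near m z \<longleftrightarrow> (\<forall>i. N (z - k m i) $ i \<le> c * \<epsilon> m)" for m z
  have approx: "\<exists>z. z \<in> convex hull (x ` {n. P n}) \<and> near m z" if "eventually P U" for P m
    unfolding near_def c_def
    using ultrafilter_convex_approximation[OF U' \<kappa> that \<epsilon>] by metis
  \<comment> \<open>The factor \<open>c + 1\<close> collects \<open>c\<close> from
    \<open>near\<close> and 1 from \<open>k_dist\<close>.\<close>
  have near_dist: "mnorm (z - z') \<le> (c + 1) * (\<epsilon> m + \<epsilon> l)" if "near m z" "near l z'" for m l z z'
    unfolding mnorm_le_iff
  proof
    fix i
    have "N (z - z') $ i = N ((z - k m i) + ((k m i - k l i) + (k l i - z'))) $ i" by simp
    also have "\<dots> \<le> N (z - k m i) $ i + (N (k m i - k l i) $ i + N (k l i - z') $ i)"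
      by (intro order_trans[OF vnorm_component_triangle] add_left_mono vnorm_component_triangle)
    also have "N (k l i - z') $ i = N (z' - k l i) $ i" using vnorm_minus[of "z' - k l i"] by simp
    also have "N (z - k m i) $ i + (N (k m i - k l i) $ i + N (z' - k l i) $ i) \<le> c * \<epsilon> m + ((\<epsilon> m + \<epsilon> l) + c * \<epsilon> l)"
      using that by (intro add_mono k_dist) (auto simp: near_def)
    finally show "N (z - z') $ i \<le> (c + 1) * (\<epsilon> m + \<epsilon> l)" by (simp add: algebra_simps)
  qed
  have "\<forall>m. \<exists>z. near m z" using approx[of "\<lambda>n. True"] by auto
  then obtain \<zeta> where \<zeta>: "\<And>m. near m (\<zeta> m)" by metis
  obtain z where z: "(\<lambda>m. mnorm (\<zeta> m - z)) \<longlonglongrightarrow> 0"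
    using strong_complete[of \<zeta> "c + 1"] near_dist[OF \<zeta> \<zeta>] by (auto simp: \<epsilon>_def)
  have \<epsilon>_lim: "(\<lambda>m. (c + 1) * (\<epsilon> m + \<epsilon> m)) \<longlonglongrightarrow> 0"
    using tendsto_mult[OF tendsto_const[of "c + 1"] tendsto_add[OF LIMSEQ_inverse_real_of_nat LIMSEQ_inverse_real_of_nat]]
    by (simp add: \<epsilon>_def)
  have upper: "f z \<le> Lim U (\<lambda>n. f (x n))" if f: "f \<in> dual_ball" for f
  proof (rule field_le_epsilon)
    fix \<eta> :: real assume \<eta>: "0 < \<eta>"
    let ?\<xi> = "Lim U (\<lambda>n. f (x n))"
    have "((\<lambda>n. f (x n)) \<longlongrightarrow> ?\<xi>) U"
      by (rule dual_ball_ultrafilter_bounded[OF V(1) _ U f]) (simp add: x)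
    then have ev: "\<forall>\<^sub>F n in U. f (x n) < ?\<xi> + \<eta>" using \<eta> by (intro order_tendstoD(2)) auto
    have "\<forall>m. \<exists>z. z \<in> convex hull (x ` {n. f (x n) < ?\<xi> + \<eta>}) \<and> near m z" using approx[OF ev] by auto
    then obtain \<zeta>' where \<zeta>': "\<And>m. \<zeta>' m \<in> convex hull (x ` {n. f (x n) < ?\<xi> + \<eta>})" "\<And>m. near m (\<zeta>' m)"
      by metis
    have "convex {y. f y \<le> ?\<xi> + \<eta>}"
      using linear_add[OF dual_ball_linear[OF f]] linear_scale[OF dual_ball_linear[OF f]]
      by (auto simp: convex_def intro!: convex_bound_le)
    then have "convex hull (x ` {n. f (x n) < ?\<xi> + \<eta>}) \<subseteq> {y. f y \<le> ?\<xi> + \<eta>}"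
      by (intro hull_minimal) auto
    then have le: "f (\<zeta>' m) \<le> ?\<xi> + \<eta>" for m using \<zeta>'(1) by blast
    have "(\<lambda>m. (c + 1) * (\<epsilon> m + \<epsilon> m) + mnorm (\<zeta> m - z)) \<longlonglongrightarrow> 0"
      using tendsto_add[OF \<epsilon>_lim z] by simp
    moreover have "norm (mnorm (\<zeta>' m - z)) \<le> (c + 1) * (\<epsilon> m + \<epsilon> m) + mnorm (\<zeta> m - z)" for m
      using mnorm_diff_triangle[of "\<zeta>' m" z "\<zeta> m"] near_dist[OF \<zeta>'(2) \<zeta>, of m m] mnorm_nonneg[of "\<zeta>' m - z"] by simp
    ultimately have "(\<lambda>m. mnorm (\<zeta>' m - z)) \<longlonglongrightarrow> 0"
      by (rule Lim_null_comparison[OF always_eventually[OF allI], rotated])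
    then have "(\<lambda>m. f (\<zeta>' m)) \<longlonglongrightarrow> f z"
      by (rule wlim_dualD[OF mnorm_tendsto_imp_wlim dual_ball_imp_dual[OF f]])
    then show "f z \<le> ?\<xi> + \<eta>" by (rule LIMSEQ_le_const2) (use le in auto)
  qed
  have "wlim x z U" unfolding wlim_iff_dual_ball
  proof
    fix f assume f: "f \<in> dual_ball"
    have lim: "((\<lambda>n. f (x n)) \<longlongrightarrow> Lim U (\<lambda>n. f (x n))) U"
      by (rule dual_ball_ultrafilter_bounded[OF V(1) _ U f]) (simp add: x)
    have "Lim U (\<lambda>n. - f (x n)) = - Lim U (\<lambda>n. f (x n))"
      by (rule tendsto_Lim[OF U' tendsto_minus[OF lim]])
    then have "f z = Lim U (\<lambda>n. f (x n))" using upper[OF f] upper[OF dual_ball_uminus[OF f]] by simp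
    then show "((\<lambda>n. f (x n)) \<longlongrightarrow> f z) U" using lim by simp
  qed
  then show ?thesis by (rule that)
qed

subsection \<open>Closed convex hulls of weakly compact sequences\<close>

text \<open>A point of the hull of \<open>insert a F\<close> is a combination of \<open>a\<close>
  and some \<open>b\<close> in the hull of \<open>F\<close> with weight \<open>u\<close>; the
  induction replaces \<open>b\<close> by a net point and \<open>u\<close> by a multiple of
  \<open>1 / real k\<close>.\<close>

lemma convex_hull_finite_net:
  assumes "finite F" "0 < \<epsilon>"
  obtains G where "finite G" "G \<subseteq> convex hull F" "\<And>z. z \<in> convex hull F \<Longrightarrow> \<exists>g\<in>G. mnorm (z - g) < \<epsilon>"
proof -
  have "\<exists>G. finite G \<and> G \<subseteq> convex hull F \<and> (\<forall>z\<in>convex hull F. \<exists>g\<in>G. mnorm (z - g) < \<epsilon>)"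
    using assms
  proof (induction F arbitrary: \<epsilon> rule: finite_induct)
    case empty
    then show ?case by auto
  next
    case (insert a F)
    show ?case
    proof (cases "F = {}")
      case True
      then show ?thesis using insert by (intro exI[of _ "{a}"]) auto
    next
      case False
      obtain G where G: "finite G" "G \<subseteq> convex hull F" "\<And>z. z \<in> convex hull F \<Longrightarrow> \<exists>g\<in>G. mnorm (z - g) < \<epsilon> / 2"
        using insert.IH[of "\<epsilon> / 2"] insert.prems by auto
      \<comment> \<open>\<open>R\<close> bounds the distances from \<open>a\<close> to the net, so
        rounding \<open>u\<close> costs at most \<open>R / real k\<close>, less than
        \<open>\<epsilon> / 2\<close> for the \<open>k\<close> chosen below.\<close>
      define R where "R = Max (insert 0 ((\<lambda>g. mnorm (g - a)) ` G)) + 1"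
      have R: "mnorm (g - a) < R" if "g \<in> G" for g
      proof -
        have "mnorm (g - a) \<le> Max (insert 0 ((\<lambda>g. mnorm (g - a)) ` G))" using G(1) that by (intro Max_ge) auto
        then show ?thesis by (simp add: R_def)
      qed
      have "0 \<le> Max (insert 0 ((\<lambda>g. mnorm (g - a)) ` G))" using G(1) by (intro Max_ge) auto
      then have "0 < R" by (simp add: R_def)
      obtain k :: nat where k: "2 * R / \<epsilon> < real k" using reals_Archimedean2 by blast
      moreover have "0 < 2 * R / \<epsilon>" using \<open>0 < R\<close> insert.prems by simp
      ultimately have "0 < real k" by (rule less_trans[rotated])
      then have "0 < k" by simp
      define G' where "G' = (\<lambda>(j, g). (1 - real j / real k) *\<^sub>R a + (real j / real k) *\<^sub>R g) ` ({..k} \<times> G)"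
      have "finite G'" using G(1) by (auto simp: G'_def)
      moreover have "G' \<subseteq> convex hull (insert a F)"
      proof
        fix x assume "x \<in> G'"
        then obtain j g where jg: "j \<le> k" "g \<in> G" "x = (1 - real j / real k) *\<^sub>R a + (real j / real k) *\<^sub>R g"
          by (auto simp: G'_def)
        have "a \<in> convex hull (insert a F)" "g \<in> convex hull (insert a F)"
          using G(2) jg hull_mono[of F "insert a F" convex] by (auto simp: hull_inc)
        then show "x \<in> convex hull (insert a F)"
          unfolding jg(3) using jg(1) \<open>0 < k\<close> convex_convex_hull[of "insert a F"]
          by (auto simp: convex_alt)
      qed
      moreover have "\<exists>g\<in>G'. mnorm (z - g) < \<epsilon>" if z: "z \<in> convex hull (insert a F)" for z
      proof -
        obtain u b where ub: "0 \<le> u" "u \<le> 1" "b \<in> convex hull F" "z = (1 - u) *\<^sub>R a + u *\<^sub>R b"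
          using z unfolding convex_hull_insert_alt[of a F] using False by auto
        obtain g where g: "g \<in> G" "mnorm (b - g) < \<epsilon> / 2" using G(3)[OF ub(3)] by auto
        define j where "j = nat \<lfloor>u * real k\<rfloor>"
        have j: "real j \<le> u * real k" "u * real k \<le> real j + 1" using ub(1) by (auto simp: j_def)
        have "real j \<le> real k" using j(1) ub(2) mult_right_mono[of u 1 "real k"] by simp
        then have "j \<le> k" by simp
        have uj: "\<bar>u - real j / real k\<bar> \<le> 1 / real k" 
        proof -
          have "\<bar>u - real j / real k\<bar> = \<bar>u * real k - real j\<bar> / real k" using \<open>0 < k\<close> by (simp add: field_simps)
          also have "\<dots> \<le> 1 / real k" using j by (intro divide_right_mono) auto
          finally show ?thesis .
        qed
        have "z - ((1 - real j / real k) *\<^sub>R a + (real j / real k) *\<^sub>R g) = u *\<^sub>R (b - g) + (u - real j / real k) *\<^sub>R (g - a)"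
          unfolding ub(4) by (simp add: algebra_simps)
        also have "mnorm \<dots> \<le> u * mnorm (b - g) + \<bar>u - real j / real k\<bar> * mnorm (g - a)"
          using mnorm_triangle ub(1) by (metis abs_of_nonneg mnorm_scaleR)
        also have "\<dots> \<le> mnorm (b - g) + (1 / real k) * R"
          using ub uj R[OF g(1)] \<open>0 < k\<close> by (intro add_mono mult_mono mult_left_le_one_le mnorm_nonneg) auto
        also have "\<dots> < \<epsilon> / 2 + \<epsilon> / 2"
          using g(2) k \<open>0 < k\<close> insert.prems by (intro add_strict_mono) (auto simp: field_simps)
        finally have "mnorm (z - ((1 - real j / real k) *\<^sub>R a + (real j / real k) *\<^sub>R g)) < \<epsilon>" by simp
        moreover have "(1 - real j / real k) *\<^sub>R a + (real j / real k) *\<^sub>R g \<in> G'"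
          unfolding G'_def using \<open>j \<le> k\<close> g(1) by (intro image_eqI[of _ _ "(j, g)"]) auto
        ultimately show ?thesis by blast
      qed
      ultimately show ?thesis by blast
    qed
  qed
  then show ?thesis using that by blast
qed

text \<open>
  Let \<open>\<xi>\<close> be the limit of \<open>y\<close> along the ultrafilter, as a functional on the dual. If \<open>\<xi>\<close> has positive distance
  from the convex hull of \<open>y\<close>, separation gives \<open>\<phi> m\<close> in the dual ball with
  \<open>\<phi> m (y i) + \<epsilon> \<le> \<xi> (\<phi> m)\<close> for \<open>i \<le> m\<close>. A subsequence of \<open>\<phi>\<close> converges pointwise on the closed hull of \<open>k\<close>,
  and dominated convergence for the convex weights of the \<open>y n\<close> contradicts this inequality.
\<close>

lemma krein_ultralimit:
  assumes K: "compactin (weak_top N) K" and k: "\<And>j::nat. k j \<in> K" and R: "\<And>j. mnorm (k j) \<le> R"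
    and y: "\<And>n. y n \<in> convex hull (range k)"
  obtains z where "wlim y z nat_ultrafilter"
proof -
  let ?U = nat_ultrafilter
  note U = nat_ultrafilter(1)
  define D where "D = scl (convex hull (range k))"
  have D: "convex D" "scl D \<subseteq> D" "range k \<subseteq> D" "range y \<subseteq> D"
    using y scl_subset[of "convex hull (range k)"] scl_scl[of "convex hull (range k)"]
      convex_scl_convex[OF convex_convex_hull, of "range k"] hull_subset[of "range k" convex]
    unfolding D_def by blast+
  have "convex {x. mnorm x \<le> R}" unfolding convex_alt
  proof (intro ballI allI impI)
    fix u v t assume "u \<in> {x. mnorm x \<le> R}" "v \<in> {x. mnorm x \<le> R}" and t: "0 \<le> t \<and> t \<le> (1::real)"
    then have uv: "mnorm u \<le> R" "mnorm v \<le> R" by auto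
    have "mnorm ((1 - t) *\<^sub>R u + t *\<^sub>R v) \<le> (1 - t) * mnorm u + t * mnorm v"
      using mnorm_triangle[of "(1 - t) *\<^sub>R u" "t *\<^sub>R v"] t by (simp add: mnorm_scaleR)
    also have "\<dots> \<le> R" using uv t by (intro convex_bound_le) auto
    finally show "(1 - t) *\<^sub>R u + t *\<^sub>R v \<in> {x. mnorm x \<le> R}" by simp
  qed
  then have hull_R: "convex hull (range k) \<subseteq> {x. mnorm x \<le> R}" using R by (intro hull_minimal) auto
  have D_R: "mnorm d \<le> R" if d: "d \<in> D" for d
  proof (rule field_le_epsilon)
    fix \<epsilon> :: real assume "0 < \<epsilon>"
    then obtain c where c: "c \<in> convex hull (range k)" "mnorm (d - c) < \<epsilon>"
      using sclD d unfolding D_def by blast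
    then show "mnorm d \<le> R + \<epsilon>" using mnorm_triangle[of "d - c" c] hull_R by force
  qed
  \<comment> \<open>This weakly compact set contains all the \<open>k j\<close>. As a part of the
    closed hull \<open>D\<close> it consists of points where the functionals built below converge
    along a subsequence.\<close>
  define K' where "K' = D \<inter> K"
  have K': "compactin (weak_top N) K'" unfolding K'_def
    using closedin_weak_convex[OF D(1,2)] K by (rule closed_Int_compactin)
  have kK': "k j \<in> K'" for j using k D(3) by (auto simp: K'_def)
  have "\<forall>n. \<exists>S u. finite S \<and> S \<subseteq> range k \<and> (\<forall>v\<in>S. 0 \<le> u v) \<and> sum u S = 1 \<and> (\<Sum>v\<in>S. u v *\<^sub>R v) = y n"
    using y unfolding convex_hull_explicit by blast
  then obtain S u where S: "\<And>n. finite (S n)" "\<And>n. S n \<subseteq> range k" "\<And>n v. v \<in> S n \<Longrightarrow> (0::real) \<le> u n v"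
    "\<And>n. sum (u n) (S n) = 1" "\<And>n. (\<Sum>v\<in>S n. u n v *\<^sub>R v) = y n"
    unfolding choice_iff by blast
  have SK': "v \<in> K'" if "v \<in> S n" for v n using S(2) kK' that by blast
  \<comment> \<open>The convex weights of \<open>y n\<close> as a positive functional. It is
    evaluation at \<open>y n\<close> for linear \<open>h\<close>, but it will also be applied to
    absolute values of functionals.\<close>
  define \<Lambda> where "\<Lambda> n h = (\<Sum>v\<in>S n. u n v * h v)" for n and h :: "'a \<Rightarrow> real"
  have \<Lambda>_mono: "\<Lambda> n h \<le> \<Lambda> n h'" if "\<And>v. v \<in> K' \<Longrightarrow> h v \<le> h' v" for n h h'
    unfolding \<Lambda>_def using that SK' S(3) by (intro sum_mono mult_left_mono) auto
  have \<Lambda>_add: "\<Lambda> n (\<lambda>v. h v + h' v) = \<Lambda> n h + \<Lambda> n h'" for n h h'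
    by (simp add: \<Lambda>_def distrib_left sum.distrib)
  have \<Lambda>_const: "\<Lambda> n (\<lambda>v. c) = c" for n c
    by (simp add: \<Lambda>_def sum_distrib_right[symmetric] S(4))
  have \<Lambda>_linear: "\<Lambda> n f = f (y n)" if "linear f" for n f
    by (simp add: \<Lambda>_def S(5)[symmetric] linear_sum[OF that] linear_scale[OF that])
  define L where "L h = Lim ?U (\<lambda>n. \<Lambda> n h)" for h
  have L: "((\<lambda>n. \<Lambda> n h) \<longlongrightarrow> L h) ?U" if bdd: "bounded (h ` K')" for h
  proof -
    obtain b where b: "\<And>v. v \<in> K' \<Longrightarrow> \<bar>h v\<bar> \<le> b" using bdd by (auto simp: bounded_iff)
    have "\<Lambda> n h \<le> b" "- b \<le> \<Lambda> n h" for n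
      using \<Lambda>_mono[of h "\<lambda>v. b" n] \<Lambda>_mono[of "\<lambda>v. - b" h n] b by (auto simp: \<Lambda>_const abs_le_iff minus_le_iff)
    then have "\<forall>\<^sub>F n in ?U. \<bar>\<Lambda> n h\<bar> \<le> b" by (simp add: abs_le_iff minus_le_iff)
    then show ?thesis unfolding L_def by (rule ultrafilter_bounded_limit[OF U])
  qed
  define \<xi> where "\<xi> f = Lim ?U (\<lambda>n. f (y n))" for f :: "'a \<Rightarrow> real"
  have \<xi>: "((\<lambda>n. f (y n)) \<longlongrightarrow> \<xi> f) ?U" if f: "f \<in> dual_ball" for f
    unfolding \<xi>_def
  proof (rule ultrafilter_bounded_limit[OF U always_eventually], intro allI)
    fix n
    show "\<bar>f (y n)\<bar> \<le> R" using dual_ball_abs_le[OF f, of "y n"] D_R[of "y n"] D(4) by fastforce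
  qed
  \<comment> \<open>Once \<xi> is uniformly close on the dual ball to evaluations at points,
    completeness makes it an evaluation itself.\<close>
  have approx: "\<exists>z. \<forall>f\<in>dual_ball. \<xi> f - f z \<le> 2 * \<epsilon>" if \<epsilon>: "0 < \<epsilon>" for \<epsilon>
  proof (rule ccontr)
    assume "\<not> ?thesis"
    then have "\<forall>z. \<exists>f. f \<in> dual_ball \<and> 2 * \<epsilon> < \<xi> f - f z" by (meson not_le)
    then obtain \<psi> where \<psi>: "\<And>z. \<psi> z \<in> dual_ball" "\<And>z. 2 * \<epsilon> < \<xi> (\<psi> z) - \<psi> z z" by metis
    have "\<exists>f. f \<in> dual_ball \<and> (\<forall>i\<le>m. f (y i) + \<epsilon> \<le> \<xi> f)" for m
    proof -
      let ?F = "y ` {..m}"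
      obtain G where G: "finite G" "G \<subseteq> convex hull ?F" "\<And>z. z \<in> convex hull ?F \<Longrightarrow> \<exists>g\<in>G. mnorm (z - g) < \<epsilon>"
        using convex_hull_finite_net[of ?F \<epsilon>] \<epsilon> by auto
      \<comment> \<open>A large set of indices: for each of the finitely many net points
        \<open>g\<close>, the functional \<open>\<psi> g\<close> shows that \<open>y n\<close> is
        more than \<open>2 * \<epsilon>\<close> away from it. With a loss of \<epsilon> to the net,
        the hull of these \<open>y n\<close> has distance at least \<epsilon> from the hull of the
        first \<open>m + 1\<close> points.\<close>
      define A where "A n \<longleftrightarrow> (\<forall>g\<in>G. \<psi> g g + 2 * \<epsilon> < \<psi> g (y n))" for n
      have A: "eventually A ?U" unfolding A_def
      proof (intro eventually_ball_finite ballI G(1))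
        fix g show "\<forall>\<^sub>F n in ?U. \<psi> g g + 2 * \<epsilon> < \<psi> g (y n)"
          using \<psi>(2)[of g] by (intro order_tendstoD(1)[OF \<xi>[OF \<psi>(1)]]) simp
      qed
      define W where "W = (\<Union>w\<in>convex hull (y ` {n. A n}). \<Union>z\<in>convex hull ?F. {w - z})"
      have "convex W" unfolding W_def by (intro convex_differences convex_convex_hull)
      moreover have "W \<noteq> {}" using eventually_happens'[OF nat_ultrafilter_neq_bot A] by (auto simp: W_def)
      moreover have "\<epsilon> \<le> mnorm d" if "d \<in> W" for d
      proof -
        obtain w z where wz: "d = w - z" "w \<in> convex hull (y ` {n. A n})" "z \<in> convex hull ?F"
          using \<open>d \<in> W\<close> by (auto simp: W_def)
        obtain g where g: "g \<in> G" "mnorm (z - g) < \<epsilon>" using G(3)[OF wz(3)] by auto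
        have lin: "linear (\<psi> g)" using \<psi>(1) by (rule dual_ball_linear)
        have "convex {v. \<psi> g g + 2 * \<epsilon> \<le> \<psi> g v}"
        proof -
          have "{v. \<psi> g g + 2 * \<epsilon> \<le> \<psi> g v} = \<psi> g -` {\<psi> g g + 2 * \<epsilon>..}" by auto
          then show ?thesis using convex_linear_vimage[OF lin, of "{\<psi> g g + 2 * \<epsilon>..}"] by simp
        qed
        then have "convex hull (y ` {n. A n}) \<subseteq> {v. \<psi> g g + 2 * \<epsilon> \<le> \<psi> g v}"
          using g(1) by (intro hull_minimal) (auto simp: A_def intro: less_imp_le)
        then have "\<psi> g g + 2 * \<epsilon> \<le> \<psi> g w" using wz by auto
        moreover have "\<psi> g z - \<psi> g g \<le> mnorm (z - g)"
          using dual_ball_le[OF \<psi>(1), of g "z - g"] by (simp add: dual_ball_diff[OF \<psi>(1)])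
        moreover have "\<psi> g w - \<psi> g z \<le> mnorm d"
          using dual_ball_le[OF \<psi>(1), of g d] by (simp add: wz(1) dual_ball_diff[OF \<psi>(1)])
        ultimately show ?thesis using g(2) by simp
      qed
      ultimately obtain f where f: "linear f" "\<And>x. f x \<le> mnorm x" "\<And>d. d \<in> W \<Longrightarrow> \<epsilon> \<le> f d"
        using mazur_orlicz[OF sublinear_mnorm, of W \<epsilon>] by blast
      have fb: "f \<in> dual_ball" using f by (simp add: dual_ball_def)
      have "f (y i) + \<epsilon> \<le> \<xi> f" if "i \<le> m" for i
      proof (rule tendsto_lowerbound[OF \<xi>[OF fb] _ nat_ultrafilter_neq_bot])
        show "\<forall>\<^sub>F n in ?U. f (y i) + \<epsilon> \<le> f (y n)"
        proof (rule eventually_mono[OF A])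
          fix n assume "A n"
          then have "y n - y i \<in> W" using that by (auto simp: W_def intro!: bexI hull_inc)
          then show "f (y i) + \<epsilon> \<le> f (y n)" using f(3)[of "y n - y i"] by (simp add: dual_ball_diff[OF fb])
        qed
      qed
      then show ?thesis using fb by blast
    qed
    then obtain \<phi> where \<phi>: "\<And>m. \<phi> m \<in> dual_ball" "\<And>m i. i \<le> m \<Longrightarrow> \<phi> m (y i) + \<epsilon> \<le> \<xi> (\<phi> m)" by metis
    \<comment> \<open>The pointwise ultralimit already lies in the dual ball. The subsequence
      \<open>r\<close> is extracted because dominated convergence is about sequences.\<close>
    define f where "f x = Lim ?U (\<lambda>m. \<phi> m x)" for x
    have f_lim: "((\<lambda>m. \<phi> m x) \<longlongrightarrow> f x) ?U" for x
      unfolding f_def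
      by (rule ultrafilter_bounded_limit[OF U always_eventually]) (use dual_ball_abs_le[OF \<phi>(1)] in blast)
    have "linear f"
    proof (rule linearI)
      fix a b
      have "((\<lambda>m. \<phi> m (a + b)) \<longlongrightarrow> f a + f b) ?U"
        using tendsto_add[OF f_lim[of a] f_lim[of b]] by (simp add: linear_add[OF dual_ball_linear[OF \<phi>(1)]])
      then show "f (a + b) = f a + f b" using tendsto_unique[OF nat_ultrafilter_neq_bot f_lim] by blast
    next
      fix c a
      have "((\<lambda>m. \<phi> m (c *\<^sub>R a)) \<longlongrightarrow> c *\<^sub>R f a) ?U"
        using tendsto_scaleR[OF tendsto_const[of c] f_lim[of a]] by (simp add: linear_scale[OF dual_ball_linear[OF \<phi>(1)]])
      then show "f (c *\<^sub>R a) = c *\<^sub>R f a" using tendsto_unique[OF nat_ultrafilter_neq_bot f_lim] by blast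
    qed
    moreover have "f x \<le> mnorm x" for x
      by (rule tendsto_upperbound[OF f_lim always_eventually nat_ultrafilter_neq_bot]) (use dual_ball_le[OF \<phi>(1)] in blast)
    ultimately have f: "f \<in> dual_ball" by (simp add: dual_ball_def)
    have "\<exists>\<^sub>F m in sequentially. \<forall>j\<in>{..i}. \<bar>\<phi> m (k j) - f (k j)\<bar> < inverse (real (Suc i))" for i
    proof (rule frequently_if_eventually_le[OF nat_ultrafilter(2) nat_ultrafilter_neq_bot])
      show "\<forall>\<^sub>F m in ?U. \<forall>j\<in>{..i}. \<bar>\<phi> m (k j) - f (k j)\<bar> < inverse (real (Suc i))"
        using tendstoD[OF f_lim] by (intro eventually_ball_finite ballI) (auto simp: dist_real_def)
    qed
    then obtain r where r: "strict_mono r"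
      and r_close: "\<And>i. \<forall>j\<in>{..i}. \<bar>\<phi> (r i) (k j) - f (k j)\<bar> < inverse (real (Suc i))"
      using frequently_imp_strict_mono[of "\<lambda>i m. \<forall>j\<in>{..i}. \<bar>\<phi> m (k j) - f (k j)\<bar> < inverse (real (Suc i))"]
      by blast
    define C where "C = {x. (\<lambda>m. \<phi> (r m) x - f x) \<longlonglongrightarrow> 0}"
    have "k j \<in> C" for j unfolding C_def
    proof (intro CollectI Lim_null_comparison[OF _ LIMSEQ_inverse_real_of_nat])
      show "\<forall>\<^sub>F m in sequentially. norm (\<phi> (r m) (k j) - f (k j)) \<le> inverse (real (Suc m))"
        using r_close by (intro eventually_sequentiallyI[of j]) (force intro: less_imp_le)
    qed
    moreover have "convex C" unfolding convex_alt
    proof (intro ballI allI impI)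
      fix a b t assume ab: "a \<in> C" "b \<in> C"
      have "(\<lambda>m. (1 - t) * (\<phi> (r m) a - f a) + t * (\<phi> (r m) b - f b)) \<longlonglongrightarrow> (1 - t) * 0 + t * 0"
        using ab by (intro tendsto_intros) (auto simp: C_def)
      also have "(\<lambda>m. (1 - t) * (\<phi> (r m) a - f a) + t * (\<phi> (r m) b - f b)) =
          (\<lambda>m. \<phi> (r m) ((1 - t) *\<^sub>R a + t *\<^sub>R b) - f ((1 - t) *\<^sub>R a + t *\<^sub>R b))"
        unfolding linear_add[OF dual_ball_linear[OF \<phi>(1)]] linear_scale[OF dual_ball_linear[OF \<phi>(1)]]
          linear_add[OF dual_ball_linear[OF f]] linear_scale[OF dual_ball_linear[OF f]]
        by (simp add: algebra_simps)
      finally show "(1 - t) *\<^sub>R a + t *\<^sub>R b \<in> C" by (simp add: C_def)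
    qed
    ultimately have hull_C: "convex hull (range k) \<subseteq> C" by (intro hull_minimal) auto
    have D_C: "(\<lambda>m. \<phi> (r m) d - f d) \<longlonglongrightarrow> 0" if d: "d \<in> D" for d
    proof (rule LIMSEQ_I)
      fix \<eta> :: real assume \<eta>: "0 < \<eta>"
      obtain c where c: "c \<in> convex hull (range k)" "mnorm (d - c) < \<eta> / 4"
        using sclD[of d _ "\<eta> / 4"] d \<eta> unfolding D_def by auto
      have "(\<lambda>m. \<phi> (r m) c - f c) \<longlonglongrightarrow> 0" using c(1) hull_C by (auto simp: C_def)
      then obtain m0 where m0: "\<And>m. m0 \<le> m \<Longrightarrow> \<bar>\<phi> (r m) c - f c\<bar> < \<eta> / 2"
        using LIMSEQ_D[of _ 0 "\<eta> / 2"] \<eta> by fastforce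
      have "norm (\<phi> (r m) d - f d - 0) < \<eta>" if "m0 \<le> m" for m
        using m0[OF that] c(2) dual_ball_abs_le[OF \<phi>(1), of "r m" "d - c"] dual_ball_abs_le[OF f, of "d - c"]
        unfolding dual_ball_diff[OF \<phi>(1)] dual_ball_diff[OF f] real_norm_def diff_0_right by linarith
      then show "\<exists>m0. \<forall>m\<ge>m0. norm (\<phi> (r m) d - f d - 0) < \<eta>" by blast
    qed
    \<comment> \<open>The error of \<open>\<phi> (r m)\<close> against \<open>f\<close>. Its mean
      \<open>L (g m)\<close> bounds how far \<xi> at \<open>\<phi> (r m)\<close> can exceed \<xi> at
      \<open>f\<close>, which is what permits exchanging the limits in \<open>m\<close> and
      \<open>n\<close>.\<close>
    define g where "g m x = \<bar>\<phi> (r m) x - f x\<bar>" for m x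
    have g_bound: "0 \<le> g m x \<and> g m x \<le> 2 * R" if "x \<in> K'" for m x
      using dual_ball_abs_le[OF \<phi>(1), of "r m" x] dual_ball_abs_le[OF f, of x] D_R[of x] that
      by (auto simp: g_def K'_def)
    then have g_bdd: "bounded (g m ` K')" for m by (intro boundedI[of _ "2 * R"]) auto
    have Lg: "(\<lambda>m. L (g m)) \<longlonglongrightarrow> 0"
    proof (rule positive_functional_dominated_convergence[where L = L and g = g and K = K' and conv = "\<lambda>s x. wlim s x sequentially" and C = "2 * R"])
      show "\<exists>r x. strict_mono r \<and> x \<in> K' \<and> wlim (s \<circ> r) x sequentially" if "\<And>n::nat. s n \<in> K'" for s
        using eberlein_smulian[OF K', of s] that by metis
      show "L h \<le> L h'" if "bounded (h ` K')" "bounded (h' ` K')" "\<And>x. x \<in> K' \<Longrightarrow> h x \<le> h' x" for h h'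
        using \<Lambda>_mono that(3) by (intro tendsto_le[OF nat_ultrafilter_neq_bot L[OF that(2)] L[OF that(1)]] always_eventually) blast
      show "L (\<lambda>x. h x + h' x) = L h + L h'" if "bounded (h ` K')" "bounded (h' ` K')" for h h'
        unfolding L_def[of "\<lambda>x. h x + h' x"] \<Lambda>_add
        using tendsto_add[OF L[OF that(1)] L[OF that(2)]] by (rule tendsto_Lim[OF nat_ultrafilter_neq_bot])
      show "L (\<lambda>x. c) = c" for c
        unfolding L_def \<Lambda>_const by (rule tendsto_Lim[OF nat_ultrafilter_neq_bot tendsto_const])
      show "(\<lambda>n. g m (s n)) \<longlonglongrightarrow> g m x" if "wlim s x sequentially" for m s x
        unfolding g_def
        by (intro tendsto_intros wlim_dualD[OF that] dual_ball_imp_dual \<phi>(1) f)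
      show "(\<lambda>m. g m x) \<longlonglongrightarrow> 0" if "x \<in> K'" for x
        unfolding g_def using that by (intro tendsto_rabs_zero D_C) (simp add: K'_def)
    qed (fact g_bound)
    have \<xi>_le: "\<xi> (\<phi> (r m)) \<le> \<xi> f + L (g m)" for m
    proof (rule tendsto_le[OF nat_ultrafilter_neq_bot tendsto_add[OF \<xi>[OF f] L[OF g_bdd]] \<xi>[OF \<phi>(1)]])
      have "\<phi> (r m) (y n) \<le> f (y n) + \<Lambda> n (g m)" for n
      proof -
        have "\<phi> (r m) v \<le> f v + g m v" for v by (simp add: g_def)
        then have "\<Lambda> n (\<phi> (r m)) \<le> \<Lambda> n (\<lambda>x. f x + g m x)" by (intro \<Lambda>_mono)
        then show ?thesis
          by (simp add: \<Lambda>_add \<Lambda>_linear[OF dual_ball_linear[OF f]] \<Lambda>_linear[OF dual_ball_linear[OF \<phi>(1)]])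
      qed
      then show "\<forall>\<^sub>F n in ?U. \<phi> (r m) (y n) \<le> f (y n) + \<Lambda> n (g m)" by simp
    qed
    \<comment> \<open>The limit in \<open>m\<close> keeps the gap \<epsilon> for every
      \<open>i\<close>, whereas \<open>\<xi> f\<close> is itself the ultralimit of the
      \<open>f (y i)\<close>.\<close>
    have "f (y i) + \<epsilon> \<le> \<xi> f" for i
    proof (rule LIMSEQ_le)
      show "(\<lambda>m. (\<phi> (r m) (y i) - f (y i)) + (f (y i) + \<epsilon>)) \<longlonglongrightarrow> f (y i) + \<epsilon>"
        using tendsto_add[OF D_C[of "y i"] tendsto_const[of "f (y i) + \<epsilon>"]] D(4) by auto
      show "(\<lambda>m. \<xi> f + L (g m)) \<longlonglongrightarrow> \<xi> f" using tendsto_add[OF tendsto_const[of "\<xi> f"] Lg] by simp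
      show "\<exists>m0. \<forall>m\<ge>m0. \<phi> (r m) (y i) - f (y i) + (f (y i) + \<epsilon>) \<le> \<xi> f + L (g m)"
      proof (intro exI[of _ i] allI impI)
        fix m assume "i \<le> m"
        then have "i \<le> r m" using seq_suble[OF r, of m] by simp
        then show "\<phi> (r m) (y i) - f (y i) + (f (y i) + \<epsilon>) \<le> \<xi> f + L (g m)"
          using \<phi>(2)[of i "r m"] \<xi>_le[of m] by simp
      qed
    qed
    then have "f (y i) \<le> \<xi> f - \<epsilon>" for i by (simp add: le_diff_eq)
    then have "\<xi> f \<le> \<xi> f - \<epsilon>"
      by (intro tendsto_upperbound[OF \<xi>[OF f] always_eventually nat_ultrafilter_neq_bot]) blast
    then show False using \<epsilon> by simp
  qed
  have "\<forall>m. \<exists>z. \<forall>f\<in>dual_ball. \<xi> f - f z \<le> inverse (real (Suc m))"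
    using approx[of "inverse (real (Suc m)) / 2" for m] by simp
  then obtain \<zeta> where \<zeta>: "\<And>m f. f \<in> dual_ball \<Longrightarrow> \<xi> f - f (\<zeta> m) \<le> inverse (real (Suc m))" by metis
  have \<xi>_uminus: "\<xi> (\<lambda>x. - f x) = - \<xi> f" if "f \<in> dual_ball" for f
    unfolding \<xi>_def[of "\<lambda>x. - f x"] by (rule tendsto_Lim[OF nat_ultrafilter_neq_bot tendsto_minus[OF \<xi>[OF that]]])
  have \<zeta>_abs: "\<bar>f (\<zeta> m) - \<xi> f\<bar> \<le> inverse (real (Suc m))" if "f \<in> dual_ball" for f m
    using \<zeta>[OF that, of m] \<zeta>[OF dual_ball_uminus[OF that], of m] \<xi>_uminus[OF that] by (simp add: abs_le_iff)
  have "mnorm (\<zeta> m - \<zeta> n) \<le> 1 * (inverse (real (Suc m)) + inverse (real (Suc n)))" for m n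
  proof -
    obtain f where f: "f \<in> dual_ball" "f (\<zeta> m - \<zeta> n) = mnorm (\<zeta> m - \<zeta> n)" by (rule norming_functional)
    then show ?thesis using \<zeta>_abs[OF f(1), of m] \<zeta>_abs[OF f(1), of n] by (simp add: dual_ball_diff[OF f(1)])
  qed
  then obtain z where z: "(\<lambda>m. mnorm (\<zeta> m - z)) \<longlonglongrightarrow> 0" by (rule strong_complete)
  have "wlim y z ?U" unfolding wlim_iff_dual_ball
  proof
    fix f assume f: "f \<in> dual_ball"
    have "(\<lambda>m. f (\<zeta> m) - \<xi> f) \<longlonglongrightarrow> 0"
      by (rule Lim_null_comparison[OF always_eventually[OF allI] LIMSEQ_inverse_real_of_nat]) (use \<zeta>_abs[OF f] in simp)
    then have "(\<lambda>m. f (\<zeta> m)) \<longlonglongrightarrow> \<xi> f" by (rule LIM_zero_cancel)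
    then have "f z = \<xi> f"
      using LIMSEQ_unique wlim_dualD[OF mnorm_tendsto_imp_wlim[OF z] dual_ball_imp_dual[OF f]] by blast
    then show "((\<lambda>n. f (y n)) \<longlongrightarrow> f z) ?U" using \<xi>[OF f] by simp
  qed
  then show ?thesis by (rule that)
qed

text \<open>Points of the closure are replaced by points of \<open>V\<close> at distance below
  \<open>inverse (real (Suc n))\<close>; a vanishing perturbation does not change weak
  limits.\<close>

lemma relatively_weakly_compact_scl:
  assumes E: "countable E" "scl V \<subseteq> scl E" and conv: "convex (scl V)"
    and lim: "\<And>x. (\<And>n::nat. x n \<in> V) \<Longrightarrow> \<exists>z. wlim x z nat_ultrafilter"
    and y: "\<And>n::nat. y n \<in> scl V"
  obtains r z where "strict_mono r" "z \<in> scl V" "wlim (y \<circ> r) z sequentially"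
proof -
  have "\<forall>n. \<exists>x. x \<in> V \<and> mnorm (y n - x) < inverse (real (Suc n))"
  proof
    fix n
    have "0 < inverse (real (Suc n))" by simp
    then show "\<exists>x. x \<in> V \<and> mnorm (y n - x) < inverse (real (Suc n))" using sclD[OF y[of n]] by blast
  qed
  then obtain x where x: "\<And>n. x n \<in> V" "\<And>n. mnorm (y n - x n) < inverse (real (Suc n))" by metis
  have in_scl: "z \<in> scl V" if "wlim (x \<circ> r) z F" "F \<noteq> bot" for r z and F :: "nat filter"
    using wlim_in_scl[OF conv that] x(1) scl_subset[of V] scl_scl[of V] by (auto simp: subset_iff)
  obtain r z where r: "strict_mono r" "wlim (x \<circ> r) z sequentially"
  proof (rule weak_subsequence_if_ultralimits[OF E(1), of x])
    fix r :: "nat \<Rightarrow> nat"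
    obtain z where "wlim (x \<circ> r) z nat_ultrafilter" using lim[of "x \<circ> r"] x(1) by auto
    then show "\<exists>z\<in>scl E. wlim (x \<circ> r) z nat_ultrafilter" using in_scl E(2) by fastforce
  qed (rule that)
  have "(\<lambda>n. mnorm ((y \<circ> r) n - (x \<circ> r) n)) \<longlonglongrightarrow> 0"
  proof (rule Lim_null_comparison)
    show "(\<lambda>n. inverse (real (Suc (r n)))) \<longlonglongrightarrow> 0"
      using LIMSEQ_subseq_LIMSEQ[OF LIMSEQ_inverse_real_of_nat r(1)] by (simp add: o_def)
    show "\<forall>\<^sub>F n in sequentially. norm (mnorm ((y \<circ> r) n - (x \<circ> r) n)) \<le> inverse (real (Suc (r n)))"
      using x(2) by (intro always_eventually) (auto simp: mnorm_nonneg intro: less_imp_le)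
  qed
  then have "wlim (y \<circ> r) z sequentially" by (rule wlim_strong_perturbation[OF r(2)])
  then show ?thesis using that r in_scl[OF r(2)] by simp
qed

theorem krein_smulian_sequence:
  assumes K: "compactin (weak_top N) K" and k: "\<And>j::nat. k j \<in> K" and R: "\<And>j. mnorm (k j) \<le> R"
  shows "compactin (weak_top N) (scl (convex hull (range k)))"
proof -
  obtain E where E: "countable E" "scl (convex hull (range k)) \<subseteq> scl E"
    using convex_hull_separable[of "range k"] by auto
  show ?thesis
  proof (rule weakly_compact_if_separable_seq_compact[OF E])
    fix y :: "nat \<Rightarrow> 'a" assume y: "\<And>n. y n \<in> scl (convex hull (range k))"
    have "\<exists>z. wlim x z nat_ultrafilter" if "\<And>n. x n \<in> convex hull (range k)" for x
      by (rule krein_ultralimit[OF K k R that]) (rule exI)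
    then obtain r z where "strict_mono r" "z \<in> scl (convex hull (range k))" "wlim (y \<circ> r) z sequentially"
      by (rule relatively_weakly_compact_scl[OF E convex_scl_convex[OF convex_convex_hull] _ y])
    then show "\<exists>r z. strict_mono r \<and> z \<in> scl (convex hull (range k)) \<and> wlim (y \<circ> r) z sequentially"
      by (intro exI conjI)
  qed
qed

text \<open>For each of the countably many elements of \<open>V\<close> a point \<open>k j\<close>
  of \<open>K\<close> is chosen. The closed hull of these points is weakly compact, and the set of
  points within \<open>r\<close> of it is convex, so it contains the hull of \<open>V\<close> with
  the same radius.\<close>

lemma mu_convex_hull_le:
  assumes V: "vbounded N V" "countable V" "V \<noteq> {}"
  shows "mu N (convex hull V) \<le> mu N V"
proof (rule mu_leI[OF V(1)])
  fix r assume "r \<in> mu_radii V"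
  then obtain K where K: "0 \<le> r" "compactin (weak_top N) K" "\<And>x. x \<in> V \<Longrightarrow> \<exists>k\<in>K. N (x - k) \<le> r"
    using mu_radiiD by metis
  define v where "v = from_nat_into V"
  have v: "range v = V" "\<And>j. v j \<in> V"
    using range_from_nat_into[OF V(3,2)] from_nat_into[OF V(3)] by (auto simp: v_def)
  have "\<forall>j. \<exists>k\<in>K. N (v j - k) \<le> r" using K(3) v by blast
  then obtain k where k: "\<And>j. k j \<in> K" "\<And>j. N (v j - k j) \<le> r" by metis
  obtain b where b: "\<And>x. x \<in> V \<Longrightarrow> N x \<le> b" using V(1) by (auto simp: vbounded_def)
  \<comment> \<open>The boundedness of the \<open>k j\<close> that the Krein argument asks for comes
    from \<open>V\<close> and from the radius \<open>r\<close>.\<close>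
  define R where "R = Max (range (\<lambda>i. b $ i + r $ i))"
  have "mnorm (k j) \<le> R" for j unfolding mnorm_le_iff
  proof
    fix i
    have "N (k j) $ i \<le> N (v j) $ i + N (v j - k j) $ i"
      using vnorm_component_triangle[of "v j" "- (v j - k j)" i] unfolding vnorm_minus by simp
    also have "\<dots> \<le> b $ i + r $ i"
      using b[OF v(2)] k(2) by (intro add_mono) (auto simp: less_eq_vec_def)
    also have "\<dots> \<le> R" unfolding R_def by simp
    finally show "N (k j) $ i \<le> R" .
  qed
  then have compact: "compactin (weak_top N) (scl (convex hull (range k)))"
    by (rule krein_smulian_sequence[OF K(2) k(1)])
  define C where "C = {x. \<exists>c\<in>scl (convex hull (range k)). N (x - c) \<le> r}"
  have "convex C" unfolding convex_alt
  proof (intro ballI allI impI)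
    fix x y t assume "x \<in> C" "y \<in> C" and t: "0 \<le> t \<and> t \<le> (1::real)"
    then obtain c d where cd: "c \<in> scl (convex hull (range k))" "N (x - c) \<le> r"
      "d \<in> scl (convex hull (range k))" "N (y - d) \<le> r" by (auto simp: C_def)
    have "N (((1 - t) *\<^sub>R x + t *\<^sub>R y) - ((1 - t) *\<^sub>R c + t *\<^sub>R d)) \<le> r"
      unfolding less_eq_vec_def
    proof
      fix i
      have "N (((1 - t) *\<^sub>R x + t *\<^sub>R y) - ((1 - t) *\<^sub>R c + t *\<^sub>R d)) $ i = N ((1 - t) *\<^sub>R (x - c) + t *\<^sub>R (y - d)) $ i"
        by (simp add: algebra_simps)
      also have "\<dots> \<le> (1 - t) * N (x - c) $ i + t * N (y - d) $ i"
        using vnorm_component_triangle[of "(1 - t) *\<^sub>R (x - c)" "t *\<^sub>R (y - d)" i] t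
        by (simp add: vnorm_component_scaleR)
      also have "\<dots> \<le> r $ i" using cd t by (intro convex_bound_le) (auto simp: less_eq_vec_def)
      finally show "N (((1 - t) *\<^sub>R x + t *\<^sub>R y) - ((1 - t) *\<^sub>R c + t *\<^sub>R d)) $ i \<le> r $ i" .
    qed
    moreover have "(1 - t) *\<^sub>R c + t *\<^sub>R d \<in> scl (convex hull (range k))"
      using convex_scl_convex[OF convex_convex_hull, of "range k"] cd t by (auto simp: convex_alt)
    ultimately show "(1 - t) *\<^sub>R x + t *\<^sub>R y \<in> C" unfolding C_def by blast
  qed
  moreover have "V \<subseteq> C"
  proof
    fix x assume "x \<in> V"
    then obtain j where "x = v j" using v(1) by blast
    moreover have "k j \<in> scl (convex hull (range k))"
      using scl_subset hull_inc[of "k j" "range k" convex] by blast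
    ultimately show "x \<in> C" unfolding C_def using k(2) by blast
  qed
  ultimately have "convex hull V \<subseteq> C" by (rule hull_minimal[rotated])
  then show "r \<in> mu_radii (convex hull V)" using K(1) compact by (intro mu_radiiI) (auto simp: C_def)
qed

subsection \<open>Fixed points\<close>

text \<open>The pseudometrics \<open>d n\<close> see finitely many functionals, and Schauder's
  projection with respect to them gives points moved by at most
  \<open>inverse (real (Suc n))\<close>. A weak subsequential limit of these is fixed because the
  \<open>g j\<close> separate points.\<close>

theorem weakly_seq_continuous_fixed_point:
  assumes D: "convex D" "D \<noteq> {}" and E: "countable E" "D \<subseteq> scl E"
    and seq: "\<And>y. (\<And>n::nat. y n \<in> D) \<Longrightarrow> \<exists>r z. strict_mono r \<and> z \<in> D \<and> wlim (y \<circ> r) z sequentially"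
    and T: "\<And>x. x \<in> D \<Longrightarrow> T x \<in> D"
    and T_cont: "\<And>s x. (\<And>n::nat. s n \<in> D) \<Longrightarrow> x \<in> D \<Longrightarrow> wlim s x sequentially \<Longrightarrow> wlim (\<lambda>n. T (s n)) (T x) sequentially"
  shows "\<exists>x\<in>D. T x = x"
proof -
  obtain g :: "nat \<Rightarrow> 'a \<Rightarrow> real" where g: "\<And>j. g j \<in> dual_ball"
    and sep: "\<And>x y. x \<in> scl E \<Longrightarrow> y \<in> scl E \<Longrightarrow> (\<And>j. g j x = g j y) \<Longrightarrow> x = y"
    using separating_functionals[OF E(1)] by blast
  note g_dual = dual_ball_imp_dual[OF g] and g_linear = dual_ball_linear[OF g]
  define d where "d n x y = (\<Sum>j\<le>n. \<bar>g j x - g j y\<bar>)" for n x y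
  have compact: "compactin (weak_top N) D"
    by (rule weakly_compact_if_separable_seq_compact[OF E seq])
  have approx: "\<exists>x\<in>D. d n x (T x) \<le> \<epsilon>" if \<epsilon>: "0 < \<epsilon>" for n \<epsilon>
  proof -
    have open_d: "openin (weak_top N) {z. d n z y < \<epsilon>}" for y
    proof -
      have "continuous_map (weak_top N) euclideanreal (\<lambda>z. \<bar>g j z - g j y\<bar>)" for j
        by (intro continuous_map_real_abs continuous_map_diff continuous_map_weak_dual[OF g_dual]) auto
      then have "continuous_map (weak_top N) euclideanreal (\<lambda>z. d n z y)"
        unfolding d_def by (intro continuous_map_sum) auto
      then have "openin (weak_top N) {z \<in> topspace (weak_top N). d n z y \<in> {..<\<epsilon>}}"
        by (rule openin_continuous_map_preimage) simp
      then show ?thesis by simp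
    qed
    have "\<exists>\<F>. finite \<F> \<and> \<F> \<subseteq> (\<lambda>y. {z. d n z y < \<epsilon>}) ` D \<and> D \<subseteq> \<Union>\<F>"
      by (rule compactinD[OF compact]) (use open_d \<epsilon> in \<open>auto simp: d_def\<close>)
    then obtain \<F> where \<F>: "finite \<F>" "\<F> \<subseteq> (\<lambda>y. {z. d n z y < \<epsilon>}) ` D" "D \<subseteq> \<Union>\<F>" by auto
    obtain F where F: "F \<subseteq> D" "finite F" "\<F> = (\<lambda>y. {z. d n z y < \<epsilon>}) ` F"
      using finite_subset_image[OF \<F>(1,2)] by auto
    have F_cover: "D \<subseteq> (\<Union>y\<in>F. {z. d n z y < \<epsilon>})" using \<F>(3) F(3) by simp
    define m where "m = card F"
    obtain y where y: "bij_betw y {0..<m} F" using ex_bij_betw_nat_finite[OF F(2)] by (auto simp: m_def)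
    have yD: "y i \<in> D" if "i < m" for i using y F(1) that by (auto simp: bij_betw_def)
    have cover: "\<exists>i<m. d n z (y i) < \<epsilon>" if zD: "z \<in> D" for z
    proof -
      obtain v where "v \<in> F" "d n z v < \<epsilon>" using F_cover zD by auto
      moreover then obtain i where "i < m" "v = y i" using y by (auto simp: bij_betw_def)
      ultimately show ?thesis by auto
    qed
    have "0 < m" using cover D(2) by fastforce
    \<comment> \<open>Weights subordinate to the finite cover: a centre \<open>y i\<close> at
      \<open>d n\<close>-distance at least \<epsilon> from \<open>z\<close> gets weight 0.\<close>
    define w where "w z i = max 0 (\<epsilon> - d n z (y i))" for z i
    define W where "W z = (\<Sum>i<m. w z i)" for z
    have w_nonneg: "0 \<le> w z i" for z i by (simp add: w_def)
    have W_pos: "0 < W z" if zD: "z \<in> D" for z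
    proof -
      obtain i where i: "i < m" "d n z (y i) < \<epsilon>" using cover[OF zD] by blast
      then have "0 < w z i" by (simp add: w_def)
      also have "\<dots> \<le> W z" unfolding W_def using i w_nonneg by (intro member_le_sum) auto
      finally show ?thesis .
    qed
    \<comment> \<open>the whole cube parametrises convex combinations: missing mass goes to \<open>y 0\<close>, excess is divided out\<close>
    define c where "c u i = (u i + (if i = 0 then max 0 (1 - (\<Sum>i<m. u i)) else 0)) / max 1 (\<Sum>i<m. u i)"
      for u :: "nat \<Rightarrow> real" and i
    define X where "X u = (\<Sum>i<m. c u i *\<^sub>R y i)" for u
    \<comment> \<open>A fixed point \<open>u\<close> of \<open>G\<close> makes \<open>X u\<close>
      the Schauder projection of \<open>T (X u)\<close>, hence close to it. On coefficients,
      continuity concerns only finitely many real sequences.\<close>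
    define G where "G u i = w (T (X u)) i / W (T (X u))" for u i
    let ?Q = "{u. \<forall>i<m. 0 \<le> u i \<and> u i \<le> (1::real)}"
    have X_D: "X u \<in> D" if "u \<in> ?Q" for u
      unfolding X_def
    proof (rule convex_sum)
      have "(\<Sum>i<m. c u i) = (\<Sum>i<m. u i + (if i = 0 then max 0 (1 - (\<Sum>i<m. u i)) else 0)) / max 1 (\<Sum>i<m. u i)"
        by (simp add: c_def sum_divide_distrib)
      also have "\<dots> = 1" using \<open>0 < m\<close> by (simp add: sum.distrib max_def)
      finally show "(\<Sum>i<m. c u i) = 1" .
      show "0 \<le> c u i" if "i \<in> {..<m}" for i using that \<open>u \<in> ?Q\<close> by (auto simp: c_def)
    qed (use D yD in auto)
    obtain u where u: "u \<in> ?Q" "\<And>i. i < m \<Longrightarrow> G u i = u i"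
    proof (rule brouwer_unit_cube_sequential[of m G])
      fix u i assume u: "u \<in> ?Q" and i: "i < m"
      have "w (T (X u)) i \<le> W (T (X u))" unfolding W_def using i w_nonneg by (intro member_le_sum) auto
      then show "0 \<le> G u i \<and> G u i \<le> 1" using w_nonneg W_pos[OF T[OF X_D[OF u]]] by (simp add: G_def)
    next
      fix s u i assume s: "\<And>k::nat. s k \<in> ?Q" and u: "u \<in> ?Q" and i: "i < m"
        and lim: "\<And>i. i < m \<Longrightarrow> (\<lambda>k. s k i) \<longlonglongrightarrow> u i"
      have c_lim: "(\<lambda>k. c (s k) i) \<longlonglongrightarrow> c u i" if "i < m" for i
        unfolding c_def using lim that by (cases "i = 0") (auto intro!: tendsto_intros tendsto_max)
      have "wlim (\<lambda>k. X (s k)) (X u) sequentially" unfolding wlim_iff X_def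
        by (auto simp: linear_sum[OF dual_linear] linear_scale[OF dual_linear] intro!: tendsto_intros c_lim)
      then have TX: "wlim (\<lambda>k. T (X (s k))) (T (X u)) sequentially"
        by (rule T_cont[OF X_D[OF s] X_D[OF u]])
      have w_lim: "(\<lambda>k. w (T (X (s k))) i) \<longlonglongrightarrow> w (T (X u)) i" for i
        unfolding w_def d_def by (intro tendsto_intros tendsto_max wlim_dualD[OF TX g_dual])
      then show "(\<lambda>k. G (s k) i) \<longlonglongrightarrow> G u i"
        unfolding G_def W_def using W_pos[OF T[OF X_D[OF u]]]
        by (intro tendsto_intros) (auto simp: W_def)
    qed (rule that)
    define z where "z = T (X u)"
    have zD: "z \<in> D" unfolding z_def by (intro T X_D u)
    have u_eq: "u i = w z i / W z" if "i < m" for i using u(2)[OF that] by (simp add: G_def z_def)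
    have u_sum: "(\<Sum>i<m. u i) = 1"
      using W_pos[OF zD] by (simp add: u_eq sum_divide_distrib[symmetric] W_def[symmetric])
    \<comment> \<open>At a fixed point the coefficients already sum to 1, so the correction in
      \<open>c\<close> vanishes.\<close>
    have "c u i = u i" for i by (cases "i = 0") (simp_all add: c_def u_sum)
    then have X_eq: "X u = (\<Sum>i<m. u i *\<^sub>R y i)" by (simp add: X_def)
    have u_nonneg: "0 \<le> u i" if "i < m" for i using u(1) that by auto
    have "\<bar>g j (X u) - g j z\<bar> \<le> (\<Sum>i<m. u i * \<bar>g j z - g j (y i)\<bar>)" for j
    proof -
      have "g j (X u) - g j z = (\<Sum>i<m. u i * g j (y i)) - (\<Sum>i<m. u i) * g j z"
        by (simp add: X_eq u_sum linear_sum[OF g_linear] linear_scale[OF g_linear])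
      also have "\<dots> = (\<Sum>i<m. u i * (g j (y i) - g j z))"
        by (simp add: sum_distrib_right sum_subtractf[symmetric] right_diff_distrib)
      also have "\<bar>\<dots>\<bar> \<le> (\<Sum>i<m. \<bar>u i * (g j (y i) - g j z)\<bar>)" by (rule sum_abs)
      also have "\<dots> = (\<Sum>i<m. u i * \<bar>g j z - g j (y i)\<bar>)"
        using u_nonneg by (intro sum.cong) (auto simp: abs_mult abs_minus_commute)
      finally show ?thesis .
    qed
    then have "d n (X u) z \<le> (\<Sum>j\<le>n. \<Sum>i<m. u i * \<bar>g j z - g j (y i)\<bar>)"
      unfolding d_def by (intro sum_mono)
    also have "\<dots> = (\<Sum>i<m. u i * d n z (y i))"
      unfolding d_def by (subst sum.swap) (simp add: sum_distrib_left)
    also have "\<dots> \<le> (\<Sum>i<m. u i * \<epsilon>)"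
    proof (rule sum_mono)
      fix i assume i: "i \<in> {..<m}"
      show "u i * d n z (y i) \<le> u i * \<epsilon>"
      proof (cases "d n z (y i) \<le> \<epsilon>")
        case True
        then show ?thesis using u_nonneg i by (intro mult_left_mono) auto
      next
        case False
        then show ?thesis using u_eq i by (simp add: w_def)
      qed
    qed
    also have "\<dots> = \<epsilon>" by (simp add: sum_distrib_right[symmetric] u_sum)
    finally show ?thesis using X_D[OF u(1)] by (auto simp: z_def)
  qed
  have "\<forall>n. \<exists>x. x \<in> D \<and> d n x (T x) \<le> inverse (real (Suc n))" using approx by (metis inverse_positive_iff_positive of_nat_0_less_iff zero_less_Suc)
  then obtain x where x: "\<And>n. x n \<in> D" "\<And>n. d n (x n) (T (x n)) \<le> inverse (real (Suc n))" by metis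
  obtain r z where r: "strict_mono r" "z \<in> D" "wlim (x \<circ> r) z sequentially" using seq[of x] x(1) by auto
  have Tz: "wlim (\<lambda>n. T ((x \<circ> r) n)) (T z) sequentially" by (rule T_cont[OF _ r(2,3)]) (simp add: x(1))
  have "g j z = g j (T z)" for j
  proof -
    have "(\<lambda>n. g j ((x \<circ> r) n) - g j (T ((x \<circ> r) n))) \<longlonglongrightarrow> 0"
    proof (rule Lim_null_comparison[OF eventually_sequentiallyI LIMSEQ_inverse_real_of_nat])
      fix n assume "j \<le> n"
      have "n \<le> r n" by (rule seq_suble[OF r(1)])
      have "\<bar>g j (x (r n)) - g j (T (x (r n)))\<bar> \<le> d (r n) (x (r n)) (T (x (r n)))"
        unfolding d_def using \<open>j \<le> n\<close> \<open>n \<le> r n\<close>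
        by (intro member_le_sum[of j _ "\<lambda>j. \<bar>g j (x (r n)) - g j (T (x (r n)))\<bar>"]) auto
      also have "\<dots> \<le> inverse (real (Suc (r n)))" by (rule x(2))
      also have "\<dots> \<le> inverse (real (Suc n))" using \<open>n \<le> r n\<close> by (intro le_imp_inverse_le) auto
      finally show "norm (g j ((x \<circ> r) n) - g j (T ((x \<circ> r) n))) \<le> inverse (real (Suc n))" by simp
    qed
    moreover have "(\<lambda>n. g j ((x \<circ> r) n) - g j (T ((x \<circ> r) n))) \<longlonglongrightarrow> g j z - g j (T z)"
      by (intro tendsto_diff wlim_dualD[OF r(3) g_dual] wlim_dualD[OF Tz g_dual])
    ultimately have "g j z - g j (T z) = 0" using LIMSEQ_unique by blast
    then show ?thesis by simp
  qed
  then have "T z = z" using sep[of "T z" z] E(2) r(2) T[OF r(2)] by auto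
  then show ?thesis using r(2) by (rule bexI)
qed

section \<open>The composed operator and its fixed point\<close>

lemma vbounded_subset: "vbounded N W \<Longrightarrow> V \<subseteq> W \<Longrightarrow> vbounded N V"
  unfolding vbounded_def by blast

lemma vbounded_sum:
  assumes "vbounded N V" "vbounded N W" shows "vbounded N {v + w | v w. v \<in> V \<and> w \<in> W}"
proof -
  obtain r s where rs: "\<And>x. x \<in> V \<Longrightarrow> N x \<le> r" "\<And>x. x \<in> W \<Longrightarrow> N x \<le> s"
    using assms by (auto simp: vbounded_def)
  have "N (v + w) \<le> r + s" if "v \<in> V" "w \<in> W" for v w
    using vnorm_triangle[of v w] add_mono[OF rs(1)[OF that(1)] rs(2)[OF that(2)]] by (rule order_trans)
  then show ?thesis unfolding vbounded_def by blast
qed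

lemma mu_le_0_imp_weak_subsequence:
  assumes V: "vbounded N V" "mu N V \<le> 0" and y: "\<And>n::nat. y n \<in> V"
  obtains r z where "strict_mono r" "wlim (y \<circ> r) z sequentially"
proof -
  obtain E where E: "countable E" "scl (convex hull (range y)) \<subseteq> scl E"
    using convex_hull_separable[of "range y"] by auto
  have "\<exists>z\<in>scl E. wlim (y \<circ> r) z nat_ultrafilter" for r
  proof -
    obtain z where z: "wlim (y \<circ> r) z nat_ultrafilter"
      by (rule mu_le_0_imp_ultralimit[OF V _ nat_ultrafilter(1), of "y \<circ> r"]) (use y in auto)
    have "z \<in> scl (convex hull (range y))"
      by (rule wlim_in_scl[OF convex_convex_hull z nat_ultrafilter_neq_bot]) (simp add: hull_inc)
    then show ?thesis using E(2) z by (intro bexI[of _ z]) auto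
  qed
  then obtain r z where "strict_mono r" "wlim (y \<circ> r) z sequentially"
    using weak_subsequence_if_ultralimits[OF E(1), of y] by metis
  then show ?thesis by (rule that)
qed

text \<open>The product structure is condensed into the equivalence of \<open>F x = B y\<close> and
  \<open>x = T y\<close>, so the argument runs in a generalized Banach space.\<close>

theorem two_operator_fixed_point:
  assumes S: "S \<noteq> {}" "vbounded N S" "closedin (strong_top N) S" "convex S"
    and B: "mu_contraction_on N S M1 B" "weakly_seq_continuous_on N S B"
    and F: "mu_contraction_on N UNIV M2 (\<lambda>x. x - F x)" "weakly_seq_continuous_on N UNIV F"
    and T: "\<And>y. y \<in> S \<Longrightarrow> T y \<in> S" "\<And>x y. y \<in> S \<Longrightarrow> F x = B y \<longleftrightarrow> x = T y"
    and M: "converges_to_zero (matrix_inv (mat 1 - M2) ** M1)"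
  shows "\<exists>x\<in>S. T x = x"
proof -
  have M1: "0 \<le> M1 $ i $ j" for i j using B(1) by (simp add: mu_contraction_on_def)
  have M2: "0 \<le> M2 $ i $ j" "converges_to_zero M2" for i j using F(1) by (simp_all add: mu_contraction_on_def)
  have bdd: "vbounded N V" if "V \<subseteq> S" for V using vbounded_subset[OF S(2) that] .
  have TS: "T ` V \<subseteq> S" if "V \<subseteq> S" for V using T(1) that by auto
  have mu_T: "mu N (T ` V) \<le> M1 *v mu N V + M2 *v mu N (T ` V)" if V: "V \<subseteq> S" "V \<noteq> {}" for V
  proof -
    let ?P = "(\<lambda>x. x - F x) ` T ` V"
    have bB: "vbounded N (B ` V)" and B_le: "mu N (B ` V) \<le> M1 *v mu N V"
      using B(1) V bdd[OF V(1)] by (auto simp: mu_contraction_on_def)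
    have bP: "vbounded N ?P" and P_le: "mu N ?P \<le> M2 *v mu N (T ` V)"
      using F(1) V bdd[OF TS[OF V(1)]] by (auto simp: mu_contraction_on_def)
    have "T ` V \<subseteq> {v + w | v w. v \<in> B ` V \<and> w \<in> ?P}"
    proof
      fix x assume "x \<in> T ` V"
      then obtain y where y: "y \<in> V" "x = T y" by auto
      then have "F x = B y" using T(2) V by auto
      then have "x = B y + (x - F x)" by simp
      then show "x \<in> {v + w | v w. v \<in> B ` V \<and> w \<in> ?P}" using y by blast
    qed
    then have "mu N (T ` V) \<le> mu N {v + w | v w. v \<in> B ` V \<and> w \<in> ?P}"
      by (intro mu_mono vbounded_sum bB bP)
    also have "\<dots> \<le> mu N (B ` V) + mu N ?P" by (rule mu_sum_le[OF bB bP])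
    also have "\<dots> \<le> M1 *v mu N V + M2 *v mu N (T ` V)" using B_le P_le by (rule add_mono)
    finally show ?thesis .
  qed
  have T_cont: "wlim (\<lambda>n. T (s n)) (T x) sequentially"
    if s: "\<And>n::nat. s n \<in> S" and x: "x \<in> S" and lim: "wlim s x sequentially" for s x
  proof -
    let ?V = "range s"
    have V: "?V \<subseteq> S" using s by auto
    \<comment> \<open>A convergent sequence together with its limit is weakly compact and so has
      measure zero. The term with \<open>M1\<close> then drops out, and \<open>M2\<close> alone
      forces the image to have measure zero.\<close>
    have "compactin (weak_top N) (insert x ?V)"
      by (rule compactin_sequence_with_limit[OF lim]) auto
    then have "mu N ?V \<le> 0" by (rule mu_weakly_compact_le_0) auto
    then have "mu N ?V = 0" using mu_nonneg[OF bdd[OF V]] by (rule order_antisym)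
    then have "mu N (T ` ?V) \<le> M2 *v mu N (T ` ?V)" using mu_T[OF V] by simp
    then have TV: "mu N (T ` ?V) \<le> 0"
      using converges_to_zero_subinvariant[OF M2 mu_nonneg[OF bdd[OF TS[OF V]]]] by simp
    show ?thesis unfolding wlim_iff
    proof (intro allI impI)
      fix f assume f: "dual f"
      show "(\<lambda>n. f (T (s n))) \<longlonglongrightarrow> f (T x)"
      proof (rule ccontr)
        assume "\<not> ?thesis"
        then obtain \<epsilon> where \<epsilon>: "0 < \<epsilon>" "\<exists>\<^sub>F n in sequentially. \<epsilon> \<le> \<bar>f (T (s n)) - f (T x)\<bar>"
          by (auto simp: tendsto_iff frequently_def dist_real_def not_le)
        then obtain r where r: "strict_mono r" "\<And>k::nat. \<epsilon> \<le> \<bar>f (T (s (r k))) - f (T x)\<bar>"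
          using frequently_imp_strict_mono[of "\<lambda>k n. \<epsilon> \<le> \<bar>f (T (s n)) - f (T x)\<bar>"] by auto
        \<comment> \<open>Only some subsequential limit \<open>z\<close> is available at first. Weak
          sequential continuity of \<open>B\<close> and \<open>F\<close> gives
          \<open>F z = B x\<close>, hence \<open>z = T x\<close>, against the distance
          \<epsilon>.\<close>
        obtain r' z where r': "strict_mono r'" "wlim ((\<lambda>k. T (s (r k))) \<circ> r') z sequentially"
          by (rule mu_le_0_imp_weak_subsequence[OF bdd[OF TS[OF V]] TV, of "\<lambda>k. T (s (r k))"]) auto
        define q where "q = s \<circ> (r \<circ> r')"
        have qS: "q k \<in> S" for k using s by (simp add: q_def)
        have Tq: "wlim (\<lambda>k. T (q k)) z sequentially" using r'(2) by (simp add: q_def o_def)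
        have "wlim q x sequentially"
          unfolding q_def by (rule wlim_subseq[OF lim strict_mono_o[OF r(1) r'(1)]])
        then have "wlim (\<lambda>k. B (q k)) (B x) sequentially"
          using B(2) qS x unfolding weakly_seq_continuous_on_def by blast
        moreover have "wlim (\<lambda>k. F (T (q k))) (F z) sequentially"
          using F(2) Tq unfolding weakly_seq_continuous_on_def by simp
        moreover have "F (T (q k)) = B (q k)" for k using T(2)[OF qS] by simp
        ultimately have "F z = B x" using wlim_unique by fastforce
        then have "z = T x" using T(2)[OF x] by simp
        then have "(\<lambda>k. f (T (q k))) \<longlonglongrightarrow> f (T x)" using wlim_dualD[OF Tq f] by simp
        then have "\<forall>\<^sub>F k in sequentially. \<bar>f (T (q k)) - f (T x)\<bar> < \<epsilon>"
          using \<epsilon>(1) by (auto simp: tendsto_iff dist_real_def)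
        then obtain k where "\<bar>f (T (q k)) - f (T x)\<bar> < \<epsilon>" by (auto simp: eventually_sequentially)
        then show False using r(2)[of "r' k"] by (simp add: q_def)
      qed
    qed
  qed
  obtain x0 where x0: "x0 \<in> S" using S(1) by auto
  obtain Q where Q: "countable Q" "{x0} \<subseteq> Q" "T ` Q \<subseteq> Q" "rat_convex Q"
    and Q_least: "\<forall>P. {x0} \<subseteq> P \<longrightarrow> (\<forall>x\<in>P \<inter> Q. T x \<in> P) \<longrightarrow> rat_convex P \<longrightarrow> Q \<subseteq> P"
    by (rule countable_rat_convex_closure[of "{x0}" T]) simp
  have QS: "Q \<subseteq> S" using x0 T(1) convex_imp_rat_convex[OF S(4)] by (intro Q_least[rule_format]) auto
  \<comment> \<open>Invariance of the hull is tested at points of \<open>Q\<close> only, whose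
    images lie in it by construction.\<close>
  have Q_hull: "Q \<subseteq> convex hull (insert x0 (T ` Q))"
    by (intro Q_least[rule_format] convex_imp_rat_convex convex_convex_hull) (auto simp: hull_inc)
  have sub: "insert x0 (T ` Q) \<subseteq> S" using x0 TS[OF QS] by simp
  have "mu N Q \<le> mu N (convex hull (insert x0 (T ` Q)))"
    using sub S(4) by (intro mu_mono Q_hull bdd hull_minimal)
  also have "\<dots> \<le> mu N (insert x0 (T ` Q))"
    using Q(1) by (intro mu_convex_hull_le bdd sub) auto
  also have "\<dots> \<le> mu N (T ` Q)" by (intro mu_insert_le bdd TS QS)
  finally have Q_le: "mu N Q \<le> mu N (T ` Q)" .
  have "mu N (T ` Q) \<le> M1 *v mu N Q + M2 *v mu N (T ` Q)" using Q(2) by (intro mu_T QS) auto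
  also have "\<dots> \<le> M1 *v mu N (T ` Q) + M2 *v mu N (T ` Q)"
    by (intro add_right_mono matrix_vector_mult_mono M1 Q_le)
  finally have "mu N (T ` Q) = 0"
    by (rule two_matrix_subinvariant[OF M1 M2 M mu_nonneg[OF bdd[OF TS[OF QS]]]])
  then have mu_Q: "mu N Q \<le> 0" using Q_le by simp
  have convex: "convex (scl Q)" by (rule convex_scl_rat[OF Q(4)])
  have "scl Q \<subseteq> scl S" by (rule scl_mono[OF QS])
  then have DS: "scl Q \<subseteq> S" using S(3) unfolding closedin_strong_iff by blast
  \<comment> \<open>Norm convergence implies weak convergence, and weak limits of points of a convex
    norm-closed set stay in it, so weak sequential continuity keeps the closure invariant.\<close>
  have T_D: "T x \<in> scl Q" if x: "x \<in> scl Q" for x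
  proof -
    have "\<exists>q. q \<in> Q \<and> mnorm (x - q) < inverse (real (Suc n))" for n
      using sclD[OF x, of "inverse (real (Suc n))"] by auto
    then obtain q where q: "\<And>n. q n \<in> Q" "\<And>n. mnorm (x - q n) < inverse (real (Suc n))" by metis
    have "(\<lambda>n. mnorm (q n - x)) \<longlonglongrightarrow> 0"
      by (rule Lim_null_comparison[OF always_eventually[OF allI] LIMSEQ_inverse_real_of_nat])
         (use q(2) in \<open>auto simp: mnorm_nonneg mnorm_minus_commute intro: less_imp_le\<close>)
    then have "wlim (\<lambda>n. T (q n)) (T x) sequentially"
      using q(1) QS DS x by (intro T_cont mnorm_tendsto_imp_wlim) auto
    moreover have "T (q n) \<in> scl Q" for n using q(1)[of n] Q(3) scl_subset[of Q] by blast
    ultimately have "T x \<in> scl (scl Q)" by (intro wlim_in_scl[OF convex]) auto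
    then show ?thesis using scl_scl by blast
  qed
  show "\<exists>x\<in>S. T x = x"
  proof -
    have "\<exists>x\<in>scl Q. T x = x"
    proof (rule weakly_seq_continuous_fixed_point[OF convex _ Q(1) order_refl _ T_D])
      show "scl Q \<noteq> {}" using Q(2) scl_subset[of Q] by auto
      show "wlim (\<lambda>n. T (s n)) (T x) sequentially"
        if "\<And>n::nat. s n \<in> scl Q" "x \<in> scl Q" "wlim s x sequentially" for s x
        using that DS by (intro T_cont) auto
      fix y :: "nat \<Rightarrow> 'a" assume y: "\<And>n. y n \<in> scl Q"
      have "\<exists>z. wlim w z nat_ultrafilter" if "\<And>n. w n \<in> Q" for w
        by (rule mu_le_0_imp_ultralimit[OF bdd[OF QS] mu_Q that nat_ultrafilter(1)]) (rule exI)
      then obtain r z where "strict_mono r" "z \<in> scl Q" "wlim (y \<circ> r) z sequentially"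
        by (rule relatively_weakly_compact_scl[OF Q(1) order_refl convex _ y])
      then show "\<exists>r z. strict_mono r \<and> z \<in> scl Q \<and> wlim (y \<circ> r) z sequentially"
        by (intro exI conjI)
    qed
    then show ?thesis using DS by blast
  qed
qed

end

section \<open>The operator equation\<close>

text \<open>Left multiplication by the inverse of \<open>A x\<close> solves the defining equation
  uniquely, so the description in \<open>quot_op\<close> denotes.\<close>

lemma quot_op_eq_iff:
  assumes e: "unit_elem e" and inv: "invertible_elem e (A x)"
  shows "quot_op A C x = z \<longleftrightarrow> A x * z = x - C x"
proof -
  obtain b where b: "A x * b = e" "b * A x = e" using inv by (auto simp: invertible_elem_def)
  have unit: "e * u = u" for u using e by (simp add: unit_elem_def)
  have ex1: "\<exists>!z. A x * z = x - C x"
  proof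
    show "A x * (b * (x - C x)) = x - C x" by (simp add: mult.assoc[symmetric] b unit)
    fix z assume "A x * z = x - C x"
    then have "b * (x - C x) = (b * A x) * z" by (simp add: mult.assoc)
    then show "z = b * (x - C x)" by (simp add: b unit)
  qed
  show ?thesis
    unfolding quot_op_def using theI'[OF ex1] the1_equality[OF ex1, of z] by auto
qed

theorem theorem3p4:
  fixes N :: "'a::real_algebra \<Rightarrow> real ^ 'n"
    and e :: 'a
    and S :: "'a set"
    and A B C :: "'a \<Rightarrow> 'a"
    and M1 M2 :: "real ^ 'n ^ 'n"
  assumes "generalized_banach_algebra N" and "unit_elem e"
    and "S \<noteq> {}" and "vbounded N S" and "closedin (strong_top N) S" and "convex S"
    and i: "\<forall>x. invertible_elem e (A x)"
    and ii: "mu_contraction_on N S M1 B"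
      "mu_contraction_on N UNIV M2 (\<lambda>x. x - quot_op A C x)"
    and iii: "weakly_seq_continuous_on N S B"
      "weakly_seq_continuous_on N UNIV (quot_op A C)"
    and iv: "\<forall>z \<in> B ` S. \<exists>!x. quot_op A C x = z"
    and v: "\<forall>x. \<forall>y\<in>S. x = A x * B y + C x \<longrightarrow> x \<in> S"
    and "converges_to_zero (matrix_inv (mat 1 - M2) ** M1)"
  shows "\<exists>x\<in>S. x = A x * B x + C x"
proof -
  interpret generalized_banach_algebra N by fact
  \<comment> \<open>In this form \<open>z = B y\<close> yields the equation in condition (v), and
    \<open>z = B x\<close> the equation to be solved.\<close>
  have quot: "quot_op A C x = z \<longleftrightarrow> x = A x * z + C x" for x z
    using quot_op_eq_iff[of e A x C z] \<open>unit_elem e\<close> i by (auto simp: algebra_simps)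
  define T where "T y = (THE x. quot_op A C x = B y)" for y
  have T: "quot_op A C x = B y \<longleftrightarrow> x = T y" if "y \<in> S" for x y
  proof -
    have ex1: "\<exists>!x. quot_op A C x = B y" using iv that by blast
    show ?thesis unfolding T_def using theI'[OF ex1] the1_equality[OF ex1] by blast
  qed
  have "T y \<in> S" if "y \<in> S" for y
  proof -
    have "T y = A (T y) * B y + C (T y)" using T[OF that, of "T y"] by (simp add: quot)
    then show ?thesis using v that by blast
  qed
  then obtain x where x: "x \<in> S" "T x = x"
    using two_operator_fixed_point[OF assms(3-6) ii(1) iii(1) ii(2) iii(2) _ T assms(14)] by blast
  then have "quot_op A C x = B x" using T[OF x(1), of x] by simp
  then show ?thesis using x(1) quot by blast
qed

end
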